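(* Let $f_0:\mathbb{C}\to\hat{\mathbb{C}}$ be a transcendental meromorphic function of finite order $\rho>0$ satisfying: (KU1) $\infty$ is not an asymptotic value of $f_0$; (KU2) there exist a co-finite subset $\mathcal{P}^*$ of the set $\mathcal{P}$ of poles and $R^*>0$ with $\mathrm{dist}(\mathrm{Sing}(f_0^{-1}),a)>2R^*$ for all $a\in\mathcal{P}^*$; (KU3) there is $R^\dagger>0$ with $B(a_1,R^\dagger)\cap B(a_2,R^\dagger)=\emptyset$ for distinct poles; (KU4) there exist $M\in\mathbb{N}$, $\beta\geq0$ such that for each $a\in\mathcal{P}^*$, $1\leq m(a)\leq M$ and $|f_0(z)|\asymp|a|^{-\beta}|z-a|^{-m(a)}$, $|f_0'(z)|\asymp m(a)|a|^{-\beta}|z-a|^{-m(a)-1}$ for $z\in B(a,R^\dagger)$. Then there is $\varepsilon>0$ such that if $|c_n|<\varepsilon$ for all $n$, then $$\frac{\rho M^*}{\beta+M^*+1}\leq\mathrm{EHD}(F_+)\leq\mathrm{ED}(F_+)\leq\frac{\rho M}{\beta+M+1}.$$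
   Context: $m(a)$ is pole multiplicity; $\mathrm{Sing}(f^{-1})$ the finite critical and asymptotic values; $A\asymp B$ means $C^{-1}A\leq B\leq CA$, $C\geq1$ independent of $a,z$. $M^*$ is the largest integer $1\leq M^*\leq M$ such that $\sum_{a\in\mathcal{P},m(a)=M^*}|a|^{-t}$ converges for $t>\rho$ and diverges for $t<\rho$. $f_n=f_0+c_n$, $F_+^n=f_n\circ\dots\circ f_1$. $\mathcal{J}(F_+)$ is the complement of the set of points with a neighborhood on which all $F_+^n$ are defined and normal; $\mathcal{J}_r(F_+)$ is the set of $z\in\mathcal{J}(F_+)$ with all $F_+^n(z)$ defined and some $\delta>0$ such that for infinitely many $n$, $B(F_+^n(z),\delta)$ pulls back univalently along the orbit of $z$. $\mathrm{ED}(F)=\lim_{R\to\infty}\mathrm{HD}\{z\in\mathcal{J}(F):|F^n(z)|>R\ \forall n\geq1\}$, $\mathrm{EHD}(F)=\lim_{R\to\infty}\mathrm{HD}\{z\in\mathcal{J}_r(F):|F^n(z)|>R\ \forall n\geq1\}$. *)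

theory Defs
  imports "HOL-Complex_Analysis.Complex_Analysis" "HOL-Computational_Algebra.Polynomial"
begin

text \<open>A meromorphic function f : C -> C-hat is represented by a total function
  complex => complex; its values at poles are irrelevant (junk).\<close>

definition poles :: "(complex \<Rightarrow> complex) \<Rightarrow> complex set" where
  "poles f = {z. is_pole f z}"

definition pole_mult :: "(complex \<Rightarrow> complex) \<Rightarrow> complex \<Rightarrow> nat" where
  "pole_mult f a = nat (- zorder f a)"

definition plane_meromorphic :: "(complex \<Rightarrow> complex) \<Rightarrow> bool" where
  "plane_meromorphic f \<longleftrightarrow> f meromorphic_on UNIV \<and> f holomorphic_on (UNIV - poles f)"

definition rational_function :: "(complex \<Rightarrow> complex) \<Rightarrow> bool" where
  "rational_function f \<longleftrightarrow>
     (\<exists>p q :: complex poly. q \<noteq> 0 \<and> (\<forall>z. poly q z \<noteq> 0 \<longrightarrow> f z = poly p z / poly q z))"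

definition transcendental_meromorphic :: "(complex \<Rightarrow> complex) \<Rightarrow> bool" where
  "transcendental_meromorphic f \<longleftrightarrow> plane_meromorphic f \<and> \<not> rational_function f"

definition pole_count :: "(complex \<Rightarrow> complex) \<Rightarrow> real \<Rightarrow> real" where
  "pole_count f r = real (\<Sum>a\<in>poles f \<inter> cball 0 r. pole_mult f a)"

definition nev_N :: "(complex \<Rightarrow> complex) \<Rightarrow> real \<Rightarrow> real" where
  "nev_N f r = integral {0..r} (\<lambda>t. (pole_count f t - pole_count f 0) / t)
               + pole_count f 0 * ln r"

definition nev_m :: "(complex \<Rightarrow> complex) \<Rightarrow> real \<Rightarrow> real" where
  "nev_m f r = (1 / (2 * pi)) * integral {0..2*pi} (\<lambda>\<theta>. max 0 (ln (norm (f (of_real r * cis \<theta>)))))"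

definition nev_T :: "(complex \<Rightarrow> complex) \<Rightarrow> real \<Rightarrow> real" where
  "nev_T f r = nev_m f r + nev_N f r"

definition mero_order :: "(complex \<Rightarrow> complex) \<Rightarrow> ereal" where
  "mero_order f = Limsup at_top (\<lambda>r::real. ereal (ln (nev_T f r) / ln r))"

definition critical_values :: "(complex \<Rightarrow> complex) \<Rightarrow> complex set" where
  "critical_values f = {f z | z. z \<notin> poles f \<and> deriv f z = 0}"

definition asymptotic_values :: "(complex \<Rightarrow> complex) \<Rightarrow> complex set" where
  "asymptotic_values f = {w. \<exists>\<gamma> :: real \<Rightarrow> complex. continuous_on {0..} \<gamma> \<and>
       (\<forall>t\<ge>0. \<gamma> t \<notin> poles f) \<and> filterlim \<gamma> at_infinity at_top \<and>
       ((f \<circ> \<gamma>) \<longlongrightarrow> w) at_top}"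

definition infinity_asymptotic_value :: "(complex \<Rightarrow> complex) \<Rightarrow> bool" where
  "infinity_asymptotic_value f \<longleftrightarrow> (\<exists>\<gamma> :: real \<Rightarrow> complex. continuous_on {0..} \<gamma> \<and>
       (\<forall>t\<ge>0. \<gamma> t \<notin> poles f) \<and> filterlim \<gamma> at_infinity at_top \<and>
       filterlim (f \<circ> \<gamma>) at_infinity at_top)"

definition sing_values :: "(complex \<Rightarrow> complex) \<Rightarrow> complex set" where
  "sing_values f = critical_values f \<union> asymptotic_values f"

definition Mstar_prop :: "(complex \<Rightarrow> complex) \<Rightarrow> real \<Rightarrow> nat \<Rightarrow> bool" where
  "Mstar_prop f \<rho> k \<longleftrightarrow>
     (\<forall>t>\<rho>. (\<lambda>a. norm a powr (-t)) summable_on {a \<in> poles f. pole_mult f a = k}) \<and>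
     (\<forall>t<\<rho>. \<not> (\<lambda>a. norm a powr (-t)) summable_on {a \<in> poles f. pole_mult f a = k})"

definition is_Mstar :: "(complex \<Rightarrow> complex) \<Rightarrow> real \<Rightarrow> nat \<Rightarrow> nat \<Rightarrow> bool" where
  "is_Mstar f \<rho> M Ms \<longleftrightarrow> 1 \<le> Ms \<and> Ms \<le> M \<and> Mstar_prop f \<rho> Ms \<and>
     (\<forall>k. Ms < k \<and> k \<le> M \<longrightarrow> \<not> Mstar_prop f \<rho> k)"

fun nonaut_iter :: "(complex \<Rightarrow> complex) \<Rightarrow> (nat \<Rightarrow> complex) \<Rightarrow> nat \<Rightarrow> complex \<Rightarrow> complex" where
  "nonaut_iter f c 0 z = z"
| "nonaut_iter f c (Suc n) z = f (nonaut_iter f c n z) + c (Suc n)"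

definition all_defined :: "(complex \<Rightarrow> complex) \<Rightarrow> (nat \<Rightarrow> complex) \<Rightarrow> complex set" where
  "all_defined f c = {z. \<forall>k. nonaut_iter f c k z \<notin> poles f}"

text \<open>Chordal metric on the Riemann sphere (None = infinity).\<close>
fun chordal :: "complex option \<Rightarrow> complex option \<Rightarrow> real" where
  "chordal None None = 0"
| "chordal (Some a) None = 2 / sqrt (1 + (norm a)\<^sup>2)"
| "chordal None (Some b) = 2 / sqrt (1 + (norm b)\<^sup>2)"
| "chordal (Some a) (Some b) = 2 * norm (a - b) / sqrt ((1 + (norm a)\<^sup>2) * (1 + (norm b)\<^sup>2))"

definition normal_family_on :: "complex set \<Rightarrow> (nat \<Rightarrow> complex \<Rightarrow> complex) \<Rightarrow> bool" where
  "normal_family_on U F \<longleftrightarrow>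
     (\<forall>\<sigma> :: nat \<Rightarrow> nat. \<exists>r (g :: complex \<Rightarrow> complex option). strict_mono r \<and> True \<and>
        (\<forall>K. compact K \<and> K \<subseteq> U \<longrightarrow>
           (\<forall>e>0. eventually (\<lambda>k. \<forall>z\<in>K. chordal (Some (F (\<sigma> (r k)) z)) (g z) < e) sequentially)))"

definition julia_set :: "(complex \<Rightarrow> complex) \<Rightarrow> (nat \<Rightarrow> complex) \<Rightarrow> complex set" where
  "julia_set f c = - {z. \<exists>U. open U \<and> z \<in> U \<and> U \<subseteq> all_defined f c \<and>
                          normal_family_on U (nonaut_iter f c)}"

definition univalent_pullback :: "(complex \<Rightarrow> complex) \<Rightarrow> (nat \<Rightarrow> complex) \<Rightarrow> nat \<Rightarrow> real \<Rightarrow> complex \<Rightarrow> bool" where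
  "univalent_pullback f c n \<delta> z \<longleftrightarrow>
     (\<exists>V. open V \<and> z \<in> V \<and> (\<forall>w\<in>V. \<forall>k<n. nonaut_iter f c k w \<notin> poles f) \<and>
          inj_on (nonaut_iter f c n) V \<and>
          nonaut_iter f c n ` V = ball (nonaut_iter f c n z) \<delta>)"

definition radial_julia_set :: "(complex \<Rightarrow> complex) \<Rightarrow> (nat \<Rightarrow> complex) \<Rightarrow> complex set" where
  "radial_julia_set f c = {z \<in> julia_set f c. z \<in> all_defined f c \<and>
     (\<exists>\<delta>>0. infinite {n. univalent_pullback f c n \<delta> z})}"

definition hausdorff_pre :: "real \<Rightarrow> real \<Rightarrow> complex set \<Rightarrow> ennreal" where
  "hausdorff_pre s \<delta> A = (INF U \<in> {U :: nat \<Rightarrow> complex set. A \<subseteq> (\<Union>i. U i) \<and>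
        (\<forall>i. bounded (U i) \<and> diameter (U i) \<le> \<delta>)}. (\<Sum>i. ennreal (diameter (U i) powr s)))"

definition hausdorff_measure :: "real \<Rightarrow> complex set \<Rightarrow> ennreal" where
  "hausdorff_measure s A = (SUP \<delta> \<in> {0<..}. hausdorff_pre s \<delta> A)"

text \<open>HD(A) = inf { s > 0 : H^s(A) = 0 } (this equals the usual inf over s >= 0).\<close>
definition hausdorff_dim :: "complex set \<Rightarrow> real" where
  "hausdorff_dim A = Inf {s. s > 0 \<and> hausdorff_measure s A = 0}"

definition escaping_R :: "(complex \<Rightarrow> complex) \<Rightarrow> (nat \<Rightarrow> complex) \<Rightarrow> complex set \<Rightarrow> real \<Rightarrow> complex set" where
  "escaping_R f c J R = {z \<in> J. z \<in> all_defined f c \<and> (\<forall>n\<ge>1. norm (nonaut_iter f c n z) > R)}"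

definition eventual_dim :: "(complex \<Rightarrow> complex) \<Rightarrow> (nat \<Rightarrow> complex) \<Rightarrow> real" where
  "eventual_dim f c = Lim at_top (\<lambda>R. hausdorff_dim (escaping_R f c (julia_set f c) R))"

definition eventual_hyp_dim :: "(complex \<Rightarrow> complex) \<Rightarrow> (nat \<Rightarrow> complex) \<Rightarrow> real" where
  "eventual_hyp_dim f c = Lim at_top (\<lambda>R. hausdorff_dim (escaping_R f c (radial_julia_set f c) R))"

end

theory Submission
  imports Defs "HOL-Library.Sublist"
begin

text \<open>
  Near a pole \<open>a\<close> of order \<open>m\<close> the function is \<open>h\<^bsup>-m\<^esup>\<close> with \<open>h\<close> univalent on a disk of fixed radius, so
  inverse branches of \<open>f\<close> into this disk exist on \<open>ball w (|w| / 2)\<close> for every large \<open>w\<close>, and they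
  contract by a factor comparable with \<open>|a|\<^bsup>-\<beta>/m\<^esup> |w|\<^bsup>-(1 + 1/m)\<^esup>\<close>. As infinity is not an asymptotic
  value, Iversen's argument shows that large values occur only in these disks.

  Upper bound: an orbit staying outside a large disk follows an itinerary of poles, and the
  pullbacks along itineraries of length \<open>n\<close> give covers of total mass at most a power of
  \<open>\<Sum> |a|\<^bsup>-t(\<beta> + M + 1)/M\<^esup>\<close>, a small tail of a series which converges because the order bounds the
  number of poles. Lower bound: finitely many poles of order \<open>M\<^sup>*\<close> whose sum \<open>\<Sum> |a|\<^bsup>-s(\<beta> + M\<^sup>* + 1)/M\<^sup>*\<^esup>\<close>
  is large form an iterated function system. Distortion constants accumulate once per step, but they
  are absorbed by the size of that sum. All perturbations with \<open>|c\<^sub>n| < 1\<close> are admissible, since the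
  branches are defined on disks of unbounded radius.
\<close>

section \<open>Hausdorff content\<close>

text \<open>Only the vanishing of Hausdorff measures enters \<open>hausdorff_dim\<close>, and
  content detects it without any mesh condition on covers, so both bounds are statements about
  content. A step from the disk at \<open>a\<close> to the disk at \<open>b\<close> costs, up to a
  constant, \<open>|a|^(-beta/m(a)) * |b|^(-(1 + 1/m(a)))\<close>, which mixes two poles. Along an
  itinerary the second factor of one step is therefore grouped with the first factor of the next.
  Each pole then carries the exponent \<open>1 + 1/m + beta/m'\<close>, where m and m' are the
  multiplicities of its predecessor and of the pole itself. The upper bound takes the worst case M
  in both places; the lower bound keeps to poles of one multiplicity, where the exponent is the same
  everywhere. Equating t times this exponent with \<rho> gives both fractions of the theorem. The
  charts give explicit Lipschitz bounds, uniform over the poles, in place of a distortion theorem.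
  Since following an orbit shifts the sequence c, the estimates of the upper bound hold for all
  admissible sequences at once.\<close>

definition hausdorff_content :: "real \<Rightarrow> complex set \<Rightarrow> ennreal" where
  "hausdorff_content s A = (INF U \<in> {U :: nat \<Rightarrow> complex set. A \<subseteq> (\<Union>i. U i) \<and>
        (\<forall>i. bounded (U i))}. (\<Sum>i. ennreal (diameter (U i) powr s)))"

lemma hausdorff_content_le:
  assumes "A \<subseteq> (\<Union>i. U i)" "\<And>i. bounded (U i)"
  shows "hausdorff_content s A \<le> (\<Sum>i. ennreal (diameter (U i) powr s))"
  unfolding hausdorff_content_def by (rule INF_lower) (use assms in auto)

lemma hausdorff_content_less_cover:
  assumes "hausdorff_content s A < e"
  obtains U where "A \<subseteq> (\<Union>i. U i)" "\<And>i. bounded (U i)"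
    "(\<Sum>i. ennreal (diameter (U i) powr s)) < e"
proof -
  obtain U where U: "U \<in> {U :: nat \<Rightarrow> complex set. A \<subseteq> (\<Union>i. U i) \<and> (\<forall>i. bounded (U i))}"
    "(\<Sum>i. ennreal (diameter (U i) powr s)) < e"
    using assms unfolding hausdorff_content_def INF_less_iff by (elim bexE)
  show thesis by (rule that[of U]) (use U in auto)
qed

lemma hausdorff_content_mono: "A \<subseteq> B \<Longrightarrow> hausdorff_content s A \<le> hausdorff_content s B"
  unfolding hausdorff_content_def by (rule INF_superset_mono) (blast intro: order_trans, simp)

lemma hausdorff_content_le_diameter:
  assumes "bounded A"
  shows "hausdorff_content s A \<le> ennreal (diameter A powr s)"
proof -
  let ?U = "\<lambda>i::nat. if i = 0 then A else {}"
  have "hausdorff_content s A \<le> (\<Sum>i. ennreal (diameter (?U i) powr s))"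
    by (rule hausdorff_content_le) (use assms in auto)
  also have "\<dots> = (\<Sum>i\<in>{0}. ennreal (diameter (?U i) powr s))"
    by (rule suminf_finite) auto
  finally show ?thesis by simp
qed

lemma hausdorff_content_empty [simp]: "hausdorff_content s {} = 0"
  using hausdorff_content_le_diameter[of "{}" s] by simp

lemma suminf_prod_decode_ennreal:
  fixes f :: "nat \<Rightarrow> nat \<Rightarrow> ennreal"
  shows "(\<Sum>k. f (fst (prod_decode k)) (snd (prod_decode k))) = (\<Sum>i. \<Sum>j. f i j)"
proof -
  have "(\<Sum>k. (\<lambda>p. f (fst p) (snd p)) (prod_decode k)) = (\<Sum>i. \<Sum>j. f i j)"
    using suminf_ennreal_2dimen[of "\<lambda>i. \<Sum>j. f i j" "\<lambda>p. f (fst p) (snd p)"]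
    by (simp add: o_def)
  thus ?thesis by simp
qed

lemma hausdorff_content_UN:
  fixes A :: "nat \<Rightarrow> complex set"
  shows "hausdorff_content s (\<Union>n. A n) \<le> (\<Sum>n. hausdorff_content s (A n))"
proof (cases "(\<Sum>n. hausdorff_content s (A n)) < top")
  case False
  thus ?thesis by (metis top.not_eq_extremum top_greatest)
next
  case True
  hence fin: "hausdorff_content s (A n) < top" for n
    using ennreal_suminf_lessD by blast
  show ?thesis
  proof (rule ennreal_le_epsilon)
    fix e :: real assume e: "e > 0"
    define d where "d n = e * (1/2) ^ Suc n" for n
    have dpos: "d n > 0" for n using e by (simp add: d_def)
    have "\<exists>U. A n \<subseteq> (\<Union>i. U i) \<and> (\<forall>i. bounded (U i)) \<and>
        (\<Sum>i::nat. ennreal (diameter (U i) powr s)) < hausdorff_content s (A n) + ennreal (d n)" for n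
    proof -
      have "hausdorff_content s (A n) < hausdorff_content s (A n) + ennreal (d n)"
        using fin[of n] dpos[of n] by (metis add.right_neutral ennreal_add_left_cancel_less ennreal_less_zero_iff infinity_ennreal_def order_less_irrefl)
      thus ?thesis by (elim hausdorff_content_less_cover) blast
    qed
    then obtain U where U: "\<And>n. A n \<subseteq> (\<Union>i. U n i)" "\<And>n i. bounded (U n i)"
      "\<And>n. (\<Sum>i::nat. ennreal (diameter (U n i) powr s)) < hausdorff_content s (A n) + ennreal (d n)"
      by metis
    let ?V = "\<lambda>k. U (fst (prod_decode k)) (snd (prod_decode k))"
    have "hausdorff_content s (\<Union>n. A n) \<le> (\<Sum>k. ennreal (diameter (?V k) powr s))"
    proof (rule hausdorff_content_le)
      show "(\<Union>n. A n) \<subseteq> (\<Union>k. ?V k)"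
      proof
        fix x assume "x \<in> (\<Union>n. A n)"
        then obtain n i where "x \<in> U n i" using U(1) by blast
        thus "x \<in> (\<Union>k. ?V k)" by (intro UN_I[of "prod_encode (n, i)"]) auto
      qed
    qed (use U in auto)
    also have "\<dots> = (\<Sum>n. \<Sum>i. ennreal (diameter (U n i) powr s))"
      by (rule suminf_prod_decode_ennreal)
    also have "\<dots> \<le> (\<Sum>n. hausdorff_content s (A n) + ennreal (d n))"
      by (intro suminf_le) (use U(3) in \<open>auto intro: less_imp_le\<close>)
    also have "\<dots> = (\<Sum>n. hausdorff_content s (A n)) + (\<Sum>n. ennreal (d n))"
      by (simp add: suminf_add)
    also have "(\<Sum>n. ennreal (d n)) = ennreal e"
    proof -
      have "d sums (e * 1)" unfolding d_def by (intro sums_mult power_half_series)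
      thus ?thesis using dpos less_imp_le by (metis mult.right_neutral suminf_ennreal_eq)
    qed
    finally show "hausdorff_content s (\<Union>n. A n) \<le> (\<Sum>n. hausdorff_content s (A n)) + ennreal e" .
  qed
qed

lemma hausdorff_content_UN_infsum:
  fixes X :: "'a \<Rightarrow> complex set"
  assumes "countable P" and sm: "b summable_on P"
    and b: "\<And>a. a \<in> P \<Longrightarrow> 0 \<le> b a \<and> hausdorff_content s (X a) \<le> ennreal (b a)"
  shows "hausdorff_content s (\<Union>a\<in>P. X a) \<le> ennreal (infsum b P)"
proof -
  let ?N = "to_nat_on P ` P"
  let ?Y = "\<lambda>n. if n \<in> ?N then X (from_nat_into P n) else {}"
  let ?c = "\<lambda>n. if n \<in> ?N then b (from_nat_into P n) else 0"
  have inj: "inj_on (to_nat_on P) P" using assms(1) by (rule inj_on_to_nat_on)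
  have "((b \<circ> from_nat_into P) has_sum infsum b P) ?N"
    using has_sum_reindex[OF inj, of "b \<circ> from_nat_into P" "infsum b P"]
      has_sum_infsum[OF sm] by (subst has_sum_reindex[OF inj]) 
      (auto simp: o_def from_nat_into_to_nat_on[OF assms(1)] cong: has_sum_cong)
  hence "(?c has_sum infsum b P) UNIV"
    by (subst has_sum_cong_neutral[where S = UNIV and T = ?N and g = "b \<circ> from_nat_into P"]) auto
  hence sums: "?c sums infsum b P" by (rule has_sum_imp_sums)
  have c: "0 \<le> ?c n \<and> hausdorff_content s (?Y n) \<le> ennreal (?c n)" for n
    using b by (auto simp: from_nat_into_to_nat_on[OF assms(1)])
  have "(\<Union>a\<in>P. X a) \<subseteq> (\<Union>n. ?Y n)"
  proof
    fix x assume "x \<in> (\<Union>a\<in>P. X a)"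
    then obtain a where "a \<in> P" "x \<in> X a" by blast
    thus "x \<in> (\<Union>n. ?Y n)" 
      by (intro UN_I[of "to_nat_on P a"]) (auto simp: from_nat_into_to_nat_on[OF assms(1)])
  qed
  hence "hausdorff_content s (\<Union>a\<in>P. X a) \<le> hausdorff_content s (\<Union>n. ?Y n)"
    by (rule hausdorff_content_mono)
  also have "\<dots> \<le> (\<Sum>n. hausdorff_content s (?Y n))" by (rule hausdorff_content_UN)
  also have "\<dots> \<le> (\<Sum>n. ennreal (?c n))" by (intro suminf_le) (use c in auto)
  also have "\<dots> = ennreal (infsum b P)"
    by (rule suminf_ennreal_eq[OF _ sums]) (use c in blast)
  finally show ?thesis .
qed

lemma hausdorff_content_UN_null:
  assumes "countable P" "\<And>a. a \<in> P \<Longrightarrow> hausdorff_content s (X a) = 0"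
  shows "hausdorff_content s (\<Union>a\<in>P. X a) = 0"
  using hausdorff_content_UN_infsum[of P "\<lambda>_. 0" s X] assms by simp

text \<open>The members of a cover are cut down to \<open>A\<close> before they are mapped, because
  \<open>g\<close> is controlled on \<open>A\<close> only. With \<open>L\<close> the Lipschitz
  constant of an inverse branch, \<open>L powr s\<close> is the cost of one pullback.\<close>

lemma hausdorff_content_lipschitz_image:
  assumes L: "L \<ge> 0" "\<And>x y. x \<in> A \<Longrightarrow> y \<in> A \<Longrightarrow> norm (g x - g y) \<le> L * norm (x - y)"
    and s: "s > 0" and b: "b \<ge> 0" "hausdorff_content s A \<le> ennreal b"
  shows "hausdorff_content s (g ` A) \<le> ennreal (L powr s * b)"
proof -
  have "hausdorff_content s (g ` A) \<le> ennreal (L powr s) * (\<Sum>i. ennreal (diameter (U i) powr s))"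
    if U: "A \<subseteq> (\<Union>i. U i)" "\<And>i. bounded (U i)" for U :: "nat \<Rightarrow> complex set"
  proof -
    have d: "bounded (g ` (U i \<inter> A)) \<and> diameter (g ` (U i \<inter> A)) \<le> L * diameter (U i)" for i
    proof -
      have lip: "norm (g x - g y) \<le> L * diameter (U i)" if "x \<in> U i \<inter> A" "y \<in> U i \<inter> A" for x y
      proof -
        have "norm (x - y) \<le> diameter (U i)"
          using diameter_bounded_bound[OF U(2)[of i], of x y] that by (auto simp: dist_norm)
        thus ?thesis using L that by (meson IntD2 mult_left_mono order_trans)
      qed
      have "bounded (g ` (U i \<inter> A))"
      proof (cases "U i \<inter> A = {}")
        case False
        then obtain x where x: "x \<in> U i \<inter> A" by blast
        show ?thesis unfolding bounded_def
          by (intro exI[of _ "g x"] exI[of _ "L * diameter (U i)"]) (use lip[OF x] in \<open>auto simp: dist_norm\<close>)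
      qed auto
      moreover have "0 \<le> L * diameter (U i)"
        using L diameter_ge_0[OF U(2)[of i]] by simp
      ultimately show ?thesis
        using lip by (intro conjI diameter_le) auto
    qed
    have "hausdorff_content s (g ` A) \<le> (\<Sum>i. ennreal (diameter (g ` (U i \<inter> A)) powr s))"
    proof (rule hausdorff_content_le)
      show "g ` A \<subseteq> (\<Union>i. g ` (U i \<inter> A))"
      proof (rule image_subsetI)
        fix x assume x: "x \<in> A"
        then obtain i where "x \<in> U i" using U(1) by (meson UN_E subsetD)
        thus "g x \<in> (\<Union>i. g ` (U i \<inter> A))" using x by (intro UN_I[of i] imageI) auto
      qed
    qed (use d in blast)
    also have "\<dots> \<le> (\<Sum>i. ennreal (L powr s) * ennreal (diameter (U i) powr s))"
    proof (intro suminf_le)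
      fix i
      have "diameter (g ` (U i \<inter> A)) powr s \<le> (L * diameter (U i)) powr s"
        using d[of i] s diameter_ge_0 by (intro powr_mono2) auto
      also have "\<dots> = L powr s * diameter (U i) powr s"
        by (metis L(1) U(2) diameter_ge_0 powr_mult)
      finally show "ennreal (diameter (g ` (U i \<inter> A)) powr s) \<le> ennreal (L powr s) * ennreal (diameter (U i) powr s)"
        by (simp add: ennreal_mult'[symmetric] ennreal_leI)
    qed auto
    finally show ?thesis by simp
  qed
  note cover = this
  show ?thesis
  proof (rule ennreal_le_epsilon)
    fix e :: real assume e: "e > 0"
    \<comment> \<open>The added 1 keeps the quotient meaningful when \<open>L\<close> is 0.\<close>
    define d where "d = e / (L powr s + 1)"
    have "L powr s + 1 > 0" by (meson add_nonneg_pos powr_ge_zero zero_less_one)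
    hence d: "d > 0" "L powr s * d \<le> e" using e by (auto simp: d_def field_simps)
    have "hausdorff_content s A < ennreal (b + d)"
      using b d by (metis ennreal_less_iff less_add_same_cancel1 order_le_less_trans)
    then obtain U where U: "A \<subseteq> (\<Union>i. U i)" "\<And>i. bounded (U i)"
      "(\<Sum>i. ennreal (diameter (U i) powr s)) < ennreal (b + d)"
      using hausdorff_content_less_cover by blast
    have "hausdorff_content s (g ` A) \<le> ennreal (L powr s) * ennreal (b + d)"
      by (rule order_trans[OF cover[OF U(1,2)]]) (use U(3) in \<open>auto intro: mult_left_mono less_imp_le\<close>)
    also have "\<dots> = ennreal (L powr s * b + L powr s * d)"
      using b d by (simp add: ennreal_mult'[symmetric] algebra_simps)
    also have "\<dots> \<le> ennreal (L powr s * b + e)"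
      using d by (intro ennreal_leI) auto
    also have "\<dots> = ennreal (L powr s * b) + ennreal e"
      using b e by (intro ennreal_plus) auto
    finally show "hausdorff_content s (g ` A) \<le> ennreal (L powr s * b) + ennreal e" .
  qed
qed

text \<open>A cover whose sum lies below \<open>\<delta> powr s\<close> cannot contain a set of
  diameter above \<delta>, so at the level of null sets the mesh condition takes care of
  itself.\<close>

lemma hausdorff_measure_eq_0_iff:
  assumes s: "s > 0"
  shows "hausdorff_measure s A = 0 \<longleftrightarrow> hausdorff_content s A = 0"
proof
  assume "hausdorff_measure s A = 0"
  hence "hausdorff_pre s 1 A \<le> 0"
    unfolding hausdorff_measure_def by (metis SUP_upper greaterThan_iff zero_less_one)
  moreover have "hausdorff_content s A \<le> hausdorff_pre s 1 A"
    unfolding hausdorff_content_def hausdorff_pre_def by (rule INF_superset_mono) auto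
  ultimately show "hausdorff_content s A = 0" by simp
next
  assume 0: "hausdorff_content s A = 0"
  have "hausdorff_pre s \<delta> A \<le> 0 + ennreal e" if "\<delta> > 0" "e > 0" for \<delta> e
  proof -
    define e' where "e' = min e (\<delta> powr s)"
    have "e' > 0" using that by (auto simp: e'_def)
    hence "hausdorff_content s A < ennreal e'" using 0 by simp
    then obtain U where U: "A \<subseteq> (\<Union>i. U i)" "\<And>i. bounded (U i)"
      "(\<Sum>i. ennreal (diameter (U i) powr s)) < ennreal e'"
      using hausdorff_content_less_cover by blast
    have "diameter (U i) \<le> \<delta>" for i
    proof (rule ccontr)
      assume "\<not> diameter (U i) \<le> \<delta>"
      hence "\<delta> powr s \<le> diameter (U i) powr s" using that s by (intro powr_mono2) auto
      hence "ennreal e' \<le> ennreal (diameter (U i) powr s)" by (intro ennreal_leI) (auto simp: e'_def)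
      also have "\<dots> = (\<Sum>i\<in>{i}. ennreal (diameter (U i) powr s))" by simp
      also have "\<dots> \<le> (\<Sum>i. ennreal (diameter (U i) powr s))"
        by (rule sum_le_suminf) auto
      finally show False using U(3) by simp
    qed
    hence "hausdorff_pre s \<delta> A \<le> (\<Sum>i. ennreal (diameter (U i) powr s))"
      unfolding hausdorff_pre_def using U by (intro INF_lower) auto
    also have "\<dots> \<le> ennreal e" using U(3) by (metis e'_def ennreal_leI less_imp_le min.cobounded1 order_trans)
    finally show ?thesis by simp
  qed
  note le = this
  have "hausdorff_pre s \<delta> A \<le> 0" if "\<delta> > 0" for \<delta>
    by (rule ennreal_le_epsilon) (rule le[OF that])
  thus "hausdorff_measure s A = 0"
    unfolding hausdorff_measure_def by (auto simp: SUP_eq_iff bot_ennreal)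
qed

lemma hausdorff_dim_le:
  assumes "s > 0" "hausdorff_content s A = 0"
  shows "hausdorff_dim A \<le> s"
  unfolding hausdorff_dim_def
proof (rule cInf_lower)
  show "bdd_below {s. 0 < s \<and> hausdorff_measure s A = 0}" by (rule bdd_belowI[of _ 0]) simp
qed (use assms in \<open>simp add: hausdorff_measure_eq_0_iff\<close>)

text \<open>The exponent \<open>s0\<close> ensures that the infimum is taken over a nonempty set;
  over the empty set a real \<open>Inf\<close> has no usable value.\<close>

lemma hausdorff_dim_ge:
  assumes "s0 > 0" "hausdorff_content s0 A = 0"
    and "\<And>s. s > 0 \<Longrightarrow> s < d \<Longrightarrow> hausdorff_content s A \<noteq> 0"
  shows "d \<le> hausdorff_dim A"
  unfolding hausdorff_dim_def
proof (rule cInf_greatest)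
  show "{s. 0 < s \<and> hausdorff_measure s A = 0} \<noteq> {}"
    using assms(1,2) by (auto simp: hausdorff_measure_eq_0_iff)
next
  fix s assume "s \<in> {s. 0 < s \<and> hausdorff_measure s A = 0}"
  hence "s > 0" "hausdorff_content s A = 0" by (auto simp: hausdorff_measure_eq_0_iff)
  thus "d \<le> s" using assms(3)[of s] by linarith
qed

lemma hausdorff_dim_nonneg:
  assumes "s0 > 0" "hausdorff_content s0 A = 0"
  shows "0 \<le> hausdorff_dim A"
  by (rule hausdorff_dim_ge[OF assms]) simp

lemma hausdorff_dim_mono:
  assumes "A \<subseteq> B" "s0 > 0" "hausdorff_content s0 B = 0"
  shows "hausdorff_dim A \<le> hausdorff_dim B"
  unfolding hausdorff_dim_def
proof (rule cInf_superset_mono)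
  show "{s. 0 < s \<and> hausdorff_measure s B = 0} \<subseteq> {s. 0 < s \<and> hausdorff_measure s A = 0}"
    using hausdorff_content_mono[OF assms(1)] by (auto simp: hausdorff_measure_eq_0_iff) (metis le_zero_eq)
  show "bdd_below {s. 0 < s \<and> hausdorff_measure s A = 0}" by (rule bdd_belowI[of _ 0]) simp
  show "{s. 0 < s \<and> hausdorff_measure s B = 0} \<noteq> {}"
    using assms hausdorff_measure_eq_0_iff by blast
qed

section \<open>Null sets under locally injective holomorphic maps\<close>

lemma holomorphic_locally_expanding:
  assumes "f holomorphic_on D" "open D" "z \<in> D" "deriv f z \<noteq> 0"
  obtains r where "r > 0" "ball z r \<subseteq> D"
    "\<And>x y. x \<in> ball z r \<Longrightarrow> y \<in> ball z r \<Longrightarrow> norm (x - y) \<le> 2 / norm (deriv f z) * norm (f x - f y)"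
proof -
  let ?d = "deriv f z"
  have "continuous_on D (deriv f)"
    by (simp add: assms holomorphic_deriv holomorphic_on_imp_continuous_on)
  hence "isCont (deriv f) z" using assms by (simp add: continuous_on_eq_continuous_at)
  then obtain r1 where r1: "r1 > 0" "\<And>x. dist x z < r1 \<Longrightarrow> dist (deriv f x) ?d < norm ?d / 2"
    using assms(4) unfolding continuous_at_eps_delta by (metis half_gt_zero zero_less_norm_iff)
  obtain r2 where r2: "r2 > 0" "ball z r2 \<subseteq> D" using assms open_contains_ball by blast
  define r where "r = min r1 r2"
  have sub: "ball z r \<subseteq> D" using r2 by (auto simp: r_def)
  have "norm (x - y) \<le> 2 / norm ?d * norm (f x - f y)" if xy: "x \<in> ball z r" "y \<in> ball z r" for x y
  proof -
    \<comment> \<open>Subtracting the linear part leaves a map whose derivative is at most half of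
      \<open>norm ?d\<close>, so the linear part dominates.\<close>
    have "norm ((f x - ?d * x) - (f y - ?d * y)) \<le> norm ?d / 2 * norm (x - y)"
    proof (rule field_differentiable_bound[OF convex_ball _ _ xy])
      fix w assume w: "w \<in> ball z r"
      have "(f has_field_derivative deriv f w) (at w)"
        using assms sub w holomorphic_derivI by blast
      hence "((\<lambda>x. f x - ?d * x) has_field_derivative deriv f w - ?d * 1) (at w)"
        by (intro DERIV_diff DERIV_cmult DERIV_ident)
      thus "((\<lambda>x. f x - ?d * x) has_field_derivative deriv f w - ?d) (at w within ball z r)"
        by (simp add: has_field_derivative_at_within)
      show "norm (deriv f w - ?d) \<le> norm ?d / 2"
        using r1(2)[of w] w by (auto simp: r_def dist_norm norm_minus_commute)
    qed
    moreover have "norm (?d * (x - y)) \<le> norm (f x - f y) + norm ((f x - ?d * x) - (f y - ?d * y))"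
      using norm_triangle_ineq4[of "f x - f y" "(f x - ?d * x) - (f y - ?d * y)"]
      by (simp add: algebra_simps)
    ultimately have "norm ?d * norm (x - y) \<le> 2 * norm (f x - f y)" by (simp add: norm_mult)
    thus ?thesis using assms(4) by (simp add: pos_le_divide_eq mult.commute)
  qed
  moreover have "r > 0" using r1 r2 by (simp add: r_def)
  ultimately show ?thesis using sub by (intro that[of r])
qed

text \<open>Locally \<open>f\<close> has a Lipschitz inverse, and by Lindelof countably many such
  balls cover \<open>S\<close>. The lemma serves the first map of an orbit:
  \<open>escaping_R\<close> restricts the size of the orbit only from time 1 on, so what is
  estimated directly is the image of the escaping set.\<close>

lemma hausdorff_null_holomorphic_preimage:
  assumes "f holomorphic_on D" "open D" "S \<subseteq> D" "\<And>z. z \<in> S \<Longrightarrow> deriv f z \<noteq> 0"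
    and s: "s > 0" and null: "hausdorff_content s (f ` S) = 0"
  shows "hausdorff_content s S = 0"
proof -
  define \<B> where "\<B> = {ball z r | z r. \<exists>L. L \<ge> 0 \<and>
    (\<forall>x \<in> ball z r. \<forall>y \<in> ball z r. norm (x - y) \<le> L * norm (f x - f y))}"
  have "\<And>S. S \<in> \<B> \<Longrightarrow> open S" by (auto simp: \<B>_def)
  then obtain \<B>' where B': "\<B>' \<subseteq> \<B>" "countable \<B>'" "\<Union>\<B>' = \<Union>\<B>"
    by (rule Lindelof)
  have "S \<subseteq> \<Union>\<B>"
  proof
    fix z assume z: "z \<in> S"
    then obtain r where r: "r > 0" 
      "\<And>x y. x \<in> ball z r \<Longrightarrow> y \<in> ball z r \<Longrightarrow> norm (x - y) \<le> 2 / norm (deriv f z) * norm (f x - f y)"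
      using holomorphic_locally_expanding[OF assms(1,2)] assms(3,4) by (metis subsetD)
    show "z \<in> \<Union>\<B>"
    proof (rule UnionI[of "ball z r"])
      have "0 \<le> 2 / norm (deriv f z)" by simp
      thus "ball z r \<in> \<B>" unfolding \<B>_def using r(2) by blast
    qed (use r in auto)
  qed
  hence "S = (\<Union>B\<in>\<B>'. S \<inter> B)" using B' by auto
  moreover have "hausdorff_content s (S \<inter> B) = 0" if B: "B \<in> \<B>'" for B
  proof -
    obtain L where L: "L \<ge> 0" "\<And>x y. x \<in> B \<Longrightarrow> y \<in> B \<Longrightarrow> norm (x - y) \<le> L * norm (f x - f y)"
    proof -
      have "B \<in> \<B>" using B B'(1) by blast
      then obtain z r L where "B = ball z r" "L \<ge> 0"
        "\<forall>x \<in> ball z r. \<forall>y \<in> ball z r. norm (x - y) \<le> L * norm (f x - f y)"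
        unfolding \<B>_def by blast
      thus thesis using that by blast
    qed
    have inj: "inj_on f B" using L(2) by (force simp: inj_on_def)
    have "hausdorff_content s (f ` (S \<inter> B)) = 0"
      using null hausdorff_content_mono[of "f ` (S \<inter> B)" "f ` S" s] by (metis Int_lower1 image_mono le_zero_eq)
    moreover have "S \<inter> B = inv_into B f ` f ` (S \<inter> B)" using inj by (force simp: image_comp)
    moreover have "hausdorff_content s (inv_into B f ` f ` (S \<inter> B)) \<le> ennreal (L powr s * 0)"
      by (rule hausdorff_content_lipschitz_image) (use L s inj calculation(1) in auto)
    ultimately show ?thesis by simp
  qed
  ultimately show ?thesis using hausdorff_content_UN_null[OF B'(2)] by metis
qed

section \<open>Large values and poles\<close>

lemma not_islimpt_plane_poles:
  assumes "plane_meromorphic f"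
  shows "\<not> z islimpt poles f"
proof -
  have "isolated_singularity_at f z"
    using assms by (meson UNIV_I meromorphic_on_isolated_singularity plane_meromorphic_def meromorphic_on_altdef)
  thus ?thesis unfolding poles_def by (rule not_islimpt_poles)
qed

lemma closed_poles: "plane_meromorphic f \<Longrightarrow> closed (poles f)"
  using closed_limpt not_islimpt_plane_poles by blast

lemma finite_poles_Int_compact:
  assumes "plane_meromorphic f" "compact K"
  shows "finite (poles f \<inter> K)"
  using finite_not_islimpt_in_compact[OF assms(2)] not_islimpt_plane_poles[OF assms(1)]
  by (metis Int_commute)

lemma countable_poles:
  assumes "plane_meromorphic f"
  shows "countable (poles f)"
proof -
  have "poles f = (\<Union>n::nat. poles f \<inter> cball 0 (real n))"
    using real_arch_simple by fastforce
  moreover have "countable (\<Union>n::nat. poles f \<inter> cball 0 (real n))"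
  proof (rule countable_UN)
    show "countable (poles f \<inter> cball 0 (real n))" for n
      using finite_poles_Int_compact[OF assms] by (simp add: countable_finite)
  qed simp
  ultimately show ?thesis by simp
qed

lemma plane_meromorphic_continuous_on:
  "plane_meromorphic f \<Longrightarrow> A \<inter> poles f = {} \<Longrightarrow> continuous_on A f"
  unfolding plane_meromorphic_def
  by (rule continuous_on_subset[OF holomorphic_on_imp_continuous_on]) auto

lemma open_norm_gt:
  assumes "plane_meromorphic f"
  shows "open {z. z \<notin> poles f \<and> norm (f z) > r}"
proof -
  have "open (- poles f)" using closed_poles[OF assms] by blast
  moreover have "continuous_on (- poles f) (\<lambda>z. norm (f z))"
    by (intro continuous_on_norm plane_meromorphic_continuous_on assms) auto
  ultimately have "open ((\<lambda>z. norm (f z)) -` {r<..} \<inter> - poles f)"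
    using continuous_on_open_vimage open_greaterThan by blast
  moreover have "(\<lambda>z. norm (f z)) -` {r<..} \<inter> - poles f = {z. z \<notin> poles f \<and> norm (f z) > r}" by auto
  ultimately show ?thesis by simp
qed

text \<open>The point at infinity is negligible in the maximum principle: multiplying powers of \<open>f\<close> by
  \<open>\<delta> / (z - b)\<close> forces decay at infinity at the price of a factor that disappears on taking roots.\<close>

lemma maximum_modulus_unbounded:
  fixes f :: "complex \<Rightarrow> complex"
  assumes U: "open U" and hol: "f holomorphic_on U" and cont: "continuous_on (closure U) f"
    and R: "R > 0" "\<And>z. z \<in> frontier U \<Longrightarrow> norm (f z) \<le> R"
    and K: "\<And>z. z \<in> U \<Longrightarrow> norm (f z) \<le> K"
    and b: "\<delta> > 0" "ball b \<delta> \<inter> U = {}" and z0: "z0 \<in> U"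
  shows "norm (f z0) \<le> R"
proof -
  have disj: "ball b \<delta> \<inter> closure U = {}"
    using b(2) by (simp add: open_Int_closure_eq_empty)
  hence far: "\<delta> \<le> norm (z - b)" if "z \<in> closure U" for z
    using that by (force simp: dist_norm norm_minus_commute not_less[symmetric])
  have key: "norm (f z0) ^ n * \<delta> / norm (z0 - b) \<le> R ^ n" for n
  proof -
    \<comment> \<open>Beyond the radius \<open>K ^ n * \<delta> / R ^ n\<close> the decaying factor
      beats the a priori bound \<open>K ^ n\<close>; the other entry of the maximum places
      \<open>z0\<close> inside the truncated region.\<close>
    define \<rho> where "\<rho> = max (norm (z0 - b) + 1) (K ^ n * \<delta> / R ^ n)"
    define g where "g z = f z ^ n * (of_real \<delta> / (z - b))" for z
    let ?S = "U \<inter> ball b \<rho>"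
    have nz: "z - b \<noteq> 0" if "z \<in> closure U" for z using far[OF that] b(1) by auto
    have \<rho>: "\<rho> > 0" by (auto simp: \<rho>_def add_nonneg_pos less_max_iff_disj)
    have "norm (g z0) \<le> R ^ n"
    proof (rule maximum_modulus_frontier[of g ?S])
      have "interior ?S = ?S" using U by (simp add: interior_open open_Int)
      moreover have "g holomorphic_on ?S" unfolding g_def
        using nz closure_subset[of U]
        by (intro holomorphic_intros holomorphic_on_subset[OF hol]) auto
      ultimately show "g holomorphic_on interior ?S" by simp
      have cl: "closure ?S \<subseteq> closure U" by (simp add: closure_mono)
      show "continuous_on (closure ?S) g" unfolding g_def
        by (intro continuous_intros continuous_on_subset[OF cont cl]) (use nz cl in blast)
      show "bounded ?S" by auto
      show "z0 \<in> ?S" using z0 by (auto simp: \<rho>_def dist_norm norm_minus_commute)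
      fix z assume z: "z \<in> frontier ?S"
      have zS: "z \<in> closure U" "z \<in> cball b \<rho>" "z \<notin> ?S"
      proof -
        show "z \<in> closure U" using z cl by (auto simp: frontier_def)
        have "closure ?S \<subseteq> cball b \<rho>" by (rule closure_minimal) auto
        thus "z \<in> cball b \<rho>" using z by (auto simp: frontier_def)
        show "z \<notin> ?S" using z U by (simp add: frontier_def interior_open open_Int)
      qed
      show "norm (g z) \<le> R ^ n"
      proof (cases "z \<in> U")
        case False
        hence "z \<in> frontier U" using zS(1) U by (simp add: frontier_def interior_open)
        hence "norm (f z) ^ n \<le> R ^ n" using R(2) by (intro power_mono) auto
        moreover have "\<delta> / norm (z - b) \<le> 1" using far[OF zS(1)] b(1) by (auto simp: divide_le_eq)
        ultimately have "norm (f z) ^ n * (\<delta> / norm (z - b)) \<le> R ^ n * 1"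
          using b(1) R(1) by (intro mult_mono) auto
        thus ?thesis using b(1) by (simp add: g_def norm_mult norm_divide norm_power)
      next
        case True
        hence "norm (z - b) = \<rho>" using zS by (auto simp: dist_norm norm_minus_commute)
        moreover have "norm (f z) ^ n \<le> K ^ n" using K[OF True] by (intro power_mono) auto
        ultimately have "norm (g z) \<le> K ^ n * \<delta> / \<rho>"
          using b(1) \<rho> by (simp add: g_def norm_mult norm_divide norm_power divide_right_mono mult_right_mono)
        also have "\<dots> \<le> R ^ n"
        proof -
          have "K ^ n * \<delta> / R ^ n \<le> \<rho>" by (simp add: \<rho>_def)
          thus ?thesis using R(1) \<rho> by (simp add: field_simps)
        qed
        finally show ?thesis .
      qed
    qed
    thus ?thesis using b(1) by (simp add: g_def norm_mult norm_divide norm_power)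
  qed
  show ?thesis
  proof (rule ccontr)
    assume "\<not> norm (f z0) \<le> R"
    hence "norm (f z0) / R > 1" using R by (simp add: field_simps)
    then obtain n where n: "norm (z0 - b) / \<delta> < (norm (f z0) / R) ^ n"
      using real_arch_pow by blast
    have "norm (z0 - b) > 0" using far[of z0] z0 closure_subset[of U] b(1) by force
    thus False using key[of n] n R(1) b(1) by (simp add: power_divide field_simps)
  qed
qed

text \<open>The jump of the floor at an integer is harmless since consecutive paths share an
  endpoint. Continuity at \<open>t\<close> is read off from \<open>{0..real N}\<close> for some
  \<open>N\<close> above \<open>t\<close>, which contains a neighbourhood of \<open>t\<close> in the
  half-line.\<close>

lemma continuous_on_path_sequence:
  fixes p :: "nat \<Rightarrow> real \<Rightarrow> complex"
  assumes p: "\<And>n. path (p n)" "\<And>n. pathfinish (p n) = pathstart (p (Suc n))"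
  shows "continuous_on {0..} (\<lambda>t. p (nat \<lfloor>t\<rfloor>) (t - real (nat \<lfloor>t\<rfloor>)))"
    (is "continuous_on _ ?\<gamma>")
proof -
  have piece: "continuous_on {real N..real N + 1} ?\<gamma>" for N
  proof -
    have eq: "?\<gamma> t = p N (t - real N)" if "t \<in> {real N..real N + 1}" for t
    proof (cases "t = real N + 1")
      case True
      hence "nat \<lfloor>t\<rfloor> = Suc N" by (simp add: nat_add_distrib)
      thus ?thesis using True p(2)[of N] by (simp add: pathfinish_def pathstart_def)
    next
      case False
      hence "\<lfloor>t\<rfloor> = int N" using that by (intro floor_unique) auto
      thus ?thesis by simp
    qed
    have "continuous_on {real N..real N + 1} (\<lambda>t. p N (t - real N))"
      using p(1)[of N] unfolding path_def
      by (rule continuous_on_compose2) (auto intro!: continuous_intros)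
    thus ?thesis by (subst continuous_on_cong[OF refl eq])
  qed
  have upto: "continuous_on {0..real N} ?\<gamma>" for N
  proof (induction N)
    case 0
    thus ?case by simp
  next
    case (Suc N)
    have "{0..real (Suc N)} = {0..real N} \<union> {real N..real N + 1}" by auto
    thus ?case using continuous_on_closed_Un[OF _ _ Suc piece[of N]] by simp
  qed
  show ?thesis
  proof (unfold continuous_on_eq_continuous_within, intro ballI)
    fix t :: real assume t: "t \<in> {0..}"
    obtain N where N: "t < real N" using reals_Archimedean2 by blast
    have "continuous (at t within {0..real N}) ?\<gamma>"
      using upto[of N] t N by (simp add: continuous_on_eq_continuous_within)
    moreover have "at t within {0..real N} = at t within {0..}"
      by (rule at_within_nhd[of _ "{..<real N}"]) (use N in auto)
    ultimately show "continuous (at t within {0..}) ?\<gamma>" by simp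
  qed
qed

text \<open>Iversen's argument: on a component of \<open>{|f| > r}\<close> without poles \<open>f\<close> is unbounded, so one
  can descend through components with growing \<open>r\<close> and join them to an asymptotic path.\<close>

lemma infinity_asymptotic_value_if_tract:
  assumes pm: "plane_meromorphic f" and W: "closed W" "W \<inter> poles f = {}"
    and z0: "z0 \<in> W" "norm (f z0) > R" and R: "R > 0"
    and sub: "\<And>T. connected T \<Longrightarrow> T \<subseteq> {z. z \<notin> poles f \<and> norm (f z) > R} \<Longrightarrow> T \<inter> W \<noteq> {} \<Longrightarrow> T \<subseteq> W"
    and b: "ball b \<delta> \<inter> W = {}" "\<delta> > 0"
  shows "infinity_asymptotic_value f"
proof -
  define G where "G r = {z. z \<notin> poles f \<and> norm (f z) > r}" for r
  define U where "U n z = connected_component_set (G (R + real n)) z" for n z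
  have hol: "f holomorphic_on (- poles f)"
    using pm by (simp add: plane_meromorphic_def Compl_eq_Diff_UNIV)
  have U: "open (U n z)" "connected (U n z)" "z \<in> U n z" "U n z \<subseteq> W" "U n z \<subseteq> G (R + real n)"
    if "z \<in> W" "norm (f z) > R + real n" for n z
  proof -
    show "open (U n z)" "connected (U n z)"
      unfolding U_def G_def using open_norm_gt[OF pm] by (auto simp: open_connected_component)
    show zU: "z \<in> U n z" using that W(2) by (auto simp: U_def G_def connected_component_refl_eq)
    show G: "U n z \<subseteq> G (R + real n)" unfolding U_def by (rule connected_component_subset)
    show "U n z \<subseteq> W"
      by (rule sub) (use zU that G \<open>connected (U n z)\<close> in \<open>auto simp: G_def\<close>)
  qed
  \<comment> \<open>If |f| stayed below \<open>R + real (Suc n)\<close> on the component,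
    \<open>f\<close> would be bounded there, with frontier values at most \<open>R + real n\<close>;
    the maximum principle then contradicts the value at \<open>z\<close>.\<close>
  have step: "\<exists>z'. (z' \<in> W \<and> norm (f z') > R + real (Suc n)) \<and> z' \<in> U n z"
    if z: "z \<in> W \<and> norm (f z) > R + real n" for n z
  proof (rule ccontr)
    note u = U[OF conjunct1[OF z] conjunct2[OF z]]
    assume no: "\<not> ?thesis"
    have cl: "closure (U n z) \<subseteq> W" using u(4) W(1) by (simp add: closure_minimal)
    have "norm (f z) \<le> R + real n"
    proof (rule maximum_modulus_unbounded[OF u(1) _ _ _ _ _ b(2) _ u(3)])
      show "f holomorphic_on U n z" by (rule holomorphic_on_subset[OF hol]) (use u(5) in \<open>auto simp: G_def\<close>)
      show "continuous_on (closure (U n z)) f"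
        using cl W(2) by (intro plane_meromorphic_continuous_on pm) auto
      show "R + real n > 0" using R by simp
      show "norm (f w) \<le> R + real (Suc n)" if "w \<in> U n z" for w
        using no that u(4) by force
      show "ball b \<delta> \<inter> U n z = {}" using u(4) b by blast
      fix w assume w: "w \<in> frontier (U n z)"
      hence wc: "w \<in> closure (U n z)" "w \<notin> U n z" using u(1) by (auto simp: frontier_def interior_open)
      show "norm (f w) \<le> R + real n"
      proof (rule ccontr)
        \<comment> \<open>A frontier point above the level has an open component of its own, which
          meets \<open>U n z\<close> and hence equals it.\<close>
        assume "\<not> norm (f w) \<le> R + real n"
        hence wG: "w \<in> G (R + real n)" using wc cl W(2) by (auto simp: G_def)
        hence "open (connected_component_set (G (R + real n)) w)"
          unfolding G_def by (intro open_connected_component open_norm_gt pm)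
        moreover have "w \<in> connected_component_set (G (R + real n)) w"
          using wG by (simp add: connected_component_refl_eq)
        ultimately obtain y where "y \<in> U n z" "y \<in> connected_component_set (G (R + real n)) w"
          using wc(1) by (meson closure_iff_nhds_not_empty disjoint_iff open_contains_ball order_refl)
        hence "w \<in> U n z" unfolding U_def
          by (metis connected_component_sym connected_component_trans mem_Collect_eq)
        thus False using wc by simp
      qed
    qed
    thus False using z by simp
  qed
  have "\<exists>s. \<forall>n. (s n \<in> W \<and> norm (f (s n)) > R + real n) \<and> s (Suc n) \<in> U n (s n)"
    by (rule dependent_nat_choice[of "\<lambda>n z. z \<in> W \<and> norm (f z) > R + real n" "\<lambda>n z z'. z' \<in> U n z"])
      (use z0 step in auto)
  then obtain s where s: "\<And>n. s n \<in> W" "\<And>n. norm (f (s n)) > R + real n" "\<And>n. s (Suc n) \<in> U n (s n)"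
    by blast
  have "\<exists>p. path p \<and> path_image p \<subseteq> U n (s n) \<and> pathstart p = s n \<and> pathfinish p = s (Suc n)" for n
    using connected_open_path_connected[OF U(1,2)[OF s(1,2)]] U(3)[OF s(1,2)] s(3)
    by (meson path_connected_def)
  then obtain p where p: "\<And>n. path (p n)" "\<And>n. path_image (p n) \<subseteq> U n (s n)"
    "\<And>n. pathstart (p n) = s n" "\<And>n. pathfinish (p n) = s (Suc n)"
    by metis
  define \<gamma> where "\<gamma> t = p (nat \<lfloor>t\<rfloor>) (t - real (nat \<lfloor>t\<rfloor>))" for t
  have cont: "continuous_on {0..} \<gamma>"
    unfolding \<gamma>_def by (rule continuous_on_path_sequence) (use p in auto)
  have \<gamma>: "\<gamma> t \<in> W" "norm (f (\<gamma> t)) \<ge> t - 1" if t: "t \<ge> 0" for t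
  proof -
    let ?n = "nat \<lfloor>t\<rfloor>"
    have n: "real ?n \<le> t" "t \<le> real ?n + 1" using t by auto
    have "t - real ?n \<in> {0..1}" unfolding atLeastAtMost_iff using n by linarith
    hence "\<gamma> t \<in> path_image (p ?n)" unfolding \<gamma>_def path_image_def by (rule imageI)
    hence "\<gamma> t \<in> U ?n (s ?n)" using p(2) by blast
    hence *: "\<gamma> t \<in> W" "\<gamma> t \<in> G (R + real ?n)" using U(4,5)[OF s(1,2)] by blast+
    show "\<gamma> t \<in> W" by fact
    have "R + real ?n < norm (f (\<gamma> t))" using *(2) unfolding G_def by blast
    thus "norm (f (\<gamma> t)) \<ge> t - 1" using n R by linarith
  qed
  have "filterlim (\<lambda>t. norm ((f \<circ> \<gamma>) t)) at_top at_top"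
  proof (rule filterlim_at_top_mono)
    show "filterlim (\<lambda>t::real. t - 1) at_top at_top"
      using filterlim_tendsto_add_at_top[of "\<lambda>_. -1" "-1" at_top "\<lambda>t. t"]
      by (simp add: filterlim_ident)
    show "\<forall>\<^sub>F t in at_top. t - 1 \<le> norm ((f \<circ> \<gamma>) t)"
      using eventually_ge_at_top[of 0] by eventually_elim (use \<gamma> in auto)
  qed
  hence 1: "filterlim (f \<circ> \<gamma>) at_infinity at_top"
    by (rule filterlim_norm_at_top_imp_at_infinity)
  \<comment> \<open>The path leaves every disk: \<open>f\<close> is bounded on the part of
    \<open>W\<close> in a disk by compactness, whereas |f| tends to infinity along the path.\<close>
  have 2: "filterlim \<gamma> at_infinity at_top"
  proof (subst filterlim_at_infinity[OF order_refl], intro allI impI)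
    fix r :: real assume "r > 0"
    have "compact (W \<inter> cball 0 r)" using W(1) by (simp add: closed_Int_compact)
    hence "compact (f ` (W \<inter> cball 0 r))"
      using W(2) by (intro compact_continuous_image plane_meromorphic_continuous_on pm) auto
    then obtain L where L: "\<And>z. z \<in> W \<Longrightarrow> norm z \<le> r \<Longrightarrow> norm (f z) \<le> L"
      by (force dest!: compact_imp_bounded simp: bounded_iff)
    show "\<forall>\<^sub>F t in at_top. r \<le> norm (\<gamma> t)"
      using eventually_ge_at_top[of 0] eventually_gt_at_top[of "L + 1"]
    proof eventually_elim
      case (elim t)
      show ?case
      proof (rule ccontr)
        assume "\<not> r \<le> norm (\<gamma> t)"
        thus False using L[of "\<gamma> t"] \<gamma>[of t] elim by simp
      qed
    qed
  qed
  show ?thesis unfolding infinity_asymptotic_value_def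
    using cont \<gamma>(1) W(2) 1 2 by (intro exI[of _ \<gamma>]) auto
qed

text \<open>The tract lemma is applied to the complement \<open>W\<close> of the pole disks. The
  level \<open>R1\<close> is at least the bound on the circles, so a connected piece of {|f| > R1}
  cannot cross a circle and leave \<open>W\<close>. A disk around a regular point \<open>b\<close>
  is removed as well, since the maximum principle needs a disk outside the region; \<open>R1\<close>
  also dominates |f| on this disk, so no such piece meets it.\<close>

lemma large_values_near_poles:
  assumes pm: "plane_meromorphic f" and "\<not> infinity_asymptotic_value f"
    and rad: "\<And>a. a \<in> poles f \<Longrightarrow> r a > 0"
      "\<And>a z. a \<in> poles f \<Longrightarrow> z \<in> sphere a (r a) \<Longrightarrow> z \<notin> poles f \<and> norm (f z) \<le> R0"
  obtains R1 where "R1 > 0"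
    "\<And>z. z \<notin> poles f \<Longrightarrow> norm (f z) > R1 \<Longrightarrow> \<exists>a\<in>poles f. z \<in> ball a (r a)"
proof -
  have "poles f \<noteq> UNIV" using countable_poles[OF pm] uncountable_UNIV_complex by metis
  then obtain b where b: "b \<notin> poles f" by blast
  have "open (- poles f)" using closed_poles[OF pm] by blast
  then obtain d where d: "d > 0" "cball b d \<subseteq> - poles f"
    using b open_contains_cball by (metis ComplI)
  have "compact (f ` cball b d)"
    by (intro compact_continuous_image plane_meromorphic_continuous_on pm) (use d in auto)
  then obtain K where K: "\<And>z. z \<in> cball b d \<Longrightarrow> norm (f z) \<le> K"
    by (force dest!: compact_imp_bounded simp: bounded_iff)
  define R1 where "R1 = max 1 (max R0 K)"
  define W where "W = - ((\<Union>a\<in>poles f. ball a (r a)) \<union> ball b d)"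
  show thesis
  proof (rule that[of R1], goal_cases)
    case 1
    thus ?case by (simp add: R1_def)
  next
    case (2 z)
    show ?case
    proof (rule ccontr)
      assume no: "\<not> (\<exists>a\<in>poles f. z \<in> ball a (r a))"
      have "infinity_asymptotic_value f"
      proof (rule infinity_asymptotic_value_if_tract[OF pm, of W z R1 b d])
        show "closed W" unfolding W_def by (intro closed_Compl open_Un open_UN) auto
        show "W \<inter> poles f = {}" using rad(1) by (force simp: W_def)
        show "z \<in> W" using no 2 K[of z] by (force simp: W_def R1_def)
        show "norm (f z) > R1" by (rule 2)
        show "R1 > 0" by (simp add: R1_def)
        show "ball b d \<inter> W = {}" "d > 0" using d by (auto simp: W_def)
        fix T assume T: "connected T" "T \<subseteq> {z. z \<notin> poles f \<and> R1 < norm (f z)}" "T \<inter> W \<noteq> {}"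
        show "T \<subseteq> W"
        proof
          fix y assume y: "y \<in> T"
          have "y \<notin> ball b d" using y T(2) K[of y] by (force simp: R1_def)
          moreover have "y \<notin> ball a (r a)" if a: "a \<in> poles f" for a
          proof
            assume "y \<in> ball a (r a)"
            moreover have "T - ball a (r a) \<noteq> {}" using T(3) a by (auto simp: W_def)
            ultimately have "T \<inter> frontier (ball a (r a)) \<noteq> {}"
              using y by (intro connected_Int_frontier T(1)) auto
            then obtain x where "x \<in> T" "x \<in> sphere a (r a)" using rad(1)[OF a] by auto
            thus False using rad(2)[OF a, of x] T(2) by (force simp: R1_def)
          qed
          ultimately show "y \<in> W" by (auto simp: W_def)
        qed
      qed
      thus False using assms(2) by simp
    qed
  qed
qed

section \<open>Local structure at a pole\<close>

text \<open>The bounds say that \<open>1 / (f z * (z - a) ^ m)\<close> is bounded and bounded away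
  from zero on the punctured disk. The singularity is removable, and the zero-free extension has a
  holomorphic m-th root \<open>v\<close> because a disk is contractible. The root lives on the whole
  disk of radius \<open>D\<close>, so no radius depending on the pole is lost.\<close>

lemma pole_root_factorization:
  fixes f :: "complex \<Rightarrow> complex"
  assumes hol: "f holomorphic_on ball a D - {a}" and D: "D > 0" and m: "m \<ge> 1"
    and B: "B > 0" and C: "C \<ge> 1"
    and bnd: "\<And>z. z \<in> ball a D \<Longrightarrow> z \<noteq> a \<Longrightarrow>
      inverse C * (B / norm (z - a) ^ m) \<le> norm (f z) \<and> norm (f z) \<le> C * (B / norm (z - a) ^ m)"
  obtains v where "v holomorphic_on ball a D"
    "\<And>z. z \<in> ball a D \<Longrightarrow> 1 / (C * B) \<le> norm (v z) ^ m \<and> norm (v z) ^ m \<le> C / B"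
    "\<And>z. z \<in> ball a D \<Longrightarrow> z \<noteq> a \<Longrightarrow> f z = 1 / ((z - a) * v z) ^ m"
proof -
  define g where "g z = 1 / (f z * (z - a) ^ m)" for z
  have fnz: "f z \<noteq> 0" if "z \<in> ball a D" "z \<noteq> a" for z
  proof -
    have "0 < inverse C * (B / norm (z - a) ^ m)" using B C that by simp
    thus ?thesis using bnd[OF that] by auto
  qed
  have gb: "1 / (C * B) \<le> norm (g z) \<and> norm (g z) \<le> C / B" if "z \<in> ball a D" "z \<noteq> a" for z
  proof -
    let ?x = "norm (z - a) ^ m"
    have x: "?x > 0" using that by simp
    have y: "norm (f z) > 0" using fnz[OF that] by simp
    have 1: "B / C \<le> norm (f z) * ?x" using bnd[OF that] x B C by (simp add: field_simps)
    have 2: "norm (f z) * ?x \<le> C * B" using bnd[OF that] x B C by (simp add: field_simps)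
    have eq: "norm (g z) = 1 / (norm (f z) * ?x)" by (simp add: g_def norm_divide norm_mult norm_power)
    have "1 / (C * B) \<le> norm (g z)" unfolding eq using 2 x y B C by (intro divide_left_mono) auto
    moreover have "norm (g z) \<le> 1 / (B / C)" unfolding eq using 1 x y B C by (intro divide_left_mono) auto
    ultimately show ?thesis by simp
  qed
  have ghol: "g holomorphic_on ball a D - {a}"
    unfolding g_def using fnz by (intro holomorphic_intros hol) auto
  have "\<forall>\<^sub>F z in at a. norm (g z) \<le> C / B"
    unfolding eventually_at using D gb by (intro exI[of _ D]) (auto simp: dist_commute)
  then obtain u where u: "u holomorphic_on ball a D" "\<And>z. z \<in> ball a D - {a} \<Longrightarrow> u z = g z"
    using holomorphic_on_extend_bounded[OF ghol] D by (metis centre_in_ball interior_ball)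
  have ub: "1 / (C * B) \<le> norm (u z) \<and> norm (u z) \<le> C / B" if z: "z \<in> ball a D" for z
  proof (cases "z = a")
    case False
    thus ?thesis using u(2)[of z] gb[of z] z by simp
  next
    case True
    have "isCont u a" using u(1) D holomorphic_on_imp_continuous_on
      by (metis centre_in_ball continuous_on_eq_continuous_at open_ball)
    hence lim: "((\<lambda>z. norm (u z)) \<longlongrightarrow> norm (u a)) (at a)"
      by (simp add: isCont_def tendsto_norm)
    have ev: "\<forall>\<^sub>F z in at a. 1 / (C * B) \<le> norm (u z) \<and> norm (u z) \<le> C / B"
      unfolding eventually_at using D gb u(2) by (intro exI[of _ D]) (auto simp: dist_commute)
    have "1 / (C * B) \<le> norm (u a)"
      by (rule tendsto_lowerbound[OF lim]) (use ev in \<open>auto elim: eventually_mono\<close>)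
    moreover have "norm (u a) \<le> C / B"
      by (rule tendsto_upperbound[OF lim]) (use ev in \<open>auto elim: eventually_mono\<close>)
    ultimately show ?thesis using True by simp
  qed
  have unz: "u z \<noteq> 0" if "z \<in> ball a D" for z
  proof -
    have "0 < 1 / (C * B)" using B C by simp
    thus ?thesis using ub[OF that] by auto
  qed
  obtain l where l: "l holomorphic_on ball a D" "\<And>z. z \<in> ball a D \<Longrightarrow> u z = exp (l z)"
    using contractible_imp_holomorphic_log[OF u(1) convex_imp_contractible[OF convex_ball] unz] by metis
  define v where "v z = exp (l z / of_nat m)" for z
  have vm: "v z ^ m = u z" if "z \<in> ball a D" for z
    using l(2)[OF that] m by (simp add: v_def exp_of_nat_mult[symmetric])
  show thesis
  proof (rule that[of v])
    show "v holomorphic_on ball a D" unfolding v_def using m by (intro holomorphic_intros l(1)) auto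
    show "1 / (C * B) \<le> norm (v z) ^ m \<and> norm (v z) ^ m \<le> C / B" if "z \<in> ball a D" for z
      using ub[OF that] vm[OF that] by (simp add: norm_power[symmetric])
    show "f z = 1 / ((z - a) * v z) ^ m" if "z \<in> ball a D" "z \<noteq> a" for z
      using u(2)[of z] that vm[of z] fnz[of z] by (simp add: g_def power_mult_distrib)
  qed
qed

text \<open>A solution of \<open>H z = \<zeta>\<close> is a fixed point of
  \<open>\<zeta> - (H z - z)\<close>, which maps the closed disk of radius
  \<open>2 * norm \<zeta>\<close> about \<open>a\<close> into itself and contracts it by
  1/2.\<close>

lemma near_identity_surj:
  fixes H :: "complex \<Rightarrow> complex"
  assumes "H a = 0"
    and lip: "\<And>x y. x \<in> ball a r \<Longrightarrow> y \<in> ball a r \<Longrightarrow> norm ((H x - x) - (H y - y)) \<le> 1/2 * norm (x - y)"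
    and \<zeta>: "norm \<zeta> < r / 2"
  shows "\<exists>z\<in>ball a r. H z = \<zeta>"
proof -
  let ?S = "cball a (2 * norm \<zeta>)"
  let ?T = "\<lambda>z. \<zeta> - (H z - z)"
  have sub: "?S \<subseteq> ball a r" using \<zeta> by auto
  have "\<exists>!x\<in>?S. ?T x = x"
  proof (rule Banach_fix[of _ "1/2"])
    show "?T ` ?S \<subseteq> ?S"
    proof (rule image_subsetI)
      fix z assume z: "z \<in> ?S"
      have "norm ((H z - z) - (H a - a)) \<le> 1/2 * norm (z - a)"
      proof (rule lip)
        show "z \<in> ball a r" using z sub by blast
        have "a \<in> ?S" by simp
        thus "a \<in> ball a r" using sub by blast
      qed
      moreover have "norm (z - a) \<le> 2 * norm \<zeta>" using z by (simp add: dist_norm norm_minus_commute)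
      moreover have "norm (a - ?T z) \<le> norm ((H z - z) - (H a - a)) + norm \<zeta>"
        using norm_triangle_ineq4[of "(H z - z) - (H a - a)" \<zeta>] assms(1) by (simp add: algebra_simps)
      ultimately show "?T z \<in> ?S" by (simp add: dist_norm)
    qed
    show "dist (?T x) (?T y) \<le> 1/2 * dist x y" if "x \<in> ?S" "y \<in> ?S" for x y
    proof -
      have "?T x - ?T y = - ((H x - x) - (H y - y))" by simp
      hence "norm (?T x - ?T y) = norm ((H x - x) - (H y - y))" by (metis norm_minus_cancel)
      moreover have "x \<in> ball a r" "y \<in> ball a r" using that sub by blast+
      ultimately show ?thesis using lip[of x y] by (simp only: dist_norm)
    qed
  qed (auto simp: complete_eq_closed)
  then obtain z where z: "z \<in> ?S" "?T z = z" by blast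
  hence "H z = \<zeta>" by (simp add: algebra_simps)
  thus ?thesis using z(1) sub by blast
qed

text \<open>The chart is \<open>h z = (z - a) * v z\<close>, and \<open>A\<close> is the modulus of
  its derivative at \<open>a\<close>. The normalized factor \<open>k = v / v a\<close> is bounded by
  \<open>C\<^sup>2\<close> for every \<open>m\<close>, hence its derivative by
  \<open>4 * C\<^sup>2 / D\<close> near \<open>a\<close> by Cauchy's inequality, and
  \<open>r\<close> is the radius whose product with this bound is 1/4. There
  \<open>H z = (z - a) * k z\<close> differs from the identity by a map with Lipschitz constant 1/2,
  which yields injectivity, both Lipschitz bounds and the size of the image.\<close>

lemma pole_chart:
  fixes f :: "complex \<Rightarrow> complex"
  assumes hol: "f holomorphic_on ball a D - {a}" and D: "D > 0" and m: "m \<ge> 1"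
    and B: "B > 0" and C: "C \<ge> 1"
    and bnd: "\<And>z. z \<in> ball a D \<Longrightarrow> z \<noteq> a \<Longrightarrow>
      inverse C * (B / norm (z - a) ^ m) \<le> norm (f z) \<and> norm (f z) \<le> C * (B / norm (z - a) ^ m)"
    and r: "r = D / (16 * C\<^sup>2)"
  obtains h A where "A > 0" "1 / (C * B) \<le> A ^ m" "A ^ m \<le> C / B" "h a = 0"
    "\<And>z. z \<in> ball a r \<Longrightarrow> z \<noteq> a \<Longrightarrow> h z \<noteq> 0 \<and> f z = 1 / h z ^ m"
    "\<And>x y. x \<in> ball a r \<Longrightarrow> y \<in> ball a r \<Longrightarrow>
      norm (x - y) \<le> 2 / A * norm (h x - h y) \<and> norm (h x - h y) \<le> 3/2 * A * norm (x - y)"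
    "\<And>\<zeta>. norm \<zeta> < A * r / 2 \<Longrightarrow> \<exists>z\<in>ball a r. h z = \<zeta>"
proof -
  obtain v where v: "v holomorphic_on ball a D"
    "\<And>z. z \<in> ball a D \<Longrightarrow> 1 / (C * B) \<le> norm (v z) ^ m \<and> norm (v z) ^ m \<le> C / B"
    "\<And>z. z \<in> ball a D \<Longrightarrow> z \<noteq> a \<Longrightarrow> f z = 1 / ((z - a) * v z) ^ m"
    using pole_root_factorization[OF hol D m B C bnd] by metis
  have vnz: "v z \<noteq> 0" if "z \<in> ball a D" for z
  proof -
    have "0 < 1 / (C * B)" using B C by simp
    thus ?thesis using v(2)[OF that] m by (auto simp: power_0_left)
  qed
  define A where "A = norm (v a)"
  have aD: "a \<in> ball a D" using D by simp
  have A: "A > 0" using vnz[OF aD] by (simp add: A_def)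
  define k where "k z = v z / v a" for z
  have khol: "k holomorphic_on ball a D" unfolding k_def using vnz[OF aD] by (intro holomorphic_intros v(1)) auto
  have C2: "C\<^sup>2 \<ge> 1" using C by (simp add: one_le_power)
  have kb: "norm (k z) \<le> C\<^sup>2" if z: "z \<in> ball a D" for z
  proof (cases "norm (k z) \<le> 1")
    case True thus ?thesis using C2 by simp
  next
    case False
    have "norm (k z) \<le> norm (k z) ^ m" using False m by (intro self_le_power) auto
    also have "\<dots> = norm (v z) ^ m / A ^ m" by (simp add: k_def A_def norm_divide power_divide)
    also have "\<dots> \<le> (C / B) / (1 / (C * B))"
      using v(2)[OF z] v(2)[OF aD] A B C by (intro frac_le) (auto simp: A_def)
    also have "\<dots> = C\<^sup>2" using B C by (simp add: field_simps power2_eq_square)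
    finally show ?thesis .
  qed
  have r0: "r > 0" "r \<le> D / 16"
  proof -
    show "r > 0" unfolding r using D C2 by (intro divide_pos_pos) auto
    have "D / (16 * C\<^sup>2) \<le> D / (16 * 1)" using D C2 by (intro divide_left_mono) auto
    thus "r \<le> D / 16" using r by simp
  qed
  have k': "norm (deriv k z) \<le> 4 * C\<^sup>2 / D" if z: "z \<in> ball a r" for z
  proof -
    have sub: "cball z (D/4) \<subseteq> ball a D"
    proof
      fix w assume "w \<in> cball z (D/4)"
      thus "w \<in> ball a D" using dist_triangle[of a w z] z r0 D by simp
    qed
    have "norm ((deriv ^^ 1) k z) \<le> fact 1 * C\<^sup>2 / (D/4) ^ 1"
    proof (rule Cauchy_inequality)
      show "k holomorphic_on ball z (D/4)" using khol sub by (meson ball_subset_cball holomorphic_on_subset order_trans)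
      show "continuous_on (cball z (D/4)) k" using khol sub holomorphic_on_imp_continuous_on holomorphic_on_subset by blast
      show "norm (k x) \<le> C\<^sup>2" if "norm (z - x) = D/4" for x
        using that sub by (intro kb) (auto simp: dist_norm subset_iff)
    qed (use D in auto)
    thus ?thesis by (simp add: mult.commute)
  qed
  have rsub: "ball a r \<subseteq> ball a D" using r0 D by (intro subset_ball) auto
  define H where "H z = (z - a) * k z" for z
  have k1: "k a = 1" using vnz[OF aD] by (simp add: k_def)
  have kder: "(k has_field_derivative deriv k z) (at z within ball a r)" if "z \<in> ball a r" for z
  proof -
    have "(k has_field_derivative deriv k z) (at z)" by (rule holomorphic_derivI[OF khol]) (use that rsub in auto)
    thus ?thesis by (rule has_field_derivative_at_within)
  qed
  have CDr: "4 * C\<^sup>2 / D * r = 1/4" using r D C by (simp add: field_simps)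
  have kn: "norm (k z - 1) \<le> 1/4" if z: "z \<in> ball a r" for z
  proof -
    have "norm (k z - k a) \<le> 4 * C\<^sup>2 / D * norm (z - a)"
      by (rule field_differentiable_bound[OF convex_ball kder k' z]) (use r0 in auto)
    also have "\<dots> \<le> 4 * C\<^sup>2 / D * r" using z D by (intro mult_left_mono) (auto simp: dist_norm norm_minus_commute)
    finally show ?thesis by (simp only: k1 CDr)
  qed
  have Hlip: "norm ((H x - x) - (H y - y)) \<le> 1/2 * norm (x - y)" if xy: "x \<in> ball a r" "y \<in> ball a r" for x y
  proof (rule field_differentiable_bound[where f = "\<lambda>z. H z - z" and f' = "\<lambda>z. (z - a) * deriv k z + (k z - 1)", OF convex_ball _ _ xy])
    fix z assume z: "z \<in> ball a r"
    have "((\<lambda>z. (z - a) * k z - z) has_field_derivative ((1 - 0) * k z + deriv k z * (z - a)) - 1) (at z within ball a r)"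
      by (intro DERIV_diff DERIV_mult DERIV_ident DERIV_const kder z)
    thus "((\<lambda>z. H z - z) has_field_derivative (z - a) * deriv k z + (k z - 1)) (at z within ball a r)"
      by (simp add: H_def algebra_simps)
    have "norm ((z - a) * deriv k z) \<le> r * (4 * C\<^sup>2 / D)"
      unfolding norm_mult using z r0 k'[OF z] D by (intro mult_mono) (auto simp: dist_norm norm_minus_commute)
    hence "norm ((z - a) * deriv k z) \<le> 1/4" by (simp only: CDr mult.commute[of r])
    thus "norm ((z - a) * deriv k z + (k z - 1)) \<le> 1/2"
      using kn[OF z] norm_triangle_ineq[of "(z - a) * deriv k z" "k z - 1"] by linarith
  qed
  define h where "h z = v a * H z" for z
  have hv: "h z = (z - a) * v z" for z using vnz[OF aD] by (simp add: h_def H_def k_def)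
  show thesis
  proof (rule that[of A h])
    show "A > 0" "1 / (C * B) \<le> A ^ m" "A ^ m \<le> C / B" using A v(2)[OF aD] by (auto simp: A_def)
    show "h a = 0" by (simp add: hv)
    show "h z \<noteq> 0 \<and> f z = 1 / h z ^ m" if "z \<in> ball a r" "z \<noteq> a" for z
      using v(3)[of z] vnz[of z] that rsub by (auto simp: hv)
    show "norm (x - y) \<le> 2 / A * norm (h x - h y) \<and> norm (h x - h y) \<le> 3/2 * A * norm (x - y)"
      if xy: "x \<in> ball a r" "y \<in> ball a r" for x y
    proof -
      have eq: "norm (h x - h y) = A * norm (H x - H y)"
        by (simp add: h_def A_def right_diff_distrib[symmetric] norm_mult)
      have "norm (x - y) \<le> norm (H x - H y) + 1/2 * norm (x - y)"
        using Hlip[OF xy] norm_triangle_ineq4[of "H x - H y" "(H x - x) - (H y - y)"] by (simp add: algebra_simps)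
      moreover have "norm (H x - H y) \<le> norm (x - y) + 1/2 * norm (x - y)"
        using Hlip[OF xy] norm_triangle_ineq[of "x - y" "(H x - x) - (H y - y)"] by (simp add: algebra_simps)
      ultimately show ?thesis unfolding eq using A by (auto simp: field_simps)
    qed
    show "\<exists>z\<in>ball a r. h z = \<zeta>" if "norm \<zeta> < A * r / 2" for \<zeta>
    proof -
      have "norm (\<zeta> / v a) < r / 2" using that A by (simp add: norm_divide A_def[symmetric] field_simps)
      then obtain z where "z \<in> ball a r" "H z = \<zeta> / v a"
        using near_identity_surj[of H a r "\<zeta> / v a"] Hlip by (metis H_def cancel_comm_monoid_add_class.diff_cancel mult_zero_left)
      thus ?thesis using vnz[OF aD] by (intro bexI[of _ z]) (auto simp: h_def)
    qed
  qed
qed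

section \<open>Expansion and inverse branches in a chart\<close>

lemma norm_power_diff_le:
  fixes x y :: complex
  assumes "norm x \<le> q" "norm y \<le> q"
  shows "norm (x ^ m - y ^ m) \<le> real m * q ^ (m - 1) * norm (x - y)"
proof (rule field_differentiable_bound[where f' = "\<lambda>z. of_nat m * z ^ (m - 1)" and S = "cball 0 q"])
  fix z :: complex assume z: "z \<in> cball 0 q"
  show "((\<lambda>z. z ^ m) has_field_derivative of_nat m * z ^ (m - 1)) (at z within cball 0 q)"
    by (rule has_field_derivative_at_within) (auto intro!: derivative_eq_intros)
  show "norm (of_nat m * z ^ (m - 1)) \<le> real m * q ^ (m - 1)"
    using z by (simp add: norm_mult norm_power mult_left_mono power_mono)
qed (use assms in auto)

text \<open>Comes from \<open>f x - f y = f x * f y * (h y ^ m - h x ^ m)\<close>. Since |f| is at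
  least \<open>lo\<close>, |h| is at most \<open>lo powr (-1 / m)\<close>, and the difference of
  m-th powers carries the factor \<open>lo powr (1 / m - 1)\<close>.\<close>

lemma chart_expansion:
  fixes f h :: "complex \<Rightarrow> complex"
  assumes m: "m \<ge> 1" and f: "f x = 1 / h x ^ m" "f y = 1 / h y ^ m" "h x \<noteq> 0" "h y \<noteq> 0"
    and lo: "lo > 0" "lo \<le> norm (f x)" "lo \<le> norm (f y)" and hi: "norm (f x) \<le> hi" "norm (f y) \<le> hi"
    and L: "norm (h x - h y) \<le> L * norm (x - y)"
  shows "norm (f x - f y) \<le> hi\<^sup>2 * (real m * lo powr (1 / real m - 1) * (L * norm (x - y)))"
proof -
  let ?q = "lo powr (- 1 / real m)"
  have hq: "norm (h z) \<le> ?q" if "f z = 1 / h z ^ m" "h z \<noteq> 0" "lo \<le> norm (f z)" for z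
  proof -
    have "norm (h z) ^ m = 1 / norm (f z)" using that by (simp add: norm_divide norm_power)
    also have "\<dots> \<le> 1 / lo" using that lo(1) by (intro divide_left_mono) auto
    also have "\<dots> = lo powr (-1)" using lo(1) by (simp add: powr_minus_divide)
    also have "\<dots> = ?q ^ m" using lo(1) m by (subst powr_power) auto
    finally show ?thesis using m by (subst (asm) power_mono_iff) auto
  qed
  have "f x - f y = (f x * f y) * (h y ^ m - h x ^ m)" using f by (simp add: field_simps)
  hence "norm (f x - f y) = norm (f x) * norm (f y) * norm (h y ^ m - h x ^ m)" by (simp add: norm_mult)
  also have "\<dots> \<le> hi\<^sup>2 * (real m * ?q ^ (m - 1) * norm (h y - h x))"
    using hi norm_power_diff_le[OF hq[of y] hq[of x], of m] f lo unfolding power2_eq_square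
    by (intro mult_mono) (auto intro: order_trans[OF norm_ge_zero])
  also have "?q ^ (m - 1) = lo powr (1 / real m - 1)"
  proof -
    have "(- 1 / real m) * real (m - 1) = 1 / real m - 1" using m by (simp add: of_nat_diff field_simps)
    thus ?thesis using lo(1) by (simp add: powr_power)
  qed
  also have "hi\<^sup>2 * (real m * lo powr (1 / real m - 1) * norm (h y - h x))
     \<le> hi\<^sup>2 * (real m * lo powr (1 / real m - 1) * (L * norm (x - y)))"
    using L by (intro mult_left_mono) (auto simp: norm_minus_commute)
  finally show ?thesis .
qed

text \<open>On the disk of radius \<open>norm w / 2\<close> about \<open>w\<close> the quotient
  \<open>u / w\<close> stays in the right half-plane, so \<open>Ln (u / w)\<close> is a holomorphic
  logarithm there and roots can be continued from \<open>w\<close> to the whole disk.\<close>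

lemma Re_pos_of_ball_ratio:
  fixes u w :: complex
  assumes "w \<noteq> 0" "u \<in> ball w (norm w / 2)"
  shows "Re (u / w) > 0" "u / w \<notin> \<real>\<^sub>\<le>\<^sub>0" "norm u > norm w / 2" "u \<noteq> 0"
proof -
  have "norm (u / w - 1) = norm (u - w) / norm w" using assms(1) by (simp add: norm_divide[symmetric] diff_divide_distrib)
  also have "\<dots> < 1/2" using assms by (simp add: dist_norm norm_minus_commute field_simps)
  finally have "\<bar>Re (u / w - 1)\<bar> < 1/2" using abs_Re_le_cmod by (rule order_le_less_trans[rotated])
  hence "\<bar>Re (u / w) - 1\<bar> < 1/2" by simp
  thus *: "Re (u / w) > 0" by linarith
  thus "u / w \<notin> \<real>\<^sub>\<le>\<^sub>0" by (auto simp: complex_nonpos_Reals_iff)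
  show "u \<noteq> 0" using * by auto
  show "norm u > norm w / 2" using assms norm_triangle_ineq2[of w "w - u"] by (simp add: dist_norm)
qed

text \<open>Solving \<open>f z = u\<close> means finding \<open>h z\<close> among the m-th roots of
  \<open>1 / u\<close>. Each root \<open>\<zeta>\<close> of \<open>1 / w\<close> continues to
  \<open>\<zeta> * exp (- Ln (u / w) / m)\<close>, and composing with the inverse of the chart gives
  a branch. The bound on \<open>2 / norm w\<close> keeps these roots in the image of the chart. The
  derivative of the continued root has its modulus divided by m|u| as size, whence the exponent 1 +
  1/m.\<close>

lemma chart_branches:
  fixes f h :: "complex \<Rightarrow> complex"
  assumes m: "m \<ge> 1" and A: "A > 0" and h0: "h a = 0"
    and f: "\<And>z. z \<in> ball a r \<Longrightarrow> z \<noteq> a \<Longrightarrow> h z \<noteq> 0 \<and> f z = 1 / h z ^ m"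
    and lip: "\<And>x y. x \<in> ball a r \<Longrightarrow> y \<in> ball a r \<Longrightarrow> norm (x - y) \<le> 2 / A * norm (h x - h y)"
    and surj: "\<And>\<zeta>. norm \<zeta> < A * r / 2 \<Longrightarrow> \<exists>z\<in>ball a r. h z = \<zeta>"
    and w: "w \<noteq> 0" "2 / norm w \<le> (A * r / 2) ^ m" and r: "r > 0"
  obtains \<Phi> :: "(complex \<Rightarrow> complex) set" where "finite \<Phi>" "card \<Phi> \<le> m" "\<Phi> \<noteq> {}"
    "\<And>\<psi> u. \<psi> \<in> \<Phi> \<Longrightarrow> u \<in> ball w (norm w / 2) \<Longrightarrow> \<psi> u \<in> ball a r \<and> \<psi> u \<noteq> a \<and> f (\<psi> u) = u"
    "\<And>\<psi> u u'. \<psi> \<in> \<Phi> \<Longrightarrow> u \<in> ball w (norm w / 2) \<Longrightarrow> u' \<in> ball w (norm w / 2) \<Longrightarrow>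
        norm (\<psi> u - \<psi> u') \<le> 2 / A * (2 / norm w) powr (1 + 1 / real m) * norm (u - u')"
    "\<And>z. z \<in> ball a r \<Longrightarrow> z \<noteq> a \<Longrightarrow> f z \<in> ball w (norm w / 2) \<Longrightarrow> \<exists>\<psi>\<in>\<Phi>. \<psi> (f z) = z"
proof -
  let ?W = "ball w (norm w / 2)"
  define Z where "Z = {\<zeta>::complex. \<zeta> ^ m = 1 / w}"
  define P where "P \<zeta> u = \<zeta> * exp (- Ln (u / w) / of_nat m)" for \<zeta> u
  define \<psi> where "\<psi> \<zeta> u = inv_into (ball a r) h (P \<zeta> u)" for \<zeta> u
  have Pm: "P \<zeta> u ^ m = 1 / u" if "\<zeta> \<in> Z" "u \<in> ?W" for \<zeta> u
  proof -
    note u = Re_pos_of_ball_ratio[OF w(1) that(2)]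
    have "exp (- Ln (u / w) / of_nat m) ^ m = exp (- Ln (u / w))"
      using m by (simp add: exp_of_nat_mult[symmetric])
    also have "\<dots> = w / u" using u(4) w(1) by (simp add: exp_minus)
    finally show ?thesis using that(1) w(1) by (simp add: P_def power_mult_distrib Z_def)
  qed
  have Pn: "norm (P \<zeta> u) ^ m < 2 / norm w" if "\<zeta> \<in> Z" "u \<in> ?W" for \<zeta> u
  proof -
    note u = Re_pos_of_ball_ratio[OF w(1) that(2)]
    have "norm (P \<zeta> u) ^ m = 1 / norm u" using Pm[OF that] by (simp add: norm_power[symmetric] norm_divide)
    also have "\<dots> < 1 / (norm w / 2)" using u w(1) by (intro divide_strict_left_mono) auto
    finally show ?thesis by simp
  qed
  have Pr: "norm (P \<zeta> u) < A * r / 2" if "\<zeta> \<in> Z" "u \<in> ?W" for \<zeta> u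
  proof -
    have "norm (P \<zeta> u) ^ m < (A * r / 2) ^ m" using Pn[OF that] w(2) by linarith
    thus ?thesis by (rule power_less_imp_less_base) (use A r in auto)
  qed
  have Pnz: "P \<zeta> u \<noteq> 0" if "\<zeta> \<in> Z" for \<zeta> u
    using that m w(1) by (auto simp: P_def Z_def power_0_left)
  have hinj: "inj_on h (ball a r)" using lip by (force simp: inj_on_def)
  have \<psi>: "\<psi> \<zeta> u \<in> ball a r" "h (\<psi> \<zeta> u) = P \<zeta> u" if "\<zeta> \<in> Z" "u \<in> ?W" for \<zeta> u
  proof -
    have "P \<zeta> u \<in> h ` ball a r" using surj[OF Pr[OF that]] by (metis imageI)
    thus "\<psi> \<zeta> u \<in> ball a r" "h (\<psi> \<zeta> u) = P \<zeta> u" unfolding \<psi>_def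
      by (rule inv_into_into, rule f_inv_into_f)
  qed
  have Plip: "norm (P \<zeta> u - P \<zeta> u') \<le> (2 / norm w) powr (1 + 1 / real m) * norm (u - u')"
    if z: "\<zeta> \<in> Z" and uu: "u \<in> ?W" "u' \<in> ?W" for \<zeta> u u'
  proof (rule field_differentiable_bound[where f' = "\<lambda>u. P \<zeta> u * (- (1 / u) / of_nat m)", OF convex_ball _ _ uu])
    fix v assume v: "v \<in> ?W"
    note v' = Re_pos_of_ball_ratio[OF w(1) v]
    have "((\<lambda>u. \<zeta> * exp (- Ln (u / w) / of_nat m)) has_field_derivative
        \<zeta> * (exp (- Ln (v / w) / of_nat m) * (- (1 / v) / of_nat m))) (at v)"
      using v' w(1) m by (auto intro!: derivative_eq_intros simp: field_simps)
    hence "(P \<zeta> has_field_derivative P \<zeta> v * (- (1 / v) / of_nat m)) (at v)"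
      unfolding P_def by (simp only: mult.assoc)
    thus "(P \<zeta> has_field_derivative P \<zeta> v * (- (1 / v) / of_nat m)) (at v within ?W)"
      by (rule has_field_derivative_at_within)
    have "norm (P \<zeta> v) \<le> (2 / norm w) powr (1 / real m)"
    proof -
      have "norm (P \<zeta> v) ^ m \<le> ((2 / norm w) powr (1 / real m)) ^ m"
        using Pn[OF z v] m w(1) by (simp add: powr_power)
      thus ?thesis using m by (subst (asm) power_mono_iff) auto
    qed
    moreover have "norm (- (1 / v) / of_nat m) \<le> 2 / norm w"
    proof -
      have "norm (- (1 / v) / of_nat m) = 1 / (norm v * real m)" by (simp add: norm_divide norm_mult)
      also have "\<dots> \<le> 1 / (norm w / 2 * 1)"
        using v' w(1) m by (intro divide_left_mono mult_mono) auto
      finally show ?thesis by simp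
    qed
    ultimately have "norm (P \<zeta> v) * norm (- (1 / v) / of_nat m) \<le> (2 / norm w) powr (1 / real m) * (2 / norm w)"
      by (intro mult_mono) auto
    also have "\<dots> = (2 / norm w) powr (1 + 1 / real m)" using w(1) by (simp add: powr_add)
    finally show "norm (P \<zeta> v * (- (1 / v) / of_nat m)) \<le> (2 / norm w) powr (1 + 1 / real m)"
      by (simp only: norm_mult)
  qed
  have Z: "finite Z" "card Z = m"
    unfolding Z_def using m w(1) by (auto intro!: finite_nth_roots card_nth_roots)
  show thesis
  proof (rule that[of "\<psi> ` Z"], goal_cases)
    case 1 thus ?case using Z by simp
  next
    case 2 thus ?case using Z card_image_le by metis
  next
    case 3 thus ?case using Z m by auto
  next
    case (4 p u)
    then obtain \<zeta> where \<zeta>: "\<zeta> \<in> Z" "p = \<psi> \<zeta>" by blast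
    have ne: "\<psi> \<zeta> u \<noteq> a" using \<psi>[OF \<zeta>(1) 4(2)] Pnz[OF \<zeta>(1), of u] h0 by auto
    have "f (\<psi> \<zeta> u) = 1 / P \<zeta> u ^ m" using f[OF \<psi>(1)[OF \<zeta>(1) 4(2)] ne] \<psi>(2)[OF \<zeta>(1) 4(2)] by simp
    also have "\<dots> = u" using Pm[OF \<zeta>(1) 4(2)] by simp
    finally show ?case using \<psi>(1)[OF \<zeta>(1) 4(2)] ne \<zeta>(2) by simp
  next
    case (5 p u u')
    then obtain \<zeta> where \<zeta>: "\<zeta> \<in> Z" "p = \<psi> \<zeta>" by blast
    have "norm (\<psi> \<zeta> u - \<psi> \<zeta> u') \<le> 2 / A * norm (P \<zeta> u - P \<zeta> u')"
      using lip[OF \<psi>(1)[OF \<zeta>(1) 5(2)] \<psi>(1)[OF \<zeta>(1) 5(3)]] \<psi>(2)[OF \<zeta>(1)] 5 by simp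
    also have "\<dots> \<le> 2 / A * ((2 / norm w) powr (1 + 1 / real m) * norm (u - u'))"
      using A by (intro mult_left_mono Plip \<zeta> 5) auto
    finally show ?case using \<zeta>(2) by (simp add: mult.assoc)
  next
    case (6 z)
    let ?u = "f z"
    note u = Re_pos_of_ball_ratio[OF w(1) 6(3)]
    \<comment> \<open>Running the continuation of the root backwards from \<open>f z\<close> to
      \<open>w\<close> identifies the branch through \<open>z\<close>.\<close>
    define \<zeta> where "\<zeta> = h z * exp (Ln (?u / w) / of_nat m)"
    have "exp (Ln (?u / w) / of_nat m) ^ m = ?u / w"
      using m u w(1) by (simp add: exp_of_nat_mult[symmetric])
    hence "\<zeta> ^ m = 1 / w" using f[OF 6(1,2)] u(4) by (simp add: \<zeta>_def power_mult_distrib)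
    moreover have "P \<zeta> ?u = h z" by (simp add: P_def \<zeta>_def exp_minus)
    hence "\<psi> \<zeta> ?u = z" using hinj 6(1) by (simp add: \<psi>_def)
    ultimately show ?case by (auto simp: Z_def)
  qed
qed

section \<open>Counting poles\<close>

lemma pole_mult_pos:
  assumes "plane_meromorphic f" "a \<in> poles f"
  shows "pole_mult f a \<ge> 1"
proof -
  have "isolated_singularity_at f a"
    using assms by (meson UNIV_I meromorphic_on_isolated_singularity plane_meromorphic_def meromorphic_on_altdef)
  hence "zorder f a < 0" using assms(2) by (intro isolated_pole_imp_neg_zorder) (auto simp: poles_def)
  thus ?thesis by (simp add: pole_mult_def)
qed

text \<open>The counting function is a finite sum of step functions, so N(2r) is an explicit sum to
  which a nonzero pole of modulus at most r contributes at least ln 2. The origin is left out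
  because \<open>nev_N\<close> treats it in a separate logarithmic term.\<close>

lemma nev_N_ge_card:
  assumes pm: "plane_meromorphic f" and r: "r \<ge> 1"
  shows "real (card (poles f \<inter> cball 0 r - {0})) * ln 2 \<le> nev_N f (2 * r)"
proof -
  define P where "P = poles f \<inter> cball 0 (2 * r) - {0}"
  have fin: "finite (poles f \<inter> cball 0 t)" for t
    by (rule finite_poles_Int_compact[OF pm]) simp
  have finP: "finite P" by (simp add: P_def fin)
  have cnt: "pole_count f t - pole_count f 0 = (\<Sum>a\<in>P. if norm a \<le> t then real (pole_mult f a) else 0)"
    if t: "t \<in> {0..2 * r}" for t
  proof -
    let ?B = "{a\<in>P. norm a \<le> t}"
    have eq: "poles f \<inter> cball 0 t = (poles f \<inter> cball 0 0) \<union> ?B"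
      using t by (auto simp: P_def)
    have "(poles f \<inter> cball 0 0) \<inter> ?B = {}" by (auto simp: P_def)
    moreover have "finite ?B" using finP by simp
    ultimately have "(\<Sum>a\<in>(poles f \<inter> cball 0 0) \<union> ?B. real (pole_mult f a)) =
        (\<Sum>a\<in>poles f \<inter> cball 0 0. real (pole_mult f a)) + (\<Sum>a\<in>?B. real (pole_mult f a))"
      by (intro sum.union_disjoint fin)
    hence "pole_count f t = pole_count f 0 + (\<Sum>a\<in>?B. real (pole_mult f a))"
      unfolding pole_count_def of_nat_sum using eq by metis
    also have "(\<Sum>a\<in>{a\<in>P. norm a \<le> t}. real (pole_mult f a)) = (\<Sum>a\<in>P. if norm a \<le> t then real (pole_mult f a) else 0)"
      by (rule sum.inter_filter[OF finP])
    finally show ?thesis by simp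
  qed
  have int1: "((\<lambda>t. (if norm a \<le> t then real (pole_mult f a) else 0) / t) has_integral
      real (pole_mult f a) * (ln (2 * r) - ln (norm a))) {0..2 * r}" if a: "a \<in> P" for a
  proof -
    have na: "0 < norm a" "norm a \<le> 2 * r" using a by (auto simp: P_def)
    have "((\<lambda>t. real (pole_mult f a) * (1 / t)) has_integral
       real (pole_mult f a) * (ln (2 * r) - ln (norm a))) {norm a..2 * r}"
    proof (rule has_integral_mult_right, rule fundamental_theorem_of_calculus)
      fix t assume "t \<in> {norm a..2 * r}"
      hence "t > 0" using na(1) unfolding atLeastAtMost_iff by linarith
      thus "(ln has_vector_derivative 1 / t) (at t within {norm a..2 * r})"
        by (auto intro!: derivative_eq_intros simp: has_real_derivative_iff_has_vector_derivative[symmetric])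
    qed (use na in auto)
    hence "((\<lambda>t. if t \<in> {norm a..2 * r} then real (pole_mult f a) * (1 / t) else 0) has_integral
       real (pole_mult f a) * (ln (2 * r) - ln (norm a))) {0..2 * r}"
      using na by (subst has_integral_restrict) auto
    thus ?thesis by (rule has_integral_eq[rotated]) auto
  qed
  have "((\<lambda>t. (pole_count f t - pole_count f 0) / t) has_integral
      (\<Sum>a\<in>P. real (pole_mult f a) * (ln (2 * r) - ln (norm a)))) {0..2 * r}"
  proof (rule has_integral_eq)
    show "((\<lambda>t. \<Sum>a\<in>P. (if norm a \<le> t then real (pole_mult f a) else 0) / t) has_integral
      (\<Sum>a\<in>P. real (pole_mult f a) * (ln (2 * r) - ln (norm a)))) {0..2 * r}"
      by (rule has_integral_sum[OF finP int1])
    show "(\<Sum>a\<in>P. (if norm a \<le> t then real (pole_mult f a) else 0) / t) = (pole_count f t - pole_count f 0) / t"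
      if "t \<in> {0..2 * r}" for t
      unfolding cnt[OF that] by (simp only: sum_divide_distrib)
  qed
  hence N: "nev_N f (2 * r) = (\<Sum>a\<in>P. real (pole_mult f a) * (ln (2 * r) - ln (norm a))) + pole_count f 0 * ln (2 * r)"
    by (simp add: nev_N_def integral_unique)
  have "real (card (poles f \<inter> cball 0 r - {0})) * ln 2 = (\<Sum>a\<in>poles f \<inter> cball 0 r - {0}. ln 2)" by simp
  also have "\<dots> \<le> (\<Sum>a\<in>P. real (pole_mult f a) * (ln (2 * r) - ln (norm a)))"
  proof (rule sum_mono2[OF finP, THEN order_trans[rotated]])
    show "poles f \<inter> cball 0 r - {0} \<subseteq> P" using r by (auto simp: P_def)
    show "0 \<le> real (pole_mult f b) * (ln (2 * r) - ln (norm b))" if "b \<in> P - (poles f \<inter> cball 0 r - {0})" for b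
      using that by (intro mult_nonneg_nonneg) (auto simp: P_def)
    show "(\<Sum>a\<in>poles f \<inter> cball 0 r - {0}. ln 2) \<le> (\<Sum>a\<in>poles f \<inter> cball 0 r - {0}. real (pole_mult f a) * (ln (2 * r) - ln (norm a)))"
    proof (rule sum_mono)
      fix a assume a: "a \<in> poles f \<inter> cball 0 r - {0}"
      hence na: "norm a > 0" "norm a \<le> r" by auto
      have "ln (norm a) \<le> ln r" by (subst ln_le_cancel_iff) (use na in linarith)+
      hence "ln 2 \<le> ln (2 * r) - ln (norm a)" using r by (simp add: ln_mult)
      moreover have "(1::real) \<le> real (pole_mult f a)" using pole_mult_pos[OF pm, of a] a by simp
      moreover have "(0::real) \<le> ln 2" by simp
      ultimately have "1 * ln 2 \<le> real (pole_mult f a) * (ln (2 * r) - ln (norm a))"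
        by (intro mult_mono) linarith+
      thus "ln 2 \<le> real (pole_mult f a) * (ln (2 * r) - ln (norm a))" by simp
    qed
  qed
  also have "\<dots> \<le> nev_N f (2 * r)"
  proof -
    have "0 \<le> pole_count f 0 * ln (2 * r)"
      using r by (intro mult_nonneg_nonneg) (simp_all add: pole_count_def sum_nonneg)
    thus ?thesis unfolding N by simp
  qed
  finally show ?thesis .
qed

lemma nev_m_nonneg: "nev_m f r \<ge> 0"
proof -
  \<comment> \<open>If the integrand is not integrable, \<open>integral\<close> returns 0.\<close>
  have "integral {0..2*pi} (\<lambda>\<theta>. max 0 (ln (norm (f (of_real r * cis \<theta>))))) \<ge> 0"
    by (cases "(\<lambda>\<theta>. max 0 (ln (norm (f (of_real r * cis \<theta>))))) integrable_on {0..2*pi}")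
      (auto intro!: integral_nonneg simp: not_integrable_integral)
  thus ?thesis by (simp add: nev_m_def)
qed

text \<open>The order bounds T(2r) eventually by a power, and T(2r) bounds the number of poles.
  Radii without poles are split off, since a bound on ln T can be inverted only when T is
  positive.\<close>

lemma card_poles_le_powr:
  assumes pm: "plane_meromorphic f" and ord: "mero_order f = ereal \<rho>" and \<sigma>: "\<sigma> > \<rho>" "\<sigma> > 0"
  obtains K where "K > 0" "\<And>r. r \<ge> 1 \<Longrightarrow> real (card (poles f \<inter> cball 0 r - {0})) \<le> K * r powr \<sigma>"
proof -
  define n where "n r = real (card (poles f \<inter> cball 0 r - {0}))" for r
  have mono: "n r \<le> n r'" if "r \<le> r'" for r r'
  proof -
    have "finite (poles f \<inter> cball 0 r' - {0})" using finite_poles_Int_compact[OF pm] by simp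
    thus ?thesis unfolding n_def using that by (intro of_nat_mono card_mono) auto
  qed
  have "Limsup at_top (\<lambda>r::real. ereal (ln (nev_T f r) / ln r)) < ereal \<sigma>"
    using ord \<sigma> by (simp add: mero_order_def)
  hence "\<forall>\<^sub>F r in at_top. ereal (ln (nev_T f r) / ln r) < ereal \<sigma>"
    by (rule Limsup_lessD)
  then obtain r0 where r0: "\<And>r. r \<ge> r0 \<Longrightarrow> ln (nev_T f r) / ln r < \<sigma>"
    unfolding eventually_at_top_linorder by auto
  define r1 where "r1 = max 1 r0"
  \<comment> \<open>The second summand serves the radii between 1 and \<open>r1\<close>, where the
    order gives no information.\<close>
  define K where "K = 2 powr \<sigma> / ln 2 + n r1"
  have big: "n r \<le> 2 powr \<sigma> / ln 2 * r powr \<sigma>" if r: "r \<ge> r1" for r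
  proof (cases "n r = 0")
    case True thus ?thesis by simp
  next
    case False
    hence npos: "n r > 0" by (simp add: n_def)
    have r': "r \<ge> 1" "2 * r \<ge> r0" using r by (auto simp: r1_def)
    have T: "n r * ln 2 \<le> nev_T f (2 * r)"
      using nev_N_ge_card[OF pm r'(1)] nev_m_nonneg[of f "2 * r"] by (simp add: nev_T_def n_def)
    moreover have "n r * ln 2 > 0" using npos by simp
    ultimately have Tpos: "nev_T f (2 * r) > 0" by linarith
    have "ln (nev_T f (2 * r)) < \<sigma> * ln (2 * r)"
      using r0[OF r'(2)] r'(1) by (simp add: pos_divide_less_eq)
    hence "nev_T f (2 * r) < exp (\<sigma> * ln (2 * r))" using Tpos by (metis exp_less_cancel_iff exp_ln)
    also have "\<dots> = 2 powr \<sigma> * r powr \<sigma>" using r'(1) by (simp add: powr_def ln_mult exp_add[symmetric] algebra_simps)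
    finally have "n r * ln 2 \<le> 2 powr \<sigma> * r powr \<sigma>" using T by simp
    thus ?thesis by (simp add: field_simps)
  qed
  show thesis
  proof (rule that[of K])
    show "K > 0" unfolding K_def by (intro add_pos_nonneg) (auto simp: n_def)
    fix r :: real assume r: "r \<ge> 1"
    have rp: "r powr \<sigma> \<ge> 1" using r \<sigma> by (simp add: ge_one_powr_ge_zero)
    have nn: "n r1 \<ge> 0" by (simp add: n_def)
    show "real (card (poles f \<inter> cball 0 r - {0})) \<le> K * r powr \<sigma>"
    proof (cases "r \<ge> r1")
      case True
      have "n r \<le> 2 powr \<sigma> / ln 2 * r powr \<sigma> + n r1 * r powr \<sigma>"
        using big[OF True] mult_nonneg_nonneg[OF nn, of "r powr \<sigma>"] by simp
      thus ?thesis by (simp add: K_def n_def distrib_right)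
    next
      case False
      have "n r \<le> n r1 * 1" using mono[of r r1] False by simp
      also have "\<dots> \<le> K * r powr \<sigma>" unfolding K_def using rp nn by (intro mult_mono) auto
      finally show ?thesis by (simp add: n_def)
    qed
  qed
qed

text \<open>Dyadic annuli: with \<open>\<sigma>\<close> halfway between \<open>\<rho>\<close> and
  \<open>s\<close>, the annulus of index j holds at most a constant times
  \<open>2 powr (j * \<sigma>)\<close> poles, each contributing at most
  \<open>2 powr (- j * s)\<close>. This leaves a geometric series of ratio \<open>q\<close>.\<close>

lemma poles_summable:
  assumes pm: "plane_meromorphic f" and ord: "mero_order f = ereal \<rho>" and s: "s > \<rho>" "\<rho> > 0"
  shows "(\<lambda>a. norm a powr (-s)) summable_on poles f"
proof -
  define \<sigma> where "\<sigma> = (\<rho> + s) / 2"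
  have \<sigma>: "\<sigma> > \<rho>" "\<sigma> > 0" "\<sigma> < s" using s by (auto simp: \<sigma>_def)
  obtain K where K: "K > 0" "\<And>r. r \<ge> 1 \<Longrightarrow> real (card (poles f \<inter> cball 0 r - {0})) \<le> K * r powr \<sigma>"
    using card_poles_le_powr[OF pm ord \<sigma>(1,2)] by blast
  define q where "q = 2 powr (\<sigma> - s)"
  have q: "0 < q" "q < 1"
  proof -
    have "q < 2 powr 0" unfolding q_def using \<sigma> by (intro powr_less_mono) auto
    thus "0 < q" "q < 1" by (auto simp: q_def)
  qed
  define P where "P = poles f - cball 0 1"
  have "(\<lambda>a. norm a powr (-s)) summable_on P"
  proof (rule nonneg_bdd_above_summable_on)
    show "bdd_above (sum (\<lambda>a. norm a powr (-s)) ` {F. F \<subseteq> P \<and> finite F})"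
    proof (rule bdd_aboveI)
      fix x assume "x \<in> sum (\<lambda>a. norm a powr (-s)) ` {F. F \<subseteq> P \<and> finite F}"
      then obtain F where F: "F \<subseteq> P" "finite F" "x = (\<Sum>a\<in>F. norm a powr (-s))" by auto
      define k where "k a = nat \<lfloor>log 2 (norm a)\<rfloor>" for a :: complex
      have k: "2 powr real (k a) \<le> norm a" "norm a \<le> 2 powr (real (k a) + 1)" if "a \<in> F" for a
      proof -
        have "norm a > 1" using that F(1) by (auto simp: P_def)
        hence "log 2 (norm a) > 0" by (subst zero_less_log_cancel_iff) auto
        hence "real (k a) \<le> log 2 (norm a)" "log 2 (norm a) \<le> real (k a) + 1"
          unfolding k_def by linarith+
        thus "2 powr real (k a) \<le> norm a" "norm a \<le> 2 powr (real (k a) + 1)"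
          using \<open>norm a > 1\<close> le_log_iff[of 2 "norm a" "real (k a)"] log_le_iff[of 2 "norm a" "real (k a) + 1"]
          by (auto simp del: zero_less_norm_iff)
      qed
      obtain N where N: "k ` F \<subseteq> {..<N}" using F(2) by (meson finite_imageI finite_nat_iff_bounded)
      have "x = (\<Sum>j<N. \<Sum>a\<in>{a\<in>F. k a = j}. norm a powr (-s))"
        unfolding F(3) by (rule sum.group[symmetric]) (use F N in auto)
      also have "\<dots> \<le> (\<Sum>j<N. K * 2 powr \<sigma> * q ^ j)"
      proof (rule sum_mono)
        fix j
        let ?A = "{a\<in>F. k a = j}"
        have "(\<Sum>a\<in>?A. norm a powr (-s)) \<le> (\<Sum>a\<in>?A. (2 powr real j) powr (-s))"
        proof (rule sum_mono)
          fix a assume "a \<in> ?A"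
          thus "norm a powr (-s) \<le> (2 powr real j) powr (-s)" using k(1)[of a] s by (intro powr_mono2') auto
        qed
        also have "\<dots> = real (card ?A) * (2 powr real j) powr (-s)" by simp
        also have "\<dots> \<le> (K * (2 powr (real j + 1)) powr \<sigma>) * (2 powr real j) powr (-s)"
        proof (rule mult_right_mono)
          have "?A \<subseteq> poles f \<inter> cball 0 (2 powr (real j + 1)) - {0}" using F(1) k(2) by (auto simp: P_def)
          moreover have "finite (poles f \<inter> cball 0 (2 powr (real j + 1)) - {0})"
            using finite_poles_Int_compact[OF pm] by simp
          ultimately have "card ?A \<le> card (poles f \<inter> cball 0 (2 powr (real j + 1)) - {0})"
            by (intro card_mono)
          also have "real \<dots> \<le> K * (2 powr (real j + 1)) powr \<sigma>"
            by (rule K(2)) (auto simp: ge_one_powr_ge_zero)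
          finally show "real (card ?A) \<le> K * (2 powr (real j + 1)) powr \<sigma>" by simp
        qed auto
        also have "\<dots> = K * 2 powr \<sigma> * q ^ j"
          by (simp add: q_def powr_powr powr_power powr_add[symmetric] algebra_simps)
        finally show "(\<Sum>a\<in>?A. norm a powr (-s)) \<le> K * 2 powr \<sigma> * q ^ j" .
      qed
      also have "\<dots> = K * 2 powr \<sigma> * (\<Sum>j<N. q ^ j)" by (simp add: sum_distrib_left)
      also have "\<dots> \<le> K * 2 powr \<sigma> * (1 / (1 - q))"
      proof (rule mult_left_mono)
        show "(\<Sum>j<N. q ^ j) \<le> 1 / (1 - q)"
          using sum_le_suminf[of "\<lambda>j. q ^ j" "{..<N}"] q by (simp add: suminf_geometric summable_geometric)
      qed (use K in auto)
      finally show "x \<le> K * 2 powr \<sigma> * (1 / (1 - q))" .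
    qed
  qed auto
  moreover have "(\<lambda>a. norm a powr (-s)) summable_on (poles f \<inter> cball 0 1)"
    by (intro summable_on_finite finite_poles_Int_compact pm) simp
  ultimately have "(\<lambda>a. norm a powr (-s)) summable_on (P \<union> (poles f \<inter> cball 0 1))"
    by (intro summable_on_Un_disjoint) (auto simp: P_def)
  moreover have "P \<union> (poles f \<inter> cball 0 1) = poles f" by (auto simp: P_def)
  ultimately show ?thesis by simp
qed

section \<open>Inverse branches near the poles\<close>

locale pole_growth =
  fixes f :: "complex \<Rightarrow> complex" and Q :: "complex set" and D \<beta> C :: real and M :: nat
  assumes pm: "plane_meromorphic f"
    and Q: "Q \<subseteq> poles f" "finite (poles f - Q)" "\<And>a. a \<in> Q \<Longrightarrow> 1 \<le> norm a"
    and D_pos: "D > 0"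
    and D_disjoint: "\<And>a b. a \<in> poles f \<Longrightarrow> b \<in> poles f \<Longrightarrow> a \<noteq> b \<Longrightarrow> ball a D \<inter> ball b D = {}"
    and \<beta>: "\<beta> \<ge> 0" and C: "C \<ge> 1"
    and mult_le: "\<And>a. a \<in> Q \<Longrightarrow> pole_mult f a \<le> M"
    and growth: "\<And>a z. a \<in> Q \<Longrightarrow> z \<in> ball a D \<Longrightarrow> z \<noteq> a \<Longrightarrow>
      inverse C * (norm a powr (-\<beta>) / norm (z - a) ^ pole_mult f a) \<le> norm (f z) \<and>
      norm (f z) \<le> C * (norm a powr (-\<beta>) / norm (z - a) ^ pole_mult f a)"
    and deriv_nonzero: "\<And>a z. a \<in> Q \<Longrightarrow> z \<in> ball a D \<Longrightarrow> z \<noteq> a \<Longrightarrow> deriv f z \<noteq> 0"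
    and no_asymptotic: "\<not> infinity_asymptotic_value f"
begin

definition rad :: real where "rad = D / (16 * C\<^sup>2)"

abbreviation mult :: "complex \<Rightarrow> nat" where "mult a \<equiv> pole_mult f a"

lemma rad: "rad > 0" "rad \<le> D / 16"
proof -
  have C2: "C\<^sup>2 \<ge> 1" using C by (simp add: one_le_power)
  show "rad > 0" unfolding rad_def using D_pos C2 by (intro divide_pos_pos) auto
  have "D / (16 * C\<^sup>2) \<le> D / (16 * 1)" using D_pos C2 by (intro divide_left_mono) auto
  thus "rad \<le> D / 16" by (simp add: rad_def)
qed

lemma ball_rad_subset: "ball a rad \<subseteq> ball a D"
  using rad D_pos by (intro subset_ball) auto

lemma mult_ge_1: "a \<in> Q \<Longrightarrow> mult a \<ge> 1"
  using pole_mult_pos[OF pm] Q(1) by blast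

lemma no_other_pole: "a \<in> poles f \<Longrightarrow> z \<in> ball a D \<Longrightarrow> z \<noteq> a \<Longrightarrow> z \<notin> poles f"
proof
  assume "a \<in> poles f" "z \<in> ball a D" "z \<noteq> a" "z \<in> poles f"
  hence "z \<in> ball a D \<inter> ball z D" using D_pos by simp
  thus False using D_disjoint[of a z] \<open>a \<in> poles f\<close> \<open>z \<noteq> a\<close> \<open>z \<in> poles f\<close> by blast
qed

lemma norm_powr_le_1:
  assumes "a \<in> Q" "x \<le> 0"
  shows "norm a powr x \<le> 1"
proof -
  have "a \<noteq> 0" using Q(3)[OF assms(1)] by auto
  thus ?thesis using powr_mono[of x 0 "norm a"] Q(3)[OF assms(1)] assms(2) by simp
qed

lemma holomorphic_near_pole:
  assumes "a \<in> poles f"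
  shows "f holomorphic_on ball a D - {a}"
proof -
  have "f holomorphic_on UNIV - poles f" using pm by (simp add: plane_meromorphic_def)
  thus ?thesis by (rule holomorphic_on_subset) (use no_other_pole[OF assms] in auto)
qed

lemma powr_mult_bounds:
  assumes a: "a \<in> Q" and A: "A > 0" "1 / (C * norm a powr (-\<beta>)) \<le> A ^ mult a" "A ^ mult a \<le> C / norm a powr (-\<beta>)"
  shows "1 / A \<le> C * norm a powr (-\<beta> / real (mult a))" "A \<le> C * norm a powr (\<beta> / real (mult a))"
proof -
  let ?m = "mult a"
  have m: "?m \<ge> 1" using mult_ge_1[OF a] .
  have na: "norm a > 0" using Q(3)[OF a] by linarith
  \<comment> \<open>The constant is enlarged to \<open>C ^ ?m\<close> so that taking roots gives
    back \<open>C\<close>, free of the multiplicity.\<close>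
  have Cm: "C \<le> C ^ ?m" using C m by (intro self_le_power) auto
  have "1 / A ^ ?m \<le> C * norm a powr (-\<beta>)"
    using A na C by (simp add: field_simps)
  also have "\<dots> \<le> C ^ ?m * norm a powr (-\<beta>)" using Cm by (intro mult_right_mono) auto
  also have "\<dots> = (C * norm a powr (-\<beta> / real ?m)) ^ ?m"
    using m na by (simp add: power_mult_distrib powr_power)
  finally have "(1 / A) ^ ?m \<le> (C * norm a powr (-\<beta> / real ?m)) ^ ?m" by (simp add: power_divide)
  thus "1 / A \<le> C * norm a powr (-\<beta> / real ?m)"
    using m A C by (subst (asm) power_mono_iff) auto
  have "A ^ ?m \<le> C * norm a powr \<beta>" using A(3) na by (simp add: powr_minus_divide)
  also have "\<dots> \<le> C ^ ?m * norm a powr \<beta>" using Cm by (intro mult_right_mono) auto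
  also have "\<dots> = (C * norm a powr (\<beta> / real ?m)) ^ ?m"
    using m na by (simp add: power_mult_distrib powr_power)
  finally show "A \<le> C * norm a powr (\<beta> / real ?m)"
    using m A C by (subst (asm) power_mono_iff) auto
qed

lemma chart:
  assumes a: "a \<in> Q"
  obtains h A where "A > 0" "1 / A \<le> C * norm a powr (-\<beta> / real (mult a))"
    "A \<le> C * norm a powr (\<beta> / real (mult a))" "1 / C \<le> A ^ mult a" "h a = 0"
    "\<And>z. z \<in> ball a rad \<Longrightarrow> z \<noteq> a \<Longrightarrow> h z \<noteq> 0 \<and> f z = 1 / h z ^ mult a"
    "\<And>x y. x \<in> ball a rad \<Longrightarrow> y \<in> ball a rad \<Longrightarrow>
      norm (x - y) \<le> 2 / A * norm (h x - h y) \<and> norm (h x - h y) \<le> 3/2 * A * norm (x - y)"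
    "\<And>\<zeta>. norm \<zeta> < A * rad / 2 \<Longrightarrow> \<exists>z\<in>ball a rad. h z = \<zeta>"
proof -
  have ap: "a \<in> poles f" using a Q(1) by blast
  have na: "norm a \<ge> 1" using Q(3)[OF a] .
  have B: "norm a powr (-\<beta>) > 0" using na by (auto simp: powr_gt_zero)
  have B1: "norm a powr (-\<beta>) \<le> 1"
    using norm_powr_le_1[OF a] \<beta> by simp
  obtain h A where hA: "A > 0" "1 / (C * norm a powr (-\<beta>)) \<le> A ^ mult a" "A ^ mult a \<le> C / norm a powr (-\<beta>)" "h a = 0"
    "\<And>z. z \<in> ball a rad \<Longrightarrow> z \<noteq> a \<Longrightarrow> h z \<noteq> 0 \<and> f z = 1 / h z ^ mult a"
    "\<And>x y. x \<in> ball a rad \<Longrightarrow> y \<in> ball a rad \<Longrightarrow>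
      norm (x - y) \<le> 2 / A * norm (h x - h y) \<and> norm (h x - h y) \<le> 3/2 * A * norm (x - y)"
    "\<And>\<zeta>. norm \<zeta> < A * rad / 2 \<Longrightarrow> \<exists>z\<in>ball a rad. h z = \<zeta>"
    by (rule pole_chart[OF holomorphic_near_pole[OF ap] D_pos mult_ge_1[OF a] B C growth[OF a] rad_def]) (assumption | rule that)+
  have "1 / C \<le> 1 / (C * norm a powr (-\<beta>))" using B B1 C by (intro divide_left_mono) auto
  hence "1 / C \<le> A ^ mult a" using hA(2) by linarith
  thus thesis using that[of A h] hA powr_mult_bounds[OF a hA(1-3)] by blast
qed

lemma expansion_bound:
  assumes a: "a \<in> Q" and xy: "x \<in> ball a rad" "x \<noteq> a" "y \<in> ball a rad" "y \<noteq> a"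
    and lo: "lo > 0" "lo \<le> norm (f x)" "lo \<le> norm (f y)" and hi: "norm (f x) \<le> hi" "norm (f y) \<le> hi"
  shows "norm (f x - f y) \<le> hi\<^sup>2 * (real (mult a) * lo powr (1 / real (mult a) - 1) *
    (3/2 * C * norm a powr (\<beta> / real (mult a)) * norm (x - y)))"
proof -
  obtain h A where hA: "A \<le> C * norm a powr (\<beta> / real (mult a))"
    "\<And>z. z \<in> ball a rad \<Longrightarrow> z \<noteq> a \<Longrightarrow> h z \<noteq> 0 \<and> f z = 1 / h z ^ mult a"
    "\<And>x y. x \<in> ball a rad \<Longrightarrow> y \<in> ball a rad \<Longrightarrow> norm (h x - h y) \<le> 3/2 * A * norm (x - y)"
    using chart[OF a] by metis
  have "norm (h x - h y) \<le> 3/2 * A * norm (x - y)" by (rule hA(3)) (use xy in auto)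
  also have "\<dots> \<le> 3/2 * C * norm a powr (\<beta> / real (mult a)) * norm (x - y)"
    using hA(1) by (intro mult_right_mono) auto
  finally show ?thesis
    using chart_expansion[of "mult a" f x h y lo hi] mult_ge_1[OF a] hA(2)[OF xy(1,2)] hA(2)[OF xy(3,4)] lo hi
    by blast
qed

text \<open>Chosen so that \<open>norm w \<ge> Rbr\<close> and \<open>A ^ mult a \<ge> 1 / C\<close>
  imply \<open>2 / norm w \<le> (A * rad / 2) ^ mult a\<close>, the condition for branches on
  \<open>ball w (norm w / 2)\<close>. The maximum with 1 lets the exponent be raised from
  \<open>mult a\<close> to \<open>M\<close>, which makes the threshold the same for all poles of
  \<open>Q\<close>.\<close>

definition Rbr :: real where "Rbr = 2 * C * (max 1 (2 / rad)) ^ M"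

lemma Rbr: "Rbr \<ge> 2"
proof -
  have "1 \<le> (max 1 (2 / rad)) ^ M" by (rule one_le_power) simp
  hence "2 * 1 * 1 \<le> 2 * C * (max 1 (2 / rad)) ^ M" using C by (intro mult_mono) auto
  thus ?thesis by (simp add: Rbr_def)
qed

lemma branches:
  assumes a: "a \<in> Q" and w: "norm w \<ge> Rbr"
  obtains \<Phi> :: "(complex \<Rightarrow> complex) set" where "finite \<Phi>" "card \<Phi> \<le> mult a" "\<Phi> \<noteq> {}"
    "\<And>\<psi> u. \<psi> \<in> \<Phi> \<Longrightarrow> u \<in> ball w (norm w / 2) \<Longrightarrow> \<psi> u \<in> ball a rad \<and> \<psi> u \<noteq> a \<and> f (\<psi> u) = u"
    "\<And>\<psi> u u'. \<psi> \<in> \<Phi> \<Longrightarrow> u \<in> ball w (norm w / 2) \<Longrightarrow> u' \<in> ball w (norm w / 2) \<Longrightarrow>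
        norm (\<psi> u - \<psi> u') \<le> 8 * C * norm a powr (-\<beta> / real (mult a)) *
          norm w powr (- (1 + 1 / real (mult a))) * norm (u - u')"
    "\<And>z. z \<in> ball a rad \<Longrightarrow> z \<noteq> a \<Longrightarrow> f z \<in> ball w (norm w / 2) \<Longrightarrow> \<exists>\<psi>\<in>\<Phi>. \<psi> (f z) = z"
proof -
  let ?m = "mult a"
  have m: "?m \<ge> 1" using mult_ge_1[OF a] .
  have w2: "norm w \<ge> 2" using w Rbr by linarith
  hence wn: "w \<noteq> 0" by auto
  obtain h A where hA: "A > 0" "1 / A \<le> C * norm a powr (-\<beta> / real (mult a))" "1 / C \<le> A ^ mult a" "h a = 0"
    "\<And>z. z \<in> ball a rad \<Longrightarrow> z \<noteq> a \<Longrightarrow> h z \<noteq> 0 \<and> f z = 1 / h z ^ mult a"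
    "\<And>x y. x \<in> ball a rad \<Longrightarrow> y \<in> ball a rad \<Longrightarrow> norm (x - y) \<le> 2 / A * norm (h x - h y)"
    "\<And>\<zeta>. norm \<zeta> < A * rad / 2 \<Longrightarrow> \<exists>z\<in>ball a rad. h z = \<zeta>"
    by (rule chart[OF a]) blast
  have le: "2 / norm w \<le> (A * rad / 2) ^ ?m"
  proof -
    have "(2 / rad) ^ ?m \<le> (max 1 (2 / rad)) ^ ?m" using rad by (intro power_mono) auto
    also have "\<dots> \<le> (max 1 (2 / rad)) ^ M" using mult_le[OF a] by (intro power_increasing) auto
    finally have "2 * C * (2 / rad) ^ ?m \<le> Rbr" using C by (simp add: Rbr_def)
    hence "2 * C * (2 / rad) ^ ?m \<le> norm w" using w by linarith
    moreover have pos: "(2 / rad) ^ ?m > 0" using rad by simp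
    ultimately have "2 / norm w \<le> 2 / (2 * C * (2 / rad) ^ ?m)"
      using C w2 by (intro divide_left_mono mult_pos_pos) auto
    also have "\<dots> = 1 / C * (rad / 2) ^ ?m" using C rad by (simp add: power_divide field_simps)
    also have "\<dots> \<le> A ^ ?m * (rad / 2) ^ ?m" using hA(3) rad by (intro mult_right_mono) auto
    also have "\<dots> = (A * rad / 2) ^ ?m" by (simp add: power_mult_distrib power_divide)
    finally show ?thesis .
  qed
  obtain \<Phi> where \<Phi>: "finite \<Phi>" "card \<Phi> \<le> ?m" "\<Phi> \<noteq> {}"
    "\<And>\<psi> u. \<psi> \<in> \<Phi> \<Longrightarrow> u \<in> ball w (norm w / 2) \<Longrightarrow> \<psi> u \<in> ball a rad \<and> \<psi> u \<noteq> a \<and> f (\<psi> u) = u"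
    "\<And>\<psi> u u'. \<psi> \<in> \<Phi> \<Longrightarrow> u \<in> ball w (norm w / 2) \<Longrightarrow> u' \<in> ball w (norm w / 2) \<Longrightarrow>
        norm (\<psi> u - \<psi> u') \<le> 2 / A * (2 / norm w) powr (1 + 1 / real ?m) * norm (u - u')"
    "\<And>z. z \<in> ball a rad \<Longrightarrow> z \<noteq> a \<Longrightarrow> f z \<in> ball w (norm w / 2) \<Longrightarrow> \<exists>\<psi>\<in>\<Phi>. \<psi> (f z) = z"
    by (rule chart_branches[OF m hA(1,4,5,6,7) wn le rad(1)]) (assumption | rule that)+
  \<comment> \<open>The 8 is the factor 2 from the inverse of the chart times 4, a bound for
    \<open>2 powr (1 + 1 / real ?m)\<close>.\<close>
  have const: "2 / A * (2 / norm w) powr (1 + 1 / real ?m) \<le>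
      8 * C * norm a powr (-\<beta> / real ?m) * norm w powr (- (1 + 1 / real ?m))"
  proof -
    have "2 / A \<le> 2 * (C * norm a powr (-\<beta> / real ?m))" using hA(2) by simp
    moreover have "(2 / norm w) powr (1 + 1 / real ?m) \<le> 4 * norm w powr (- (1 + 1 / real ?m))"
    proof -
      have "(2::real) powr (1 + 1 / real ?m) \<le> 2 powr 2" using m by (intro powr_mono) auto
      moreover have "(2 / norm w) powr (1 + 1 / real ?m) = 2 powr (1 + 1 / real ?m) * norm w powr (- (1 + 1 / real ?m))"
        unfolding powr_divide powr_minus_divide by simp
      ultimately show ?thesis by (simp add: mult_right_mono)
    qed
    ultimately have "2 / A * (2 / norm w) powr (1 + 1 / real ?m) \<le>
       2 * (C * norm a powr (-\<beta> / real ?m)) * (4 * norm w powr (- (1 + 1 / real ?m)))"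
      using hA(1) C by (intro mult_mono) auto
    thus ?thesis by (simp add: mult_ac)
  qed
  show thesis
  proof (rule that[of \<Phi>])
    show "finite \<Phi>" "card \<Phi> \<le> ?m" "\<Phi> \<noteq> {}" by (fact \<Phi>)+
    show "\<psi> u \<in> ball a rad \<and> \<psi> u \<noteq> a \<and> f (\<psi> u) = u"
      if "\<psi> \<in> \<Phi>" "u \<in> ball w (norm w / 2)" for \<psi> u by (rule \<Phi>(4)[OF that])
    show "\<exists>\<psi>\<in>\<Phi>. \<psi> (f z) = z" if "z \<in> ball a rad" "z \<noteq> a" "f z \<in> ball w (norm w / 2)" for z
      by (rule \<Phi>(6)[OF that])
    fix \<psi> u u' assume *: "\<psi> \<in> \<Phi>" "u \<in> ball w (norm w / 2)" "u' \<in> ball w (norm w / 2)"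
    have "norm (\<psi> u - \<psi> u') \<le> 2 / A * (2 / norm w) powr (1 + 1 / real ?m) * norm (u - u')"
      by (rule \<Phi>(5)[OF *])
    also have "\<dots> \<le> 8 * C * norm a powr (-\<beta> / real ?m) * norm w powr (- (1 + 1 / real ?m)) * norm (u - u')"
      by (rule mult_right_mono[OF const]) simp
    finally show "norm (\<psi> u - \<psi> u') \<le> 8 * C * norm a powr (-\<beta> / real ?m) * norm w powr (- (1 + 1 / real ?m)) * norm (u - u')" .
  qed
qed

definition is_branch :: "complex \<Rightarrow> complex \<Rightarrow> (complex \<Rightarrow> complex) \<Rightarrow> bool" where
  "is_branch a w \<psi> \<longleftrightarrow>
     (\<forall>u\<in>ball w (norm w / 2). \<psi> u \<in> ball a rad \<and> \<psi> u \<noteq> a \<and> f (\<psi> u) = u) \<and>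
     (\<forall>u\<in>ball w (norm w / 2). \<forall>u'\<in>ball w (norm w / 2).
        norm (\<psi> u - \<psi> u') \<le> 8 * C * norm a powr (-\<beta> / real (mult a)) *
          norm w powr (- (1 + 1 / real (mult a))) * norm (u - u'))"

lemma branch_exists:
  assumes "a \<in> Q" "norm w \<ge> Rbr"
  shows "\<exists>\<psi>. is_branch a w \<psi>"
proof (rule branches[OF assms], goal_cases)
  case (1 \<Phi>)
  then obtain \<psi> where "\<psi> \<in> \<Phi>" by blast
  hence "is_branch a w \<psi>" unfolding is_branch_def using 1(4,5) by blast
  thus ?case by blast
qed

lemma branch_through:
  assumes "a \<in> Q" "norm (f z) \<ge> Rbr" "z \<in> ball a rad" "z \<noteq> a"
  shows "\<exists>\<psi>. is_branch a (f z) \<psi> \<and> \<psi> (f z) = z"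
proof (rule branches[OF assms(1,2)], goal_cases)
  case (1 \<Phi>)
  have "0 < norm (f z)" using Rbr assms(2) by linarith
  hence "f z \<in> ball (f z) (norm (f z) / 2)" by simp
  then obtain \<psi> where "\<psi> \<in> \<Phi>" "\<psi> (f z) = z" using 1(6)[OF assms(3,4)] by blast
  moreover from this have "is_branch a (f z) \<psi>" unfolding is_branch_def using 1(4,5) by blast
  ultimately show ?case by blast
qed

text \<open>The derivative has a pole at \<open>a\<close> too, so it does not vanish nearby, and
  \<open>f\<close> is bounded on a small circle by compactness. Radius and bound may depend on
  \<open>a\<close>, which is harmless for the finitely many poles outside \<open>Q\<close>.\<close>

lemma exceptional_pole_radius:
  assumes "a \<in> poles f"
  obtains r K where "0 < r" "r \<le> 1" "r < D" "\<And>z. z \<in> ball a r \<Longrightarrow> z \<noteq> a \<Longrightarrow> deriv f z \<noteq> 0"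
    "\<And>z. z \<in> sphere a r \<Longrightarrow> norm (f z) \<le> K"
proof -
  have iso: "isolated_singularity_at f a"
    using pm by (meson UNIV_I meromorphic_on_isolated_singularity plane_meromorphic_def meromorphic_on_altdef)
  have "is_pole f a" using assms by (simp add: poles_def)
  hence "is_pole (deriv f) a" using iso is_pole_deriv_iff[of f a] pm
    by (meson is_pole_deriv)
  hence "filterlim (deriv f) at_infinity (at a)" by (simp add: is_pole_def)
  hence "\<forall>\<^sub>F z in at a. deriv f z \<noteq> 0" by (rule filterlim_at_infinity_imp_eventually_ne)
  then obtain e where e: "e > 0" "\<And>z. z \<noteq> a \<Longrightarrow> dist z a < e \<Longrightarrow> deriv f z \<noteq> 0"
    by (auto simp: eventually_at)
  define r where "r = min (min 1 e) (D / 2)"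
  have r: "0 < r" "r \<le> 1" "r < D" "r \<le> e" using e D_pos by (auto simp: r_def)
  have "compact (f ` sphere a r)"
  proof (intro compact_continuous_image plane_meromorphic_continuous_on pm)
    show "sphere a r \<inter> poles f = {}" using no_other_pole[OF assms] r by auto
  qed simp
  then obtain K where "\<And>z. z \<in> sphere a r \<Longrightarrow> norm (f z) \<le> K"
    by (force dest!: compact_imp_bounded simp: bounded_iff)
  thus thesis using that[of r K] r e by (auto simp: dist_commute)
qed

text \<open>The circles of radius \<open>rad\<close> around \<open>Q\<close> share one bound by the
  growth condition; the bounds on the finitely many other circles are summed, so the localization of
  large values applies. The exceptional disks form a bounded set, which orbits outside a large disk
  never enter. The nonvanishing derivative is recorded for the pullback by the first map.\<close>

lemma large_values:
  obtains R0 where "R0 > 0"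
    "\<And>z. z \<notin> poles f \<Longrightarrow> norm (f z) > R0 \<Longrightarrow> deriv f z \<noteq> 0 \<and>
       ((\<exists>a\<in>Q. z \<in> ball a rad) \<or> (\<exists>a\<in>poles f - Q. z \<in> ball a 1))"
proof -
  have "\<exists>r K. 0 < r \<and> r \<le> 1 \<and> r < D \<and> (\<forall>z\<in>ball a r. z \<noteq> a \<longrightarrow> deriv f z \<noteq> 0) \<and>
    (\<forall>z\<in>sphere a r. norm (f z) \<le> K)" if "a \<in> poles f" for a
    using exceptional_pole_radius[OF that] by metis
  then obtain r K where rK: "\<And>a. a \<in> poles f \<Longrightarrow> 0 < r a \<and> r a \<le> 1 \<and> r a < D \<and>
      (\<forall>z\<in>ball a (r a). z \<noteq> a \<longrightarrow> deriv f z \<noteq> 0) \<and> (\<forall>z\<in>sphere a (r a). norm (f z) \<le> K a)"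
    by metis
  define ra where "ra a = (if a \<in> Q then rad else r a)" for a
  define R where "R = C * (max 1 (1 / rad)) ^ M + (\<Sum>a\<in>poles f - Q. \<bar>K a\<bar>)"
  have S0: "(\<Sum>a\<in>poles f - Q. \<bar>K a\<bar>) \<ge> 0" by (simp add: sum_nonneg)
  have P0: "C * (max 1 (1 / rad)) ^ M \<ge> 0" using C by simp
  have radD: "rad < D" using rad D_pos by linarith
  have rad1: "ra a > 0" if "a \<in> poles f" for a using rK[OF that] rad by (simp add: ra_def)
  have rad2: "z \<notin> poles f \<and> norm (f z) \<le> R" if a: "a \<in> poles f" and z: "z \<in> sphere a (ra a)" for a z
  proof (cases "a \<in> Q")
    case True
    hence za: "norm (z - a) = rad" using z by (simp add: ra_def dist_norm norm_minus_commute)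
    hence zb: "z \<in> ball a D" "z \<noteq> a" using radD rad by (auto simp: dist_norm norm_minus_commute)
    have "norm (f z) \<le> C * (norm a powr (-\<beta>) / rad ^ mult a)" using growth[OF True zb] za by simp
    also have "\<dots> \<le> C * (max 1 (1 / rad)) ^ M"
    proof (rule mult_left_mono)
      have "norm a powr (-\<beta>) \<le> 1" using norm_powr_le_1[OF True] \<beta> by simp
      hence "norm a powr (-\<beta>) / rad ^ mult a \<le> 1 / rad ^ mult a" using rad by (intro divide_right_mono) auto
      also have "\<dots> = (1 / rad) ^ mult a" by (simp add: power_divide)
      also have "\<dots> \<le> (max 1 (1 / rad)) ^ mult a" using rad by (intro power_mono) auto
      also have "\<dots> \<le> (max 1 (1 / rad)) ^ M" using mult_le[OF True] by (intro power_increasing) auto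
      finally show "norm a powr (-\<beta>) / rad ^ mult a \<le> (max 1 (1 / rad)) ^ M" .
    qed (use C in auto)
    finally have "norm (f z) \<le> R" unfolding R_def using S0 by linarith
    thus ?thesis using no_other_pole[OF a zb] by simp
  next
    case False
    hence z': "z \<in> sphere a (r a)" using z by (simp add: ra_def)
    have "norm (f z) \<le> K a" using rK[OF a] z' by blast
    also have "\<dots> \<le> \<bar>K a\<bar>" by simp
    also have "\<dots> \<le> (\<Sum>a\<in>poles f - Q. \<bar>K a\<bar>)"
      by (rule member_le_sum) (use False a Q(2) in auto)
    finally have "norm (f z) \<le> R" unfolding R_def using P0 by linarith
    moreover have "z \<notin> poles f" by (rule no_other_pole[OF a]) (use z' rK[OF a] in auto)
    ultimately show ?thesis by simp
  qed
  obtain R1 where R1: "R1 > 0" "\<And>z. z \<notin> poles f \<Longrightarrow> norm (f z) > R1 \<Longrightarrow> \<exists>a\<in>poles f. z \<in> ball a (ra a)"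
    using large_values_near_poles[OF pm no_asymptotic, of ra R] rad1 rad2 by metis
  show thesis
  proof (rule that[OF R1(1)])
    fix z assume z: "z \<notin> poles f" "norm (f z) > R1"
    then obtain a where a: "a \<in> poles f" "z \<in> ball a (ra a)" using R1(2) by blast
    have za: "z \<noteq> a" using z a by auto
    show "deriv f z \<noteq> 0 \<and> ((\<exists>a\<in>Q. z \<in> ball a rad) \<or> (\<exists>a\<in>poles f - Q. z \<in> ball a 1))"
    proof (cases "a \<in> Q")
      case True
      hence zr: "z \<in> ball a rad" using a by (simp add: ra_def)
      have "deriv f z \<noteq> 0" by (rule deriv_nonzero[OF True _ za]) (use zr ball_rad_subset in blast)
      thus ?thesis using True zr by blast
    next
      case False
      hence zr: "z \<in> ball a (r a)" using a by (simp add: ra_def)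
      have "z \<in> ball a 1" using zr rK[OF a(1)] by auto
      thus ?thesis using False zr rK[OF a(1)] za a(1) by blast
    qed
  qed
qed

end

section \<open>The upper bound\<close>

text \<open>The recursion in the definition splits off the map applied last, while induction along
  itineraries splits off the map applied first; what remains is an orbit for the shifted
  sequence.\<close>

lemma nonaut_iter_shift:
  "nonaut_iter f c (Suc n) z = nonaut_iter f (\<lambda>i. c (Suc i)) n (f z + c 1)"
  by (induction n) auto

lemma ennreal_eq_0_if_le_half_powers:
  assumes "\<And>n. x \<le> ennreal (k * (1/2) ^ n)"
  shows "x = 0"
proof -
  have "(\<lambda>n. k * (1/2) ^ n) \<longlonglongrightarrow> k * 0"
    by (intro tendsto_mult_left LIMSEQ_realpow_zero) auto
  hence "(\<lambda>n. ennreal (k * (1/2) ^ n)) \<longlonglongrightarrow> ennreal 0" by (intro tendsto_ennrealI) simp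
  hence "x \<le> ennreal 0" by (rule LIMSEQ_le_const) (use assms in auto)
  thus ?thesis by simp
qed

lemma summable_on_tail_small:
  fixes g :: "'a \<Rightarrow> real"
  assumes g: "g summable_on A" "\<And>x. x \<in> A \<Longrightarrow> g x \<ge> 0" and e: "e > 0"
  obtains F where "finite F" "F \<subseteq> A" "\<And>B. B \<subseteq> A - F \<Longrightarrow> infsum g B \<le> e"
proof -
  obtain F where F: "finite F" "F \<subseteq> A" "dist (sum g F) (infsum g A) \<le> e"
    using has_sum_finite_approximation[OF has_sum_infsum[OF g(1)] e] by blast
  show thesis
  proof (rule that[OF F(1,2)])
    fix B assume B: "B \<subseteq> A - F"
    have "infsum g B \<le> infsum g (A - F)"
      by (rule infsum_mono_neutral) (use B g summable_on_subset_banach[OF g(1)] in auto)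
    also have "\<dots> = infsum g A - infsum g F"
      by (rule infsum_Diff) (use g F in auto)
    also have "\<dots> \<le> e" using F by (simp add: dist_real_def)
    finally show "infsum g B \<le> e" .
  qed
qed

context pole_growth
begin

text \<open>Unlike in \<open>escaping_R\<close>, the size condition includes time 0, so the first
  map sends this set into the set of the same kind for the shifted sequence.\<close>

definition trapped :: "(nat \<Rightarrow> complex) \<Rightarrow> real \<Rightarrow> complex set" where
  "trapped c R = {z. \<forall>n. nonaut_iter f c n z \<notin> poles f \<and> norm (nonaut_iter f c n z) > R}"

lemma trapped_step:
  assumes "z \<in> trapped c R"
  shows "z \<notin> poles f" "norm z > R" "f z + c 1 \<in> trapped (\<lambda>i. c (Suc i)) R"
proof -
  have *: "nonaut_iter f c n z \<notin> poles f \<and> norm (nonaut_iter f c n z) > R" for n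
    using assms by (simp add: trapped_def)
  show "z \<notin> poles f" "norm z > R" using *[of 0] by auto
  show "f z + c 1 \<in> trapped (\<lambda>i. c (Suc i)) R"
    unfolding trapped_def using *[of "Suc _"] unfolding nonaut_iter_shift by blast
qed

text \<open>Near a pole \<open>a\<close> the trapped set is covered by pullbacks of trapped sets
  near the admissible poles \<open>b\<close>. Raised to the power \<open>t\<close>, the Lipschitz
  constant of a branch is, up to a constant, \<open>bexp a\<close> times a power of
  \<open>norm b\<close>, and the estimate at \<open>b\<close> brings in \<open>bexp b\<close>; by
  the hypothesis on \<open>s\<close> the product is at most
  \<open>bexp a * norm b powr (-s)\<close>. The weight \<open>bexp a\<close> thus reproduces itself,
  and for large \<open>R\<close> the sum over \<open>b\<close> gains a factor 1/2 at each step. The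
  induction runs over all \<open>a\<close> and \<open>c\<close> at once, because each step changes
  both.\<close>

lemma trapped_null:
  assumes t: "t > 0" and s: "\<And>a b. a \<in> Q \<Longrightarrow> b \<in> Q \<Longrightarrow> s \<le> t * (1 + 1 / real (mult a) + \<beta> / real (mult b))"
    and sm: "(\<lambda>a. norm a powr (-s)) summable_on Q"
  obtains R1 where "\<And>R c. R \<ge> R1 \<Longrightarrow> \<forall>n. norm (c n) < 1 \<Longrightarrow> hausdorff_content t (trapped c R) = 0"
    "\<And>z. z \<notin> poles f \<Longrightarrow> norm (f z) > R1 - 1 \<Longrightarrow> deriv f z \<noteq> 0"
proof -
  obtain R0 where R0: "R0 > 0"
    "\<And>z. z \<notin> poles f \<Longrightarrow> norm (f z) > R0 \<Longrightarrow> deriv f z \<noteq> 0 \<and>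
       ((\<exists>a\<in>Q. z \<in> ball a rad) \<or> (\<exists>a\<in>poles f - Q. z \<in> ball a 1))"
    using large_values by blast
  \<comment> \<open>\<open>K\<close> collects what does not depend on the poles: at most
    \<open>M\<close> branches, each with the factor \<open>8 * C\<close> in its Lipschitz
    constant.\<close>
  define K where "K = real M * (8 * C) powr t"
  have K: "K \<ge> 0" by (simp add: K_def)
  obtain F where F: "finite F" "F \<subseteq> Q" "\<And>B. B \<subseteq> Q - F \<Longrightarrow> infsum (\<lambda>a. norm a powr (-s)) B \<le> 1 / (2 * K + 2)"
    by (rule summable_on_tail_small[OF sm, of "1 / (2 * K + 2)"]) (use K in auto)
  \<comment> \<open>Beyond this radius orbits stay away from the finite set \<open>F\<close> and
    from the exceptional poles, and branches exist on disks with room for the disks at the poles and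
    for the perturbation.\<close>
  define R1 where "R1 = R0 + Rbr + 3 * rad + 4 + (\<Sum>a\<in>F \<union> (poles f - Q). norm a)"
  have finU: "finite (F \<union> (poles f - Q))" using F(1) Q(2) by simp
  have sum0: "(\<Sum>a\<in>F \<union> (poles f - Q). norm a) \<ge> 0" by (simp add: sum_nonneg)
  have normF: "norm a + R0 + Rbr + 3 * rad + 4 \<le> R1" if "a \<in> F \<union> (poles f - Q)" for a
    using member_le_sum[OF that _ finU, of norm] by (simp add: R1_def)
  have R1: "R1 - 1 \<ge> R0" "R1 \<ge> Rbr + rad" "R1 \<ge> 3 * rad + 4" "R1 \<ge> 2"
    using sum0 R0(1) Rbr rad by (auto simp: R1_def)
  define bexp where "bexp a = norm a powr (- t * \<beta> / real (mult a))" for a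
  define E where "E = (2 * C) powr t"
  have null: "hausdorff_content t (trapped c R) = 0" if R: "R \<ge> R1" and c: "\<And>n. norm (c n) < 1" for R and c :: "nat \<Rightarrow> complex"
  proof -
    define Q' where "Q' = {a\<in>Q. norm a > R - rad}"
    have near: "\<exists>a\<in>Q'. z \<in> ball a rad" if z: "z \<in> trapped c R" and c: "\<And>n. norm (c n) < 1" for z and c :: "nat \<Rightarrow> complex"
    proof -
      note zz = trapped_step[OF z]
      have "norm (f z + c 1) > R" by (rule trapped_step(2)[OF zz(3)])
      hence "norm (f z) > R - 1" using norm_triangle_ineq[of "f z" "c 1"] c[of 1] by linarith
      hence "norm (f z) > R0" using R R1 by linarith
      hence "(\<exists>a\<in>Q. z \<in> ball a rad) \<or> (\<exists>a\<in>poles f - Q. z \<in> ball a 1)" using R0(2)[OF zz(1)] by blast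
      thus ?thesis
      proof (elim disjE bexE)
        fix a assume a: "a \<in> poles f - Q" "z \<in> ball a 1"
        have "norm z \<le> norm a + 1" using a(2) norm_triangle_ineq2[of z a] by (simp add: dist_norm norm_minus_commute)
        also have "\<dots> \<le> R" using normF[of a] a(1) R R0(1) Rbr rad by simp
        finally show ?thesis using zz(2) by simp
      next
        fix a assume a: "a \<in> Q" "z \<in> ball a rad"
        have "norm z \<le> norm a + rad" using a(2) norm_triangle_ineq2[of z a] by (simp add: dist_norm norm_minus_commute)
        hence "a \<in> Q'" using a zz(2) by (simp add: Q'_def)
        thus ?thesis using a by blast
      qed
    qed
    have Q'sub: "Q' \<subseteq> Q - F"
    proof
      fix a assume "a \<in> Q'"
      moreover have "a \<notin> F" using normF[of a] R R0(1) Rbr rad \<open>a \<in> Q'\<close> by (auto simp: Q'_def)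
      ultimately show "a \<in> Q - F" by (simp add: Q'_def)
    qed
    have sm': "(\<lambda>a. norm a powr (-s)) summable_on Q'"
      by (rule summable_on_subset_banach[OF sm]) (use Q'sub in auto)
    have tail: "K * infsum (\<lambda>a. norm a powr (-s)) Q' \<le> 1/2"
    proof -
      have "K * infsum (\<lambda>a. norm a powr (-s)) Q' \<le> K * (1 / (2 * K + 2))"
        using F(3)[OF Q'sub] K by (intro mult_left_mono)
      also have "\<dots> \<le> 1/2" using K by (simp add: field_simps)
      finally show ?thesis .
    qed
    have cQ': "countable Q'" by (rule countable_subset[OF _ countable_poles[OF pm]]) (use Q(1) in \<open>auto simp: Q'_def\<close>)
    have claim: "hausdorff_content t (trapped c R \<inter> ball a rad) \<le> ennreal (E * bexp a * (1/2) ^ n)"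
      if "a \<in> Q'" "\<And>n. norm (c n) < 1" for a n and c :: "nat \<Rightarrow> complex"
      using that
    proof (induction n arbitrary: a c)
      case (0 a c)
      have a: "a \<in> Q" using 0 by (simp add: Q'_def)
      have m: "mult a \<ge> 1" by (rule mult_ge_1[OF a])
      have na: "norm a > 0" using Q(3)[OF a] by linarith
      let ?\<rho> = "C * norm a powr (- \<beta> / real (mult a))"
      \<comment> \<open>On the trapped set |f z| is at least 1, which the growth condition turns
        into a bound on the distance to \<open>a\<close>. This yields the weight
        \<open>bexp a\<close> at the start; the radius \<open>rad\<close> alone would not.\<close>
      have sub: "trapped c R \<inter> ball a rad \<subseteq> cball a ?\<rho>"
      proof
        fix z assume z: "z \<in> trapped c R \<inter> ball a rad"
        hence zt: "z \<in> trapped c R" and zb: "z \<in> ball a D" using ball_rad_subset by blast+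
        note zz = trapped_step[OF zt]
        have za: "z \<noteq> a" using zz(1) a Q(1) by auto
        have "norm (f z + c 1) > R" by (rule trapped_step(2)[OF zz(3)])
        hence f1: "norm (f z) \<ge> 1" using norm_triangle_ineq[of "f z" "c 1"] 0(2)[of 1] R R1 by linarith
        have "norm (f z) \<le> C * (norm a powr (-\<beta>) / norm (z - a) ^ mult a)" using growth[OF a zb za] by blast
        hence "1 \<le> C * norm a powr (-\<beta>) / norm (z - a) ^ mult a" using f1 by simp
        hence "norm (z - a) ^ mult a \<le> C * norm a powr (-\<beta>)" using za by (simp add: field_simps)
        also have "\<dots> \<le> C ^ mult a * norm a powr (-\<beta>)"
          using self_le_power[of C "mult a"] C m by (intro mult_right_mono) auto
        also have "\<dots> = ?\<rho> ^ mult a" using m na by (simp add: power_mult_distrib powr_power)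
        finally have "norm (z - a) \<le> ?\<rho>" using m C by (subst (asm) power_mono_iff) auto
        thus "z \<in> cball a ?\<rho>" by (simp add: dist_norm norm_minus_commute)
      qed
      have "hausdorff_content t (trapped c R \<inter> ball a rad) \<le> hausdorff_content t (cball a ?\<rho>)"
        by (rule hausdorff_content_mono[OF sub])
      also have "\<dots> \<le> ennreal (diameter (cball a ?\<rho>) powr t)" by (rule hausdorff_content_le_diameter) simp
      also have "diameter (cball a ?\<rho>) = 2 * ?\<rho>"
      proof -
        have "?\<rho> \<ge> 0" using C by (intro mult_nonneg_nonneg) auto
        thus ?thesis by (simp only: diameter_cball if_not_P not_less)
      qed
      also have "(2 * ?\<rho>) powr t = E * bexp a"
        using C by (simp add: powr_mult powr_powr E_def bexp_def mult_ac)
      finally show ?case by simp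
    next
      case (Suc n a c)
      have a: "a \<in> Q" using Suc by (simp add: Q'_def)
      let ?c = "\<lambda>i. c (Suc i)"
      let ?L = "\<lambda>b. 8 * C * norm a powr (-\<beta> / real (mult a)) * norm b powr (- (1 + 1 / real (mult a)))"
      have big: "norm b \<ge> Rbr" "rad + 1 \<le> norm b / 2" if "b \<in> Q'" for b
        using that R R1 rad by (auto simp: Q'_def)
      define good where "good b \<Phi> \<longleftrightarrow> finite \<Phi> \<and> card \<Phi> \<le> mult a \<and>
        (\<forall>\<psi>\<in>\<Phi>. \<forall>u\<in>ball b (norm b / 2). \<forall>u'\<in>ball b (norm b / 2). norm (\<psi> u - \<psi> u') \<le> ?L b * norm (u - u')) \<and>
        (\<forall>z\<in>ball a rad. z \<noteq> a \<longrightarrow> f z \<in> ball b (norm b / 2) \<longrightarrow> (\<exists>\<psi>\<in>\<Phi>. \<psi> (f z) = z))"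
        for b and \<Phi> :: "(complex \<Rightarrow> complex) set"
      have "\<forall>b\<in>Q'. \<exists>\<Phi>. good b \<Phi>"
      proof
        fix b assume "b \<in> Q'"
        show "\<exists>\<Phi>. good b \<Phi>"
          by (rule branches[OF a big(1)[OF \<open>b \<in> Q'\<close>]], rule exI, unfold good_def) blast
      qed
      then obtain \<Phi> where good: "\<forall>b\<in>Q'. good b (\<Phi> b)" by (rule bchoice[THEN exE])
      have \<Phi>: "finite (\<Phi> b)" "card (\<Phi> b) \<le> mult a"
        "\<And>\<psi> u u'. \<psi> \<in> \<Phi> b \<Longrightarrow> u \<in> ball b (norm b / 2) \<Longrightarrow> u' \<in> ball b (norm b / 2) \<Longrightarrow> norm (\<psi> u - \<psi> u') \<le> ?L b * norm (u - u')"
        "\<And>z. z \<in> ball a rad \<Longrightarrow> z \<noteq> a \<Longrightarrow> f z \<in> ball b (norm b / 2) \<Longrightarrow> \<exists>\<psi>\<in>\<Phi> b. \<psi> (f z) = z"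
        if "b \<in> Q'" for b
        using bspec[OF good that] unfolding good_def by blast+
      let ?X = "\<lambda>b. trapped ?c R \<inter> ball b rad"
      \<comment> \<open>The branches live on a disk of radius at least \<open>rad + 1\<close>:
        \<open>rad\<close> for the disk around \<open>b\<close>, 1 for the translation by
        \<open>c 1\<close>.\<close>
      have inb: "y - c 1 \<in> ball b (norm b / 2)" if "b \<in> Q'" "y \<in> ball b rad" for b y
      proof -
        have "norm (b - (y - c 1)) \<le> norm (b - y) + norm (c 1)"
          using norm_triangle_ineq[of "b - y" "c 1"] by (simp add: algebra_simps)
        also have "\<dots> < rad + 1" using that(2) Suc(3)[of 1] by (simp add: dist_norm)
        also have "\<dots> \<le> norm b / 2" by (rule big(2)[OF that(1)])
        finally show ?thesis by (simp add: dist_norm)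
      qed
      have cov: "trapped c R \<inter> ball a rad \<subseteq> (\<Union>b\<in>Q'. \<Union>\<psi>\<in>\<Phi> b. (\<lambda>y. \<psi> (y - c 1)) ` ?X b)"
      proof
        fix z assume z: "z \<in> trapped c R \<inter> ball a rad"
        hence zt: "z \<in> trapped c R" and zb: "z \<in> ball a rad" by auto
        note zz = trapped_step[OF zt]
        have za: "z \<noteq> a" using zz(1) a Q(1) by auto
        obtain b where b: "b \<in> Q'" "f z + c 1 \<in> ball b rad" using near[OF zz(3)] Suc(3) by blast
        have "f z \<in> ball b (norm b / 2)" using inb[OF b] by simp
        then obtain \<psi> where \<psi>: "\<psi> \<in> \<Phi> b" "\<psi> (f z) = z" using \<Phi>(4)[OF b(1) zb za] by blast
        have "z \<in> (\<lambda>y. \<psi> (y - c 1)) ` ?X b"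
          by (rule image_eqI[of _ _ "f z + c 1"]) (use \<psi> zz(3) b in auto)
        thus "z \<in> (\<Union>b\<in>Q'. \<Union>\<psi>\<in>\<Phi> b. (\<lambda>y. \<psi> (y - c 1)) ` ?X b)" using \<psi>(1) b(1) by blast
      qed
      define G where "G = K * E * bexp a * (1/2) ^ n"
      have pos: "E \<ge> 0" "bexp b \<ge> 0" for b by (auto simp: E_def bexp_def)
      have piece: "hausdorff_content t (\<Union>\<psi>\<in>\<Phi> b. (\<lambda>y. \<psi> (y - c 1)) ` ?X b) \<le> ennreal (G * norm b powr (-s))"
        if b: "b \<in> Q'" for b
      proof -
        let ?v = "?L b powr t * (E * bexp b * (1/2) ^ n)"
        have bQ: "b \<in> Q" using b by (simp add: Q'_def)
        have v0: "?v \<ge> 0" using pos by simp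
        have L0: "?L b \<ge> 0" using C by simp
        have "hausdorff_content t (\<Union>\<psi>\<in>\<Phi> b. (\<lambda>y. \<psi> (y - c 1)) ` ?X b) \<le> ennreal (infsum (\<lambda>_. ?v) (\<Phi> b))"
        proof (rule hausdorff_content_UN_infsum)
          show "countable (\<Phi> b)" "(\<lambda>_. ?v) summable_on \<Phi> b"
            using \<Phi>(1)[OF b] by (auto simp: countable_finite summable_on_finite)
          fix \<psi> assume \<psi>: "\<psi> \<in> \<Phi> b"
          have "hausdorff_content t ((\<lambda>y. \<psi> (y - c 1)) ` ?X b) \<le> ennreal ?v"
          proof (rule hausdorff_content_lipschitz_image[OF L0 _ t])
            show "hausdorff_content t (?X b) \<le> ennreal (E * bexp b * (1/2) ^ n)"
              using Suc.IH[OF b, of ?c] Suc.prems(2) by blast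
            fix x y assume xy: "x \<in> ?X b" "y \<in> ?X b"
            show "norm (\<psi> (x - c 1) - \<psi> (y - c 1)) \<le> ?L b * norm (x - y)"
              using \<Phi>(3)[OF b \<psi> inb[OF b, of x] inb[OF b, of y]] xy by simp
          qed (use pos in auto)
          thus "0 \<le> ?v \<and> hausdorff_content t ((\<lambda>y. \<psi> (y - c 1)) ` ?X b) \<le> ennreal ?v" using v0 by blast
        qed
        also have "infsum (\<lambda>_. ?v) (\<Phi> b) = real (card (\<Phi> b)) * ?v" using \<Phi>(1)[OF b] by simp
        also have "ennreal (real (card (\<Phi> b)) * ?v) \<le> ennreal (real M * ?v)"
          using \<Phi>(2)[OF b] mult_le[OF a] v0 by (intro ennreal_leI mult_right_mono) auto
        also have "real M * ?v \<le> G * norm b powr (-s)"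
        proof -
          have nb: "norm b \<ge> 1" by (rule Q(3)[OF bQ])
          have "?L b powr t = (8 * C) powr t * bexp a * norm b powr (- t * (1 + 1 / real (mult a)))"
          proof -
            have e1: "(norm a powr (-\<beta> / real (mult a))) powr t = bexp a"
              unfolding bexp_def powr_powr by (simp add: mult.commute)
            have e2: "(norm b powr (- (1 + 1 / real (mult a)))) powr t = norm b powr (- t * (1 + 1 / real (mult a)))"
              unfolding powr_powr by (rule arg_cong[of _ _ "(powr) (norm b)"]) (simp add: algebra_simps)
            show ?thesis unfolding e1[symmetric] e2[symmetric] by (simp only: powr_mult)
          qed
          hence "real M * ?v = G * (norm b powr (- t * (1 + 1 / real (mult a))) * bexp b)"
            by (simp add: G_def K_def mult_ac)
          \<comment> \<open>The two exponents at \<open>b\<close> meet here; the one from the branch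
            involves the multiplicity of \<open>a\<close>, the one from the weight that of
            \<open>b\<close>.\<close>
          also have "norm b powr (- t * (1 + 1 / real (mult a))) * bexp b =
              norm b powr (- (t * (1 + 1 / real (mult a) + \<beta> / real (mult b))))"
            by (simp add: bexp_def powr_add[symmetric] algebra_simps)
          also have "G * \<dots> \<le> G * norm b powr (-s)"
          proof (rule mult_left_mono)
            show "norm b powr (- (t * (1 + 1 / real (mult a) + \<beta> / real (mult b)))) \<le> norm b powr (-s)"
              using s[OF a bQ] nb by (intro powr_mono) auto
          qed (use pos K in \<open>simp add: G_def\<close>)
          finally show ?thesis .
        qed
        hence "ennreal (real M * ?v) \<le> ennreal (G * norm b powr (-s))" by (rule ennreal_leI)
        finally show ?thesis .
      qed
      have G0: "G \<ge> 0" using pos K by (simp add: G_def)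
      have "hausdorff_content t (trapped c R \<inter> ball a rad) \<le>
          hausdorff_content t (\<Union>b\<in>Q'. \<Union>\<psi>\<in>\<Phi> b. (\<lambda>y. \<psi> (y - c 1)) ` ?X b)"
        by (rule hausdorff_content_mono[OF cov])
      also have "\<dots> \<le> ennreal (infsum (\<lambda>b. G * norm b powr (-s)) Q')"
        by (rule hausdorff_content_UN_infsum[OF cQ' summable_on_cmult_right[OF sm']])
          (use piece G0 in auto)
      also have "infsum (\<lambda>b. G * norm b powr (-s)) Q' = G * infsum (\<lambda>b. norm b powr (-s)) Q'"
        by (rule infsum_cmult_right')
      also have "\<dots> = E * bexp a * (1/2) ^ n * (K * infsum (\<lambda>b. norm b powr (-s)) Q')"
        by (simp add: G_def)
      also have "ennreal \<dots> \<le> ennreal (E * bexp a * (1/2) ^ n * (1/2))"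
        using tail pos by (intro ennreal_leI mult_left_mono) auto
      finally show ?case by (simp add: mult_ac)
    qed
    have "hausdorff_content t (trapped c R \<inter> ball a rad) = 0" if "a \<in> Q'" for a
      by (rule ennreal_eq_0_if_le_half_powers) (rule claim[OF that c])
    hence "hausdorff_content t (\<Union>a\<in>Q'. trapped c R \<inter> ball a rad) = 0"
      by (intro hausdorff_content_UN_null cQ')
    moreover have "trapped c R \<subseteq> (\<Union>a\<in>Q'. trapped c R \<inter> ball a rad)"
    proof
      fix z assume z: "z \<in> trapped c R"
      obtain a where "a \<in> Q'" "z \<in> ball a rad" using near[OF z c] by blast
      thus "z \<in> (\<Union>a\<in>Q'. trapped c R \<inter> ball a rad)" using z by blast
    qed
    ultimately have "hausdorff_content t (trapped c R) \<le> 0" using hausdorff_content_mono by metis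
    thus ?thesis by simp
  qed
  show thesis
  proof (rule that[of R1])
    show "deriv f z \<noteq> 0" if "z \<notin> poles f" "norm (f z) > R1 - 1" for z
      using R0(2)[of z] that R1(1) by simp
  qed (use null in blast)
qed

text \<open>After the first map an escaping point is trapped for the shifted sequence. The value of
  \<open>f\<close> at the point is large, so the derivative does not vanish there and the null set
  can be pulled back.\<close>

lemma escaping_null:
  assumes "t > 0" "\<And>a b. a \<in> Q \<Longrightarrow> b \<in> Q \<Longrightarrow> s \<le> t * (1 + 1 / real (mult a) + \<beta> / real (mult b))"
    and "(\<lambda>a. norm a powr (-s)) summable_on Q"
  obtains R1 where "\<And>R c J. R \<ge> R1 \<Longrightarrow> \<forall>n. norm (c n) < 1 \<Longrightarrow> hausdorff_content t (escaping_R f c J R) = 0"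
proof -
  obtain R1 where R1: "\<And>R c. R \<ge> R1 \<Longrightarrow> \<forall>n. norm (c n) < 1 \<Longrightarrow> hausdorff_content t (trapped c R) = 0"
    "\<And>z. z \<notin> poles f \<Longrightarrow> norm (f z) > R1 - 1 \<Longrightarrow> deriv f z \<noteq> 0"
    using trapped_null[OF assms] by blast
  show thesis
  proof (rule that[of R1])
    fix R J and c :: "nat \<Rightarrow> complex" assume R: "R \<ge> R1" and c: "\<forall>n. norm (c n) < 1"
    let ?S = "escaping_R f c J R"
    have S: "z \<notin> poles f" "f z + c 1 \<in> trapped (\<lambda>i. c (Suc i)) R" if z: "z \<in> ?S" for z
    proof -
      have *: "nonaut_iter f c k z \<notin> poles f" for k using z by (auto simp: escaping_R_def all_defined_def)
      have **: "norm (nonaut_iter f c (Suc n) z) > R" for n using z by (auto simp: escaping_R_def)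
      show "z \<notin> poles f" using *[of 0] by simp
      show "f z + c 1 \<in> trapped (\<lambda>i. c (Suc i)) R"
        unfolding trapped_def using *[of "Suc _"] ** unfolding nonaut_iter_shift by blast
    qed
    show "hausdorff_content t ?S = 0"
    proof (rule hausdorff_null_holomorphic_preimage)
      show "f holomorphic_on - poles f" using pm by (simp add: plane_meromorphic_def Compl_eq_Diff_UNIV)
      show "open (- poles f)" using closed_poles[OF pm] by blast
      show "?S \<subseteq> - poles f" using S by blast
      show "deriv f z \<noteq> 0" if "z \<in> ?S" for z
      proof (rule R1(2)[OF S(1)[OF that]])
        have "norm (f z + c 1) > R" by (rule trapped_step(2)[OF S(2)[OF that]])
        thus "norm (f z) > R1 - 1" using norm_triangle_ineq[of "f z" "c 1"] spec[OF c, of 1] R by linarith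
      qed
      let ?T = "trapped (\<lambda>i. c (Suc i)) R"
      have "hausdorff_content t ?T = 0" by (rule R1(1)[OF R]) (use c in blast)
      hence "hausdorff_content t ((\<lambda>y. y - c 1) ` ?T) \<le> ennreal (1 powr t * 0)"
        by (intro hausdorff_content_lipschitz_image assms(1)) auto
      moreover have "f ` ?S \<subseteq> (\<lambda>y. y - c 1) ` ?T"
      proof (rule image_subsetI)
        fix z assume "z \<in> ?S"
        thus "f z \<in> (\<lambda>y. y - c 1) ` ?T" by (intro image_eqI[of _ _ "f z + c 1"]) (use S in auto)
      qed
      ultimately show "hausdorff_content t (f ` ?S) = 0"
        using hausdorff_content_mono[of "f ` ?S" "(\<lambda>y. y - c 1) ` ?T" t] by simp
    qed (rule assms(1))
  qed
qed

end

section \<open>Coded sets\<close>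

text \<open>A Bernoulli measure argument in elementary form: \<open>\<mu> v\<close> is the mass of
  the cylinder of \<open>v\<close>, and \<open>S v\<close> the total mass of the listed words
  extending \<open>v\<close>. If \<open>S v < \<mu> v\<close>, some one-letter extension inherits
  the inequality, because a listed word extends \<open>v\<close> by at most one letter and the
  masses of the extensions of \<open>v\<close> add up to \<open>\<mu> v\<close>. From the empty word
  this leads to an infinite code; one of its prefixes is listed, and for that word \<open>S\<close>
  is at least \<open>\<mu>\<close>.\<close>

lemma word_cover_mass:
  fixes p :: "'a \<Rightarrow> real" and ws :: "nat \<Rightarrow> 'a list"
  assumes A: "finite A" and p: "\<And>a. a \<in> A \<Longrightarrow> p a \<ge> 0" "sum p A = 1"
    and cover: "\<And>x. (\<And>n. x n \<in> A) \<Longrightarrow> \<exists>i. ws i = map x [0..<length (ws i)]"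
    and wsA: "\<And>i. set (ws i) \<subseteq> A"
  shows "(\<Sum>i. ennreal (prod_list (map p (ws i)))) \<ge> 1"
proof (rule ccontr)
  assume neg: "\<not> ?thesis"
  define \<mu> where "\<mu> v = prod_list (map p v)" for v
  define g where "g v i = (if prefix v (ws i) then ennreal (\<mu> (ws i)) else 0)" for v i
  define S where "S v = (\<Sum>i. g v i)" for v
  have \<mu>0: "\<mu> v \<ge> 0" if "set v \<subseteq> A" for v
    using that p(1) unfolding \<mu>_def by (induction v) auto
  have step: "\<exists>a\<in>A. S (v @ [a]) < ennreal (\<mu> (v @ [a]))" if v: "set v \<subseteq> A" "S v < ennreal (\<mu> v)" for v
  proof (rule ccontr)
    assume "\<not> ?thesis"
    hence ge: "ennreal (\<mu> (v @ [a])) \<le> S (v @ [a])" if "a \<in> A" for a using that by (simp add: not_less)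
    have "ennreal (\<mu> v) = ennreal (\<Sum>a\<in>A. \<mu> (v @ [a]))"
      using p(2) by (simp add: \<mu>_def sum_distrib_left[symmetric])
    also have "\<dots> = (\<Sum>a\<in>A. ennreal (\<mu> (v @ [a])))"
      by (rule sum_ennreal[symmetric]) (use \<mu>0 v in auto)
    also have "\<dots> \<le> (\<Sum>a\<in>A. S (v @ [a]))" by (rule sum_mono[OF ge])
    also have "\<dots> = (\<Sum>i. \<Sum>a\<in>A. g (v @ [a]) i)" unfolding S_def by (rule suminf_sum[symmetric]) simp
    also have "\<dots> \<le> S v" unfolding S_def
    proof (rule suminf_le)
      fix i
      show "(\<Sum>a\<in>A. g (v @ [a]) i) \<le> g v i"
      proof (cases "\<exists>a\<in>A. prefix (v @ [a]) (ws i)")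
        case False
        thus ?thesis by (auto simp: g_def intro!: sum_nonpos)
      next
        case True
        then obtain a where a: "a \<in> A" "prefix (v @ [a]) (ws i)" by blast
        have uniq: "b = a" if "prefix (v @ [b]) (ws i)" for b
          using a(2) that by (auto simp: prefix_def)
        have "(\<Sum>a\<in>A. g (v @ [a]) i) = (\<Sum>b\<in>{a}. g (v @ [b]) i)"
        proof (rule sum.mono_neutral_right[OF A])
          show "{a} \<subseteq> A" using a(1) by simp
          show "\<forall>b\<in>A - {a}. g (v @ [b]) i = 0" unfolding g_def using uniq by (metis DiffD2 singletonI)
        qed
        also have "\<dots> = g v i" using a(2) append_prefixD[OF a(2)] by (simp add: g_def)
        finally show ?thesis by (rule eq_refl)
      qed
    qed auto
    finally show False using v(2) by simp
  qed
  define P where "P n v \<longleftrightarrow> length v = n \<and> set v \<subseteq> A \<and> S v < ennreal (\<mu> v)" for n v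
  have "\<exists>v. \<forall>n. P n (v n) \<and> (\<exists>a. v (Suc n) = v n @ [a])"
  proof (rule dependent_nat_choice)
    have "S [] < 1" using neg by (simp add: S_def g_def \<mu>_def not_le)
    hence "P 0 []" by (simp add: P_def \<mu>_def)
    thus "\<exists>v. P 0 v" ..
    fix v n assume "P n v"
    then obtain a where "a \<in> A" "S (v @ [a]) < ennreal (\<mu> (v @ [a]))" using step[of v] by (auto simp: P_def)
    hence "P (Suc n) (v @ [a])" using \<open>P n v\<close> by (simp add: P_def)
    thus "\<exists>v'. P (Suc n) v' \<and> (\<exists>a. v' = v @ [a])" by blast
  qed
  then obtain v where v: "\<And>n. P n (v n)" "\<And>n. \<exists>a. v (Suc n) = v n @ [a]" by blast
  define x where "x n = last (v (Suc n))" for n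
  have vx: "v n = map x [0..<n]" for n
  proof (induction n)
    case 0 thus ?case using v(1)[of 0] by (simp add: P_def)
  next
    case (Suc n)
    obtain a where "v (Suc n) = v n @ [a]" using v(2) by blast
    thus ?case using Suc by (simp add: x_def)
  qed
  have "x n \<in> A" for n
  proof -
    have "v (Suc n) \<noteq> []" using v(2)[of n] by auto
    thus ?thesis using v(1)[of "Suc n"] last_in_set unfolding x_def P_def by blast
  qed
  then obtain i where i: "ws i = map x [0..<length (ws i)]" using cover by blast
  have "ennreal (\<mu> (ws i)) = (\<Sum>j\<in>{i}. g (ws i) j)" by (simp add: g_def)
  also have "\<dots> \<le> S (ws i)" unfolding S_def by (rule sum_le_suminf) auto
  finally have "ennreal (\<mu> (ws i)) \<le> S (ws i)" .
  moreover have "ws i = v (length (ws i))" using i vx by metis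
  ultimately show False using v(1)[of "length (ws i)"] by (metis P_def not_le)
qed

text \<open>Each member of a cover lies in the cylinder of the longest word common to all of its codes, and
  the separation hypothesis bounds the mass of that cylinder by a power of its diameter.\<close>

lemma coded_set_content_pos:
  fixes \<pi> :: "(nat \<Rightarrow> 'a) \<Rightarrow> complex" and \<kappa> p :: "'a \<Rightarrow> real"
  assumes A: "finite A" and p: "\<And>a. a \<in> A \<Longrightarrow> p a \<ge> 0" "sum p A = 1"
    and s: "s > 0" and \<kappa>: "\<And>a. a \<in> A \<Longrightarrow> 0 < \<kappa> a \<and> \<kappa> a \<le> 1/2 \<and> p a \<le> \<kappa> a powr s"
    and \<delta>: "\<delta> > 0"
    and sep: "\<And>x y n. (\<And>i. x i \<in> A) \<Longrightarrow> (\<And>i. y i \<in> A) \<Longrightarrow> (\<And>i. i < n \<Longrightarrow> x i = y i) \<Longrightarrow> x n \<noteq> y n \<Longrightarrow>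
        \<delta> * (\<Prod>i<n. \<kappa> (x i)) \<le> norm (\<pi> x - \<pi> y)"
    and E: "\<And>x. (\<And>i. x i \<in> A) \<Longrightarrow> \<pi> x \<in> E"
  shows "hausdorff_content s E \<noteq> 0"
proof
  assume 0: "hausdorff_content s E = 0"
  have dspos: "\<delta> powr s / 2 > 0" using \<delta> by simp
  obtain U where U: "E \<subseteq> (\<Union>i. U i)" "\<And>i. bounded (U i)"
    "(\<Sum>i. ennreal (diameter (U i) powr s)) < ennreal (\<delta> powr s / 2)"
  proof -
    have "hausdorff_content s E < ennreal (\<delta> powr s / 2)" using 0 dspos by simp
    from hausdorff_content_less_cover[OF this] show ?thesis using that by blast
  qed
  define \<mu> where "\<mu> v = prod_list (map p v)" for v
  \<comment> \<open>The mass of a word of length n is at most \<open>q ^ n\<close>. This is for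
    members of the cover whose codes do not split before \<open>N\<close>: their word is cut off at
    length \<open>N\<close>, and its mass counts as an error.\<close>
  define q where "q = (1/2::real) powr s"
  have q: "0 < q" "q < 1"
  proof -
    have "q < (1/2) powr 0" unfolding q_def using s by (intro powr_less_mono') auto
    thus "0 < q" "q < 1" by (auto simp: q_def)
  qed
  have pq: "0 \<le> p a \<and> p a \<le> q" if "a \<in> A" for a
  proof -
    have "\<kappa> a powr s \<le> (1/2) powr s" using \<kappa>[OF that] s by (intro powr_mono2) auto
    thus ?thesis using \<kappa>[OF that] p(1)[OF that] by (simp add: q_def)
  qed
  obtain a0 where a0: "a0 \<in> A" using p(2) by (metis equals0I sum.empty zero_neq_one)
  have \<mu>q: "\<mu> v \<le> q ^ length v" if "set v \<subseteq> A" for v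
  proof -
    have "0 \<le> \<mu> v \<and> \<mu> v \<le> q ^ length v" using that
    proof (induction v)
      case (Cons a v)
      thus ?case using pq[of a] q unfolding \<mu>_def by (auto intro!: mult_mono)
    qed (simp add: \<mu>_def)
    thus ?thesis ..
  qed
  define codes where "codes V = {x. (\<forall>i. x i \<in> A) \<and> \<pi> x \<in> V}" for V
  have word: "\<exists>w. set w \<subseteq> A \<and> (\<forall>x\<in>codes V. w = map x [0..<length w]) \<and>
      \<mu> w \<le> (diameter V / \<delta>) powr s + q ^ N" if V: "bounded V" for V N
  proof (cases "\<exists>n<N. \<exists>x\<in>codes V. \<exists>y\<in>codes V. x n \<noteq> y n")
    case False
    show ?thesis
    proof (cases "codes V = {}")
      case True
      \<comment> \<open>A member without codes still needs a word; any word of length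
        \<open>N\<close> will do.\<close>
      thus ?thesis using \<mu>q[of "replicate N a0"] a0
        by (intro exI[of _ "replicate N a0"]) (auto simp: set_replicate_conv_if intro!: add_increasing)
    next
      case ne: False
      then obtain x where x: "x \<in> codes V" by blast
      let ?w = "map x [0..<N]"
      have wA: "set ?w \<subseteq> A" using x by (auto simp: codes_def)
      have "?w = map y [0..<length ?w]" if "y \<in> codes V" for y
        using False x that by auto
      thus ?thesis using \<mu>q[OF wA] wA by (intro exI[of _ ?w]) (auto intro: add_increasing)
    qed
  next
    case True
    define D where "D n \<longleftrightarrow> (\<exists>x\<in>codes V. \<exists>y\<in>codes V. x n \<noteq> y n)" for n
    define n where "n = (LEAST n. D n)"
    have Dn: "D n" unfolding n_def by (rule LeastI_ex) (use True in \<open>auto simp: D_def\<close>)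
    have min: "x i = y i" if "i < n" "x \<in> codes V" "y \<in> codes V" for i x y
      using not_less_Least[of i D] that unfolding n_def D_def by blast
    obtain x y where xy: "x \<in> codes V" "y \<in> codes V" "x n \<noteq> y n" using Dn by (auto simp: D_def)
    let ?w = "map x [0..<n]"
    have wA: "set ?w \<subseteq> A" using xy by (auto simp: codes_def)
    have "?w = map z [0..<length ?w]" if "z \<in> codes V" for z
      using min[OF _ xy(1) that] by auto
    moreover have "\<mu> ?w \<le> (diameter V / \<delta>) powr s"
    proof -
      have xA: "x i \<in> A" "y i \<in> A" for i using xy by (auto simp: codes_def)
      have "\<delta> * (\<Prod>i<n. \<kappa> (x i)) \<le> norm (\<pi> x - \<pi> y)"
        by (rule sep) (use xA min xy in auto)
      also have "\<dots> \<le> diameter V"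
        using diameter_bounded_bound[OF V, of "\<pi> x" "\<pi> y"] xy by (auto simp: codes_def dist_norm)
      finally have le: "(\<Prod>i<n. \<kappa> (x i)) \<le> diameter V / \<delta>" using \<delta> by (simp add: field_simps)
      have "\<mu> (map x [0..<j]) = (\<Prod>i<j. p (x i))" for j
        by (induction j) (auto simp: \<mu>_def mult.commute)
      hence "\<mu> ?w = (\<Prod>i<n. p (x i))" .
      also have "\<dots> \<le> (\<Prod>i<n. \<kappa> (x i) powr s)" by (intro prod_mono) (use p \<kappa> xA in auto)
      also have "\<dots> = (\<Prod>i<n. \<kappa> (x i)) powr s" by (rule prod_powr_distrib[symmetric])
      also have "\<dots> \<le> (diameter V / \<delta>) powr s"
      proof (rule powr_mono2[OF less_imp_le[OF s] _ le])
        show "0 \<le> (\<Prod>i<n. \<kappa> (x i))" by (rule prod_nonneg) (use \<kappa> xA less_imp_le in blast)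
      qed
      finally show ?thesis .
    qed
    ultimately show ?thesis using wA q by (intro exI[of _ ?w]) (auto intro: add_increasing2)
  qed
  \<comment> \<open>These errors add up to at most 1/2. The cover was chosen with sum below
    \<open>\<delta> powr s / 2\<close>, so the remaining terms contribute less than the other half
    and the total mass falls below 1.\<close>
  have "\<exists>N. q ^ N \<le> (1/2) ^ (i + 2)" for i
    using real_arch_pow_inv[of "(1/2) ^ (i + 2)" q] q by (auto intro: less_imp_le)
  then obtain N where N: "\<And>i. q ^ N i \<le> (1/2) ^ (i + 2)" by metis
  have "\<exists>w. set w \<subseteq> A \<and> (\<forall>x\<in>codes (U i). w = map x [0..<length w]) \<and>
      \<mu> w \<le> (diameter (U i) / \<delta>) powr s + q ^ N i" for i
    by (rule word[OF U(2)])
  then obtain ws where ws: "\<And>i. set (ws i) \<subseteq> A" "\<And>i x. x \<in> codes (U i) \<Longrightarrow> ws i = map x [0..<length (ws i)]"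
      "\<And>i. \<mu> (ws i) \<le> (diameter (U i) / \<delta>) powr s + q ^ N i"
    by metis
  have "1 \<le> (\<Sum>i. ennreal (\<mu> (ws i)))" unfolding \<mu>_def
  proof (rule word_cover_mass[OF A p _ ws(1)])
    fix x :: "nat \<Rightarrow> 'a" assume x: "\<And>n. x n \<in> A"
    then obtain i where "\<pi> x \<in> U i" using E[of x] U(1) by blast
    hence "x \<in> codes (U i)" using x by (simp add: codes_def)
    thus "\<exists>i. ws i = map x [0..<length (ws i)]" using ws(2) by blast
  qed
  also have "\<dots> \<le> (\<Sum>i. ennreal (1 / \<delta> powr s) * ennreal (diameter (U i) powr s) + ennreal ((1/2) ^ (i + 2)))"
  proof (rule suminf_le)
    fix i
    have "\<mu> (ws i) \<le> (diameter (U i) / \<delta>) powr s + (1/2) ^ (i + 2)" using ws(3)[of i] N[of i] by linarith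
    also have "(diameter (U i) / \<delta>) powr s = 1 / \<delta> powr s * diameter (U i) powr s"
      by (simp add: powr_divide)
    finally have "ennreal (\<mu> (ws i)) \<le> ennreal (1 / \<delta> powr s * diameter (U i) powr s + (1/2) ^ (i + 2))"
      by (rule ennreal_leI)
    thus "ennreal (\<mu> (ws i)) \<le> ennreal (1 / \<delta> powr s) * ennreal (diameter (U i) powr s) + ennreal ((1/2) ^ (i + 2))"
      using ennreal_plus[of "1 / \<delta> powr s * diameter (U i) powr s" "(1/2) ^ (i + 2)"]
        ennreal_mult'[of "1 / \<delta> powr s" "diameter (U i) powr s"] by simp
  qed auto
  also have "\<dots> = ennreal (1 / \<delta> powr s) * (\<Sum>i. ennreal (diameter (U i) powr s)) + (\<Sum>i. ennreal ((1/2) ^ (i + 2)))"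
    by (simp add: suminf_add[symmetric])
  also have "(\<Sum>i. ennreal ((1/2) ^ (i + 2))) = ennreal (1/2)"
  proof (rule suminf_ennreal_eq)
    have "(\<lambda>i. (1/2) * (1/2::real) ^ Suc i) sums ((1/2) * 1)" by (intro sums_mult power_half_series)
    thus "(\<lambda>i. (1/2) ^ (i + 2)) sums (1/2::real)" by (simp add: power_add)
  qed auto
  also have "ennreal (1 / \<delta> powr s) * (\<Sum>i. ennreal (diameter (U i) powr s)) + ennreal (1/2)
      < ennreal (1 / \<delta> powr s) * ennreal (\<delta> powr s / 2) + ennreal (1/2)"
  proof -
    have "ennreal (1 / \<delta> powr s) * (\<Sum>i. ennreal (diameter (U i) powr s)) < ennreal (1 / \<delta> powr s) * ennreal (\<delta> powr s / 2)"
      using U(3) \<delta> by (intro ennreal_mult_strict_left_mono) auto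
    thus ?thesis by (simp add: add.commute ennreal_add_left_cancel_less)
  qed
  also have "\<dots> = 1"
  proof -
    have 1: "ennreal (1 / \<delta> powr s) * ennreal (\<delta> powr s / 2) = ennreal (1/2)"
      using \<delta> by (subst ennreal_mult'[symmetric]) auto
    have 2: "ennreal (1/2) + ennreal (1/2) = ennreal (1/2 + 1/2)" by (rule ennreal_plus[symmetric]) auto
    show ?thesis unfolding 1 2 by simp
  qed
  finally show False by simp
qed

text \<open>Here \<open>d i\<close> stands for the distance of two orbits at time i and
  \<open>g i\<close> for the modulus of the pole they follow. A step involves \<open>g i\<close>
  with exponent \<open>-b\<close> and \<open>g (Suc i)\<close> with exponent \<open>-e\<close>;
  regrouping by index gives every pole the exponent \<open>-(b + e)\<close>, and the factor
  \<open>g 0 powr e\<close> corrects the surplus at index 0.\<close>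

lemma separation_product:
  fixes d g :: "nat \<Rightarrow> real"
  assumes "\<And>i. i < n \<Longrightarrow> k * g i powr (-b) * g (Suc i) powr (-e) * d (Suc i) \<le> d i"
    and "\<delta> * k * g n powr (-b) \<le> d n" and g: "\<And>i. g i > 0" and k: "k > 0"
  shows "g 0 powr e * \<delta> * (\<Prod>i\<le>n. k * g i powr (-(b + e))) \<le> d 0"
  using assms(1,2,3)
proof (induction n arbitrary: d g)
  case (0 d g)
  have "g 0 powr e * \<delta> * (k * g 0 powr (-(b + e))) = \<delta> * k * (g 0 powr e * g 0 powr (-(b + e)))" by simp
  also have "g 0 powr e * g 0 powr (-(b + e)) = g 0 powr (-b)" using 0(3)[of 0] by (simp add: powr_add[symmetric])
  finally have E: "g 0 powr e * \<delta> * (k * g 0 powr (-(b + e))) = \<delta> * k * g 0 powr (-b)" .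
  have F: "(\<Prod>i\<le>0. k * g i powr (-(b + e))) = k * g 0 powr (-(b + e))" by simp
  show ?case unfolding F E by (rule 0(2))
next
  case (Suc n d g)
  let ?P = "\<Prod>i\<le>n. k * g (Suc i) powr (-(b + e))"
  have IH: "g 1 powr e * \<delta> * ?P \<le> d 1"
    using Suc.IH[of "\<lambda>i. g (Suc i)" "\<lambda>i. d (Suc i)"] Suc.prems by simp
  have "g 0 powr e * \<delta> * (\<Prod>i\<le>Suc n. k * g i powr (-(b + e))) = k * (g 0 powr e * g 0 powr (-(b + e))) * \<delta> * ?P"
    by (simp only: prod.atMost_Suc_shift mult_ac)
  also have "g 0 powr e * g 0 powr (-(b + e)) = g 0 powr (-b)" using Suc.prems(3)[of 0] by (simp add: powr_add[symmetric])
  also have "k * g 0 powr (-b) * \<delta> * ?P = k * g 0 powr (-b) * g 1 powr (-e) * (g 1 powr e * \<delta> * ?P)"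
    using Suc.prems(3)[of 1] by (simp add: powr_minus_divide)
  also have "\<dots> \<le> k * g 0 powr (-b) * g 1 powr (-e) * d 1"
    using IH k by (intro mult_left_mono) auto
  also have "\<dots> \<le> d 0" using Suc.prems(1)[of 0] by simp
  finally show ?case .
qed

text \<open>Compactness takes the place of contraction: \<open>K k n\<close> is the image of
  \<open>B (n + k)\<close> under the k maps starting with index \<open>n\<close>, it decreases in
  \<open>k\<close>, and a point common to all \<open>K k 0\<close> starts an orbit that remains in
  every \<open>K k n\<close>.\<close>

lemma backward_orbit_exists:
  fixes B :: "nat \<Rightarrow> complex set" and \<Psi> \<phi> :: "nat \<Rightarrow> complex \<Rightarrow> complex"
  assumes B: "\<And>n. compact (B n)" "\<And>n. B n \<noteq> {}"
    and \<Psi>: "\<And>n. continuous_on (B (Suc n)) (\<Psi> n)" "\<And>n. \<Psi> n ` B (Suc n) \<subseteq> B n"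
    and \<phi>: "\<And>n u. u \<in> B (Suc n) \<Longrightarrow> \<phi> n (\<Psi> n u) = u"
  obtains z where "\<And>n. z n \<in> \<Psi> n ` B (Suc n)" "\<And>n. z (Suc n) = \<phi> n (z n)"
proof -
  define K where "K = rec_nat B (\<lambda>k K' n. \<Psi> n ` K' (Suc n))"
  have K0: "K 0 n = B n" and KS: "K (Suc k) n = \<Psi> n ` K k (Suc n)" for k n by (simp_all add: K_def)
  have sub: "K (Suc k) n \<subseteq> K k n" for k n
  proof (induction k arbitrary: n)
    case 0 thus ?case using \<Psi>(2) by (simp add: K0 KS)
  next
    case (Suc k) thus ?case unfolding KS[of "Suc k"] KS[of k] by (intro image_mono)
  qed
  have KB: "K k n \<subseteq> B n" for k n
    by (induction k) (use sub K0 in blast)+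
  have cpt: "compact (K k n) \<and> K k n \<noteq> {}" for k n
  proof (induction k arbitrary: n)
    case 0 thus ?case using B by (simp add: K0)
  next
    case (Suc k) thus ?case unfolding KS
      by (auto intro!: compact_continuous_image continuous_on_subset[OF \<Psi>(1) KB])
  qed
  have "(\<Inter>k. K k 0) \<noteq> {}"
  proof (rule compact_nest)
    show "K j 0 \<subseteq> K i 0" if "i \<le> j" for i j
      using lift_Suc_antimono_le[of "\<lambda>k. K k 0", OF sub that] .
  qed (use cpt in auto)
  then obtain z0 where z0: "\<And>k. z0 \<in> K k 0" by blast
  define z where "z = rec_nat z0 \<phi>"
  have z: "z 0 = z0" "z (Suc n) = \<phi> n (z n)" for n by (simp_all add: z_def)
  have zK: "z n \<in> K k n" for n k
  proof (induction n arbitrary: k)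
    case 0 thus ?case using z0 z by simp
  next
    case (Suc n)
    have "z n \<in> \<Psi> n ` K k (Suc n)" using Suc[of "Suc k"] by (simp add: KS)
    then obtain u where u: "u \<in> K k (Suc n)" "z n = \<Psi> n u" by blast
    hence "z (Suc n) = u" using \<phi>[of u n] KB[of k "Suc n"] z by auto
    thus ?case using u by simp
  qed
  show thesis by (rule that[of z]) (use zK[of _ 1] z in \<open>auto simp: KS K0\<close>)
qed

section \<open>Orbits with prescribed itinerary\<close>

text \<open>This is the origin of the threshold \<open>16 * C\<close>: a single factor
  \<open>1 / norm w\<close> already yields the contraction by 1/2, whatever the pole.\<close>

lemma (in pole_growth) lipschitz_half:
  fixes w :: complex
  assumes a: "a \<in> Q" and w: "norm w \<ge> 16 * C"
  shows "8 * C * norm a powr (-\<beta> / real (mult a)) * norm w powr (- (1 + 1 / real (mult a))) \<le> 1/2"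
proof -
  have w1: "norm w \<ge> 1" using w C by linarith
  hence wn: "norm w > 0" by linarith
  have "norm w powr (- (1 + 1 / real (mult a))) \<le> norm w powr (-1)"
    using w1 by (intro powr_mono) auto
  also have "\<dots> = 1 / norm w" using wn by (simp add: powr_minus_divide)
  also have "\<dots> \<le> 1 / (16 * C)" using w wn C by (intro divide_left_mono mult_pos_pos) auto
  finally have 1: "norm w powr (- (1 + 1 / real (mult a))) \<le> 1 / (16 * C)" .
  have 2: "norm a powr (-\<beta> / real (mult a)) \<le> 1" using \<beta> by (intro norm_powr_le_1[OF a]) simp
  have "8 * C * norm a powr (-\<beta> / real (mult a)) * norm w powr (- (1 + 1 / real (mult a))) \<le> 8 * C * 1 * (1 / (16 * C))"
    using 1 2 C by (intro mult_mono) auto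
  thus ?thesis using C by simp
qed

text \<open>In the lower bound on \<open>T\<close>, \<open>Rbr\<close> serves the existence of
  branches and \<open>16 * C\<close> the contraction by 1/2; the remaining terms let disks of radius
  \<open>2 * rad\<close> and the perturbations fit into the domains of the branches.\<close>

locale coded_system = pole_growth +
  fixes A :: "complex set" and T :: real and c :: "nat \<Rightarrow> complex"
  assumes AQ: "A \<subseteq> Q" and finA: "finite A" and AT: "\<And>a. a \<in> A \<Longrightarrow> norm a > T"
    and T: "T \<ge> Rbr + 16 * C + 6 * rad + 2" and c: "\<And>n. norm (c n) < 1"
begin

abbreviation "F \<equiv> nonaut_iter f c"

text \<open>The condition \<open>F n z \<noteq> x n\<close> keeps the orbit off the poles when the
  letters lie in \<open>A\<close>, since \<open>x n\<close> is then the only pole in its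
  disk.\<close>

definition codes :: "(nat \<Rightarrow> complex) \<Rightarrow> complex \<Rightarrow> bool" where
  "codes x z \<longleftrightarrow> (\<forall>n. F n z \<in> ball (x n) rad \<and> F n z \<noteq> x n)"

lemma codesD:
  assumes "codes x z" "\<And>n. x n \<in> A"
  shows "F n z \<in> ball (x n) rad" "F n z \<noteq> x n" "F n z \<notin> poles f" "f (F n z) = F (Suc n) z - c (Suc n)"
    "norm (f (F n z) - x (Suc n)) < rad + 1"
proof -
  show *: "F n z \<in> ball (x n) rad" "F n z \<noteq> x n" for n using assms by (auto simp: codes_def)
  show "F n z \<notin> poles f"
    by (rule no_other_pole[of "x n"]) (use * assms(2) AQ Q(1) ball_rad_subset in blast)+
  show eq: "f (F n z) = F (Suc n) z - c (Suc n)" by simp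
  have "norm (f (F n z) - x (Suc n)) \<le> norm (F (Suc n) z - x (Suc n)) + norm (c (Suc n))"
    using norm_triangle_ineq4[of "F (Suc n) z - x (Suc n)" "c (Suc n)"] unfolding eq by (simp add: algebra_simps)
  also have "\<dots> < rad + 1" using *(1)[of "Suc n"] c[of "Suc n"] by (simp add: dist_norm norm_minus_commute)
  finally show "norm (f (F n z) - x (Suc n)) < rad + 1" .
qed

text \<open>One branch is chosen for each step, and the orbit is found backwards. A multiple pole
  may offer several branches, so a code need not determine its point; the dimension estimate selects
  one point per code.\<close>

lemma code_exists:
  assumes x: "\<And>n. x n \<in> A"
  obtains z where "codes x z"
proof -
  have big: "norm (x n) \<ge> Rbr" "norm (x n) / 2 \<ge> rad + 1" for n
    using AT[OF x[of n]] T C rad Rbr by auto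
  have "\<exists>\<psi>. is_branch (x n) (x (Suc n)) \<psi>" for n
    by (rule branch_exists[OF _ big(1)]) (use x AQ in blast)
  then obtain \<psi> where br: "\<And>n. is_branch (x n) (x (Suc n)) (\<psi> n)" by metis
  define L where "L n = 8 * C * norm (x n) powr (-\<beta> / real (mult (x n))) *
    norm (x (Suc n)) powr (- (1 + 1 / real (mult (x n))))" for n
  have \<psi>: "\<psi> n u \<in> ball (x n) rad \<and> \<psi> n u \<noteq> x n \<and> f (\<psi> n u) = u"
    if "u \<in> ball (x (Suc n)) (norm (x (Suc n)) / 2)" for n u
    using br[of n] that unfolding is_branch_def by blast
  have \<psi>L: "norm (\<psi> n u - \<psi> n u') \<le> L n * norm (u - u')"
    if "u \<in> ball (x (Suc n)) (norm (x (Suc n)) / 2)" "u' \<in> ball (x (Suc n)) (norm (x (Suc n)) / 2)" for n u u'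
    using br[of n] that unfolding is_branch_def L_def by blast
  define B where "B n = cball (x n) rad" for n
  define \<Psi> where "\<Psi> n u = \<psi> n (u - c (Suc n))" for n u
  define \<phi> where "\<phi> n u = f u + c (Suc n)" for n u
  have inb: "u - c (Suc n) \<in> ball (x (Suc n)) (norm (x (Suc n)) / 2)" if "u \<in> B (Suc n)" for n u
  proof -
    have "norm (x (Suc n) - (u - c (Suc n))) \<le> norm (x (Suc n) - u) + norm (c (Suc n))"
      using norm_triangle_ineq[of "x (Suc n) - u" "c (Suc n)"] by (simp add: algebra_simps)
    also have "\<dots> < rad + 1" using that c[of "Suc n"] by (simp add: dist_norm B_def)
    also have "\<dots> \<le> norm (x (Suc n)) / 2" by (rule big(2))
    finally show ?thesis by (simp add: dist_norm)
  qed
  obtain z where z: "\<And>n. z n \<in> \<Psi> n ` B (Suc n)" "\<And>n. z (Suc n) = \<phi> n (z n)"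
  proof (rule backward_orbit_exists[of B \<Psi> \<phi>])
    show "compact (B n)" "B n \<noteq> {}" for n using rad by (auto simp: B_def)
    show "\<Psi> n ` B (Suc n) \<subseteq> B n" for n using \<psi>[OF inb] by (force simp: \<Psi>_def B_def)
    show "\<phi> n (\<Psi> n u) = u" if "u \<in> B (Suc n)" for n u using \<psi>[OF inb[OF that]] by (simp add: \<phi>_def \<Psi>_def)
    show "continuous_on (B (Suc n)) (\<Psi> n)" for n
    proof -
      have "(max (L n) 0)-lipschitz_on (B (Suc n)) (\<Psi> n)"
      proof (rule lipschitz_onI)
        fix u v assume uv: "u \<in> B (Suc n)" "v \<in> B (Suc n)"
        have "norm (\<Psi> n u - \<Psi> n v) \<le> L n * norm ((u - c (Suc n)) - (v - c (Suc n)))"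
          unfolding \<Psi>_def by (rule \<psi>L[OF inb[OF uv(1)] inb[OF uv(2)]])
        also have "\<dots> \<le> max (L n) 0 * norm (u - v)" by (simp add: mult_right_mono)
        finally show "dist (\<Psi> n u) (\<Psi> n v) \<le> max (L n) 0 * dist u v" by (simp add: dist_norm)
      qed simp
      thus ?thesis by (rule lipschitz_on_continuous_on)
    qed
  qed blast
  have Fz: "F n (z 0) = z n" for n
    by (induction n) (use z(2) in \<open>auto simp: \<phi>_def\<close>)
  have "z n \<in> ball (x n) rad \<and> z n \<noteq> x n" for n
  proof -
    obtain u where "u \<in> B (Suc n)" "z n = \<Psi> n u" using z(1) by blast
    thus ?thesis using \<psi>[OF inb] by (simp add: \<Psi>_def)
  qed
  hence "codes x (z 0)" unfolding codes_def Fz by blast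
  thus thesis by (rule that)
qed

text \<open>The radius is twice that of the disks at the poles, so that the image ball contains the
  pole \<open>x n\<close> itself. The same neighbourhood thus serves for univalence along the orbit
  and for finding points that land on poles.\<close>

lemma pullback:
  assumes x: "\<And>n. x n \<in> A" and z: "codes x z"
  shows "\<exists>V. open V \<and> z \<in> V \<and> (\<forall>w\<in>V. \<forall>k<n. F k w \<notin> poles f) \<and>
     continuous_on V (F n) \<and> F n ` V = ball (F n z) (2 * rad) \<and>
     (\<forall>y\<in>V. \<forall>y'\<in>V. norm (y - y') \<le> (1/2) ^ n * norm (F n y - F n y'))"
proof (induction n)
  case 0
  show ?case using rad by (intro exI[of _ "ball z (2 * rad)"]) auto
next
  case (Suc n)
  then obtain V where V: "open V" "z \<in> V" "\<And>w k. w \<in> V \<Longrightarrow> k < n \<Longrightarrow> F k w \<notin> poles f"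
    "continuous_on V (F n)" "F n ` V = ball (F n z) (2 * rad)"
    "\<And>y y'. y \<in> V \<Longrightarrow> y' \<in> V \<Longrightarrow> norm (y - y') \<le> (1/2) ^ n * norm (F n y - F n y')"
    by blast
  note zn = codesD[OF z x, of n]
  have a: "x n \<in> Q" using x AQ by blast
  define w where "w = f (F n z)"
  have w: "norm w \<ge> Rbr" "norm w \<ge> 16 * C" "norm w / 2 \<ge> 2 * rad"
  proof -
    have "norm (x (Suc n)) \<le> norm w + (rad + 1)"
      using norm_triangle_ineq2[of "x (Suc n)" w] zn(5) by (simp add: w_def norm_minus_commute)
    hence "norm w \<ge> T - rad - 1" using AT[OF x[of "Suc n"]] by linarith
    thus "norm w \<ge> Rbr" "norm w \<ge> 16 * C" "norm w / 2 \<ge> 2 * rad" using T C rad Rbr by auto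
  qed
  obtain \<psi> where br: "is_branch (x n) w \<psi>" and \<psi>: "\<psi> w = F n z"
    using branch_through[OF a _ zn(1,2)] w(1) unfolding w_def by blast
  define \<Psi> where "\<Psi> u = \<psi> (u - c (Suc n))" for u
  let ?W = "ball (F (Suc n) z) (2 * rad)"
  have inb: "u - c (Suc n) \<in> ball w (norm w / 2)" if "u \<in> ?W" for u
  proof -
    have "w - (u - c (Suc n)) = F (Suc n) z - u" by (simp add: w_def)
    hence "dist w (u - c (Suc n)) < 2 * rad" using that unfolding dist_norm mem_ball by (simp only:)
    thus ?thesis using w(3) by simp
  qed
  have \<Psi>1: "\<Psi> u \<in> ball (x n) rad" "\<Psi> u \<noteq> x n" "f (\<Psi> u) + c (Suc n) = u" if "u \<in> ?W" for u
    using br inb[OF that] by (auto simp: \<Psi>_def is_branch_def)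
  have \<Psi>2: "norm (\<Psi> u - \<Psi> u') \<le> 1/2 * norm (u - u')" if "u \<in> ?W" "u' \<in> ?W" for u u'
  proof -
    have "norm (\<Psi> u - \<Psi> u') \<le> 8 * C * norm (x n) powr (-\<beta> / real (mult (x n))) *
          norm w powr (- (1 + 1 / real (mult (x n)))) * norm ((u - c (Suc n)) - (u' - c (Suc n)))"
      unfolding \<Psi>_def using br inb[OF that(1)] inb[OF that(2)] unfolding is_branch_def by blast
    also have "\<dots> \<le> 1/2 * norm ((u - c (Suc n)) - (u' - c (Suc n)))"
      by (rule mult_right_mono[OF lipschitz_half[OF a w(2)]]) simp
    finally show ?thesis by simp
  qed
  have \<Psi>z: "\<Psi> (F (Suc n) z) = F n z" using \<psi> by (simp add: \<Psi>_def w_def)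
  have zW: "F (Suc n) z \<in> ?W" using rad by simp
  have "(1/2)-lipschitz_on ?W \<Psi>"
    by (rule lipschitz_onI) (use \<Psi>2 in \<open>auto simp: dist_norm\<close>)
  hence "continuous_on ?W \<Psi>" by (rule lipschitz_on_continuous_on)
  moreover have "inj_on \<Psi> ?W" using \<Psi>1(3) by (metis inj_onI)
  ultimately have open\<Psi>: "open (\<Psi> ` ?W)" by (intro invariance_of_domain) auto
  \<comment> \<open>The contraction by 1/2 keeps the new preimage inside the previous image ball, so
    it can be lifted along \<open>F n\<close>.\<close>
  have \<Psi>sub: "\<Psi> u \<in> ball (F n z) (2 * rad)" if "u \<in> ?W" for u
  proof -
    have "norm (F n z - \<Psi> u) \<le> 1/2 * norm (F (Suc n) z - u)" using \<Psi>2[OF zW that] unfolding \<Psi>z .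
    also have "\<dots> < 2 * rad" using that rad unfolding mem_ball dist_norm by simp
    finally show ?thesis by (simp add: dist_norm)
  qed
  have npole: "\<Psi> u \<notin> poles f" if "u \<in> ?W" for u
    by (rule no_other_pole[of "x n"]) (use \<Psi>1[OF that] a Q(1) ball_rad_subset in blast)+
  define V' where "V' = V \<inter> F n -` (\<Psi> ` ?W)"
  have V'D: "\<exists>u\<in>?W. F n y = \<Psi> u \<and> F (Suc n) y = u" if "y \<in> V'" for y
  proof -
    obtain u where u: "u \<in> ?W" "F n y = \<Psi> u" using \<open>y \<in> V'\<close> unfolding V'_def by blast
    moreover have "F (Suc n) y = u" using \<Psi>1(3)[OF u(1)] u(2) by simp
    ultimately show ?thesis by blast
  qed
  show ?case
  proof (intro exI[of _ V'] conjI ballI allI impI)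
    show "open V'" unfolding V'_def using V(1,4) open\<Psi> by (simp add: continuous_on_open_vimage Int_commute continuous_open_preimage)
    show "z \<in> V'" unfolding V'_def using V(2) zW \<Psi>z by (auto intro!: image_eqI[of _ \<Psi> "F (Suc n) z"])
    show "F k y \<notin> poles f" if y: "y \<in> V'" and k: "k < Suc n" for y k
    proof (cases "k = n")
      case True
      obtain u where "u \<in> ?W" "F n y = \<Psi> u" using V'D[OF y] by blast
      thus ?thesis using npole True by (simp only: not_False_eq_True)
    next
      case False
      thus ?thesis using V(3)[of y k] y k by (simp add: V'_def)
    qed
    show "continuous_on V' (F (Suc n))"
    proof -
      have 1: "continuous_on (\<Psi> ` ?W) f"
        by (rule plane_meromorphic_continuous_on[OF pm]) (use npole in auto)
      have 2: "continuous_on V' (F n)" by (rule continuous_on_subset[OF V(4)]) (simp add: V'_def)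
      have "continuous_on V' (\<lambda>y. f (F n y))"
        by (rule continuous_on_compose2[OF 1 2]) (auto simp: V'_def)
      hence "continuous_on V' (\<lambda>y. f (F n y) + c (Suc n))" by (intro continuous_intros)
      thus ?thesis by simp
    qed
    show "F (Suc n) ` V' = ?W"
    proof
      show "F (Suc n) ` V' \<subseteq> ?W" using V'D by (metis image_subsetI)
      show "?W \<subseteq> F (Suc n) ` V'"
      proof
        fix u assume u: "u \<in> ?W"
        obtain y where y: "y \<in> V" "F n y = \<Psi> u" using \<Psi>sub[OF u] V(5) by (metis imageE)
        hence "y \<in> V'" using u by (auto simp: V'_def)
        moreover have "F (Suc n) y = u" using \<Psi>1(3)[OF u] y(2) by simp
        ultimately show "u \<in> F (Suc n) ` V'" by blast
      qed
    qed
    show "norm (y - y') \<le> (1/2) ^ Suc n * norm (F (Suc n) y - F (Suc n) y')" if y: "y \<in> V'" "y' \<in> V'" for y y'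
    proof -
      obtain u u' where u: "u \<in> ?W" "F n y = \<Psi> u" "F (Suc n) y = u" "u' \<in> ?W" "F n y' = \<Psi> u'" "F (Suc n) y' = u'"
        using V'D[OF y(1)] V'D[OF y(2)] by blast
      have "norm (y - y') \<le> (1/2) ^ n * norm (\<Psi> u - \<Psi> u')"
        using V(6)[of y y'] y unfolding u(2,5)[symmetric] by (simp add: V'_def)
      also have "\<dots> \<le> (1/2) ^ n * (1/2 * norm (u - u'))"
        using \<Psi>2[OF u(1,4)] by (intro mult_left_mono) auto
      finally show ?thesis unfolding u(3,6) by simp
    qed
  qed
qed

text \<open>Radiality follows from the pullbacks of balls of the fixed radius
  \<open>2 * rad\<close>. For the Julia set, the pullback at time \<open>n\<close> contains a point
  that lands on the pole \<open>x n\<close>, at distance at most \<open>(1/2) ^ n * rad\<close> from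
  \<open>z\<close>; hence no neighbourhood of \<open>z\<close> has all iterates defined.\<close>

lemma coded_in_radial_julia:
  assumes x: "\<And>n. x n \<in> A" and z: "codes x z"
  shows "z \<in> radial_julia_set f c"
proof -
  have ad: "z \<in> all_defined f c" using codesD(3)[OF z x] by (simp add: all_defined_def)
  have "univalent_pullback f c n (2 * rad) z" for n
  proof -
    obtain V where V: "open V" "z \<in> V" "\<forall>w\<in>V. \<forall>k<n. F k w \<notin> poles f" "F n ` V = ball (F n z) (2 * rad)"
      "\<forall>y\<in>V. \<forall>y'\<in>V. norm (y - y') \<le> (1/2) ^ n * norm (F n y - F n y')"
      using pullback[OF x z, of n] by blast
    have "inj_on (F n) V"
    proof (rule inj_onI)
      fix y y' assume "y \<in> V" "y' \<in> V" "F n y = F n y'"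
      hence "norm (y - y') \<le> (1/2) ^ n * norm (F n y - F n y')" using V(5) by blast
      thus "y = y'" using \<open>F n y = F n y'\<close> by simp
    qed
    thus ?thesis unfolding univalent_pullback_def using V by blast
  qed
  hence "\<exists>\<delta>>0. infinite {n. univalent_pullback f c n \<delta> z}" using rad by (intro exI[of _ "2 * rad"]) simp
  moreover have "z \<in> julia_set f c"
  proof (rule ccontr)
    assume "z \<notin> julia_set f c"
    then obtain U where U: "open U" "z \<in> U" "U \<subseteq> all_defined f c" by (auto simp: julia_set_def)
    then obtain e where e: "e > 0" "ball z e \<subseteq> U" using open_contains_ball by blast
    obtain n where n: "(1/2) ^ n < e / rad" using real_arch_pow_inv[of "e / rad" "1/2"] e rad by auto
    obtain V where V: "z \<in> V" "F n ` V = ball (F n z) (2 * rad)"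
      "\<forall>y\<in>V. \<forall>y'\<in>V. norm (y - y') \<le> (1/2) ^ n * norm (F n y - F n y')"
      using pullback[OF x z, of n] by blast
    have zx: "norm (F n z - x n) < rad" using codesD(1)[OF z x, of n] by (simp add: dist_norm norm_minus_commute)
    hence "x n \<in> F n ` V" using rad unfolding V(2) by (simp add: dist_norm)
    then obtain y where y: "y \<in> V" "x n = F n y" by blast
    have "norm (z - y) \<le> (1/2) ^ n * norm (F n z - F n y)" using V(1,3) y by blast
    also have "\<dots> \<le> (1/2) ^ n * rad" using zx y(2) by (intro mult_left_mono) auto
    also have "\<dots> < e" using n rad by (simp add: field_simps)
    finally have "y \<in> all_defined f c" using e(2) U(3) by (auto simp: dist_norm)
    hence "F n y \<notin> poles f" by (simp add: all_defined_def)
    moreover have "F n y \<in> poles f" using x AQ Q(1) y(2) by (metis subsetD)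
    ultimately show False by blast
  qed
  ultimately show ?thesis using ad by (simp add: radial_julia_set_def)
qed

text \<open>An upper bound for the expansion of \<open>f\<close> between points with the same
  current and the same next pole, read as a lower bound for distances. The 12 is 4 * 2 * (3/2): the
  values are at most twice the modulus of the next pole, squared; the power of half this modulus
  loses a factor 2; the chart contributes 3/2.\<close>

lemma expansion_step:
  assumes x: "\<And>n. x n \<in> A" "\<And>n. x' n \<in> A" and z: "codes x z" "codes x' z'" and m: "mult (x n) = m"
    and eq: "x n = x' n" "x (Suc n) = x' (Suc n)"
  shows "1 / (12 * real m * C) * norm (x n) powr (-(\<beta> / real m)) * norm (x (Suc n)) powr (-(1 + 1 / real m)) *
      norm (F (Suc n) z - F (Suc n) z') \<le> norm (F n z - F n z')"
proof -
  let ?a = "x n" and ?b = "x (Suc n)"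
  have a: "?a \<in> Q" using x AQ by blast
  have m1: "m \<ge> 1" using mult_ge_1[OF a] m by simp
  note zn = codesD[OF z(1) x(1), of n] and zn' = codesD[OF z(2) x(2), of n]
  have b: "norm ?b / 2 > rad + 1" "norm ?b > 0" using AT[OF x(1)[of "Suc n"]] T C rad Rbr by auto
  have na: "norm ?a > 0" using Q(3)[OF a] by linarith
  have bd: "norm ?b / 2 \<le> norm w \<and> norm w \<le> 2 * norm ?b" if "norm (w - ?b) < rad + 1" for w
    using that b norm_triangle_ineq2[of ?b w] norm_triangle_ineq2[of w ?b] by (simp add: norm_minus_commute)
  have "norm (f (F n z) - f (F n z')) \<le> (2 * norm ?b)\<^sup>2 * (real (mult ?a) * (norm ?b / 2) powr (1 / real (mult ?a) - 1) *
    (3/2 * C * norm ?a powr (\<beta> / real (mult ?a)) * norm (F n z - F n z')))"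
    by (rule expansion_bound[OF a]) (use zn zn' eq bd[OF zn(5)] bd[OF zn'(5)[folded eq]] b in \<open>auto simp del: nonaut_iter.simps\<close>)
  also have "\<dots> \<le> (2 * norm ?b)\<^sup>2 * (real m * (2 * norm ?b powr (1 / real m - 1)) *
    (3/2 * C * norm ?a powr (\<beta> / real m) * norm (F n z - F n z')))"
  proof -
    have "(norm ?b / 2) powr (1 / real m - 1) = norm ?b powr (1 / real m - 1) * 2 powr (1 - 1 / real m)"
    proof -
      have "2 powr (1 - 1 / real m) = 1 / 2 powr (1 / real m - 1)" by (simp flip: powr_minus_divide)
      thus ?thesis by (simp add: powr_divide)
    qed
    also have "\<dots> \<le> norm ?b powr (1 / real m - 1) * 2 powr 1"
      using m1 by (intro mult_left_mono powr_mono) auto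
    finally have "(norm ?b / 2) powr (1 / real m - 1) \<le> 2 * norm ?b powr (1 / real m - 1)" by simp
    thus ?thesis unfolding m using C by (intro mult_left_mono mult_right_mono) auto
  qed
  also have "\<dots> = 12 * real m * C * norm ?a powr (\<beta> / real m) * ((norm ?b)\<^sup>2 * norm ?b powr (1 / real m - 1)) * norm (F n z - F n z')"
    by (simp add: power2_eq_square)
  also have "(norm ?b)\<^sup>2 * norm ?b powr (1 / real m - 1) = norm ?b powr (1 + 1 / real m)"
  proof -
    have "(norm ?b)\<^sup>2 = norm ?b powr 2" using b by (simp add: powr_numeral)
    hence "(norm ?b)\<^sup>2 * norm ?b powr (1 / real m - 1) = norm ?b powr (2 + (1 / real m - 1))"
      by (simp only: powr_add)
    also have "2 + (1 / real m - 1) = 1 + 1 / real m" by simp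
    finally show ?thesis .
  qed
  finally have main: "norm (f (F n z) - f (F n z')) \<le> 12 * real m * C * norm ?a powr (\<beta> / real m) * norm ?b powr (1 + 1 / real m) * norm (F n z - F n z')" .
  define K where "K = 12 * real m * C * norm ?a powr (\<beta> / real m) * norm ?b powr (1 + 1 / real m)"
  have K: "K > 0" unfolding K_def using m1 C na b by (intro mult_pos_pos) (auto simp: powr_gt_zero)
  have eqK: "1 / (12 * real m * C) * norm ?a powr (-(\<beta> / real m)) * norm ?b powr (-(1 + 1 / real m)) = 1 / K"
    unfolding powr_minus_divide K_def by simp
  have eqF: "F (Suc n) z - F (Suc n) z' = f (F n z) - f (F n z')" by simp
  have "1 / K * norm (f (F n z) - f (F n z')) \<le> 1 / K * (K * norm (F n z - F n z'))"
    using main K by (intro mult_left_mono) (auto simp: K_def)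
  also have "\<dots> = norm (F n z - F n z')" using K by simp
  finally show ?thesis unfolding eqK eqF .
qed

end

section \<open>Dimension bounds\<close>

text \<open>Distinct poles are at least \<open>D\<close> apart, and the two radii take away at most
  \<open>D / 8\<close>.\<close>

lemma (in coded_system) codes_far_apart:
  assumes x: "\<And>n. x n \<in> A" "\<And>n. x' n \<in> A" and z: "codes x z" "codes x' z'" and ne: "x n \<noteq> x' n"
  shows "D / 2 \<le> norm (F n z - F n z')"
proof -
  have "x n \<in> poles f" "x' n \<in> poles f" using x AQ Q(1) by blast+
  hence "x' n \<notin> ball (x n) D" using no_other_pole[of "x n" "x' n"] ne by auto
  hence "D \<le> norm (x n - x' n)" by (simp add: dist_norm)
  also have "\<dots> \<le> norm (x n - F n z) + norm (F n z - F n z') + norm (F n z' - x' n)"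
    using norm_triangle_ineq[of "x n - F n z" "F n z - x' n"] norm_triangle_ineq[of "F n z - F n z'" "F n z' - x' n"]
    by simp
  also have "\<dots> \<le> rad + norm (F n z - F n z') + rad"
    using codesD(1)[OF z(1) x(1), of n] codesD(1)[OF z(2) x(2), of n]
    by (intro add_mono) (auto simp: dist_norm norm_minus_commute)
  finally show ?thesis using rad D_pos by linarith
qed

text \<open>At the splitting step the images follow different poles, whose moduli may be very
  different, so \<open>expansion_step\<close> does not apply. Finiteness of \<open>A\<close>
  replaces it: all values involved lie between 1 and \<open>H\<close>, which gives the Lipschitz
  constant \<open>\<Lambda>\<close>. This loss occurs once, at the end of the common prefix, and not
  at every step.\<close>

lemma (in coded_system) codes_separate_before_split:
  assumes A1: "\<And>a. a \<in> A \<Longrightarrow> mult a = m" "A \<noteq> {}"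
  shows "\<exists>\<delta>>0. \<forall>x x' z z' n. (\<forall>n. x n \<in> A) \<longrightarrow> (\<forall>n. x' n \<in> A) \<longrightarrow> codes x z \<longrightarrow> codes x' z' \<longrightarrow>
      x n = x' n \<longrightarrow> x (Suc n) \<noteq> x' (Suc n) \<longrightarrow> \<delta> \<le> norm (F n z - F n z')"
proof -
  define H where "H = (\<Sum>a\<in>A. norm a) + rad + 1"
  have normH: "norm a + rad + 1 \<le> H" if "a \<in> A" for a
    using member_le_sum[OF that _ finA, of norm] by (simp add: H_def)
  obtain a0 where a0: "a0 \<in> A" using A1(2) by blast
  have H1: "H \<ge> 1" using normH[OF a0] rad by (smt (verit) norm_ge_zero)
  have m1: "m \<ge> 1" using mult_ge_1[of a0] A1(1)[OF a0] a0 AQ by auto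
  define \<Lambda> where "\<Lambda> = H\<^sup>2 * (real m * (3/2 * C * H powr (\<beta> / real m)))"
  have \<Lambda>: "\<Lambda> > 0" unfolding \<Lambda>_def using H1 m1 C by (intro mult_pos_pos) auto
  show ?thesis
  proof (intro exI[of _ "D / (2 * \<Lambda>)"] conjI allI impI)
    show "D / (2 * \<Lambda>) > 0" using D_pos \<Lambda> by simp
    fix x x' z z' n
    assume xA: "\<forall>n. x n \<in> A" "\<forall>n. x' n \<in> A" and z: "codes x z" "codes x' z'"
      and eq: "x n = x' n" and ne: "x (Suc n) \<noteq> x' (Suc n)"
    have x: "x n \<in> A" "x' n \<in> A" for n using xA by auto
    note zn = codesD[OF z(1) x(1), of n] and zn' = codesD[OF z(2) x(2), of n]
    have bd: "1 \<le> norm w \<and> norm w \<le> H" if b: "b \<in> A" and "norm (w - b) < rad + 1" for w b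
    proof -
      have "norm b > rad + 2" using AT[OF b] T C rad Rbr by linarith
      thus ?thesis using that(2) normH[OF b] norm_triangle_ineq2[of b w] norm_triangle_ineq2[of w b]
        by (simp add: norm_minus_commute)
    qed
    have a: "x n \<in> Q" using x AQ by blast
    have mx: "mult (x n) = m" using A1 x by blast
    have "D / 2 \<le> norm (F (Suc n) z - F (Suc n) z')" by (rule codes_far_apart[OF x z ne])
    also have "F (Suc n) z - F (Suc n) z' = f (F n z) - f (F n z')" by simp
    also have "norm (f (F n z) - f (F n z')) \<le> H\<^sup>2 * (real (mult (x n)) * 1 powr (1 / real (mult (x n)) - 1) *
      (3/2 * C * norm (x n) powr (\<beta> / real (mult (x n))) * norm (F n z - F n z')))"
    proof (rule expansion_bound[OF a])
      show "F n z \<in> ball (x n) rad" "F n z \<noteq> x n" by (fact zn)+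
      show "F n z' \<in> ball (x n) rad" "F n z' \<noteq> x n" unfolding eq by (fact zn')+
      show "1 \<le> norm (f (F n z))" "norm (f (F n z)) \<le> H" using bd[OF x(1) zn(5)] by blast+
      show "1 \<le> norm (f (F n z'))" "norm (f (F n z')) \<le> H" using bd[OF x(2) zn'(5)] by blast+
    qed simp
    also have "\<dots> \<le> H\<^sup>2 * (real m * 1 * (3/2 * C * H powr (\<beta> / real m) * norm (F n z - F n z')))"
    proof -
      have "norm (x n) \<le> H" using normH[OF x(1)[of n]] rad by linarith
      hence "norm (x n) powr (\<beta> / real m) \<le> H powr (\<beta> / real m)" using \<beta> by (intro powr_mono2) auto
      thus ?thesis unfolding mx powr_one_eq_one using C by (intro mult_left_mono mult_right_mono) auto
    qed
    also have "\<dots> = \<Lambda> * norm (F n z - F n z')" by (simp add: \<Lambda>_def)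
    finally show "D / (2 * \<Lambda>) \<le> norm (F n z - F n z')" using \<Lambda> by (simp add: field_simps)
  qed
qed

context pole_growth
begin

lemma finite_system_exists:
  assumes nonsum: "\<not> (\<lambda>a. norm a powr (-e)) summable_on {a\<in>Q. mult a = m}"
  obtains A where "finite A" "A \<subseteq> {a\<in>Q. mult a = m}" "\<And>a. a \<in> A \<Longrightarrow> norm a > T" "(\<Sum>a\<in>A. norm a powr (-e)) > K"
proof -
  let ?h = "\<lambda>a::complex. norm a powr (-e)" and ?Q = "{a\<in>Q. mult a = m}"
  let ?A0 = "?Q - cball 0 T"
  have "finite (?Q \<inter> cball 0 T)"
    by (rule finite_subset[OF _ finite_poles_Int_compact[OF pm compact_cball[of 0 T]]]) (use Q(1) in auto)
  hence fin: "?h summable_on (?Q \<inter> cball 0 T)" by (rule summable_on_finite)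
  have "\<not> ?h summable_on ?A0"
  proof
    assume "?h summable_on ?A0"
    hence "?h summable_on (?A0 \<union> (?Q \<inter> cball 0 T))" by (rule summable_on_Un_disjoint[OF _ fin]) auto
    moreover have "?A0 \<union> (?Q \<inter> cball 0 T) = ?Q" by auto
    ultimately show False using nonsum by simp
  qed
  hence "\<not> bdd_above (sum ?h ` {F. F \<subseteq> ?A0 \<and> finite F})"
    using nonneg_bdd_above_summable_on[of ?A0 ?h] by auto
  then obtain A where "A \<subseteq> ?A0" "finite A" "sum ?h A > K"
    unfolding bdd_above_def by (auto simp: not_le)
  thus thesis by (intro that[of A]) auto
qed

text \<open>The weight \<open>norm a powr (-(s * (b + e))) / \<Sigma>\<close> is at most
  \<open>\<kappa> a powr s\<close> exactly when \<open>\<Sigma> \<ge> k powr (-s)\<close>, and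
  divergence supplies a finite \<open>A\<close> for which this holds. Thus the constant
  \<open>k\<close>, paid at every step of an orbit, is also absorbed at every step.\<close>

lemma radial_escaping_content_pos:
  assumes m: "m \<ge> 1" and s: "s > 0" and c: "\<And>n. norm (c n) < 1"
    and nonsum: "\<not> (\<lambda>a. norm a powr (-(s * (\<beta> / real m + (1 + 1 / real m))))) summable_on {a\<in>Q. mult a = m}"
  shows "hausdorff_content s (escaping_R f c (radial_julia_set f c) R) \<noteq> 0"
proof -
  define b where "b = \<beta> / real m"
  define e where "e = 1 + 1 / real m"
  have b0: "b \<ge> 0" and e0: "e \<ge> 0" using \<beta> by (auto simp: b_def e_def)
  define k where "k = 1 / (12 * real m * C)"
  have k: "0 < k" "k \<le> 1/2"
  proof -
    have "12 * 1 * 1 \<le> 12 * real m * C" using m C by (intro mult_mono) auto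
    hence X: "2 \<le> 12 * real m * C" by linarith
    show "0 < k" unfolding k_def using X by (intro divide_pos_pos) linarith+
    show "k \<le> 1/2" unfolding k_def by (rule divide_left_mono) (use X in auto)
  qed
  define T where "T = \<bar>R\<bar> + (Rbr + 16 * C + 6 * rad + 2)"
  obtain A where A: "finite A" "A \<subseteq> {a\<in>Q. mult a = m}" "\<And>a. a \<in> A \<Longrightarrow> norm a > T"
    "(\<Sum>a\<in>A. norm a powr (-(s * (b + e)))) > k powr (-s)"
    using finite_system_exists[OF nonsum, of T "k powr (-s)"] unfolding b_def e_def by blast
  interpret coded_system f Q D \<beta> C M A T c
    by unfold_locales (use A c in \<open>auto simp: T_def\<close>)
  define \<Sigma> where "\<Sigma> = (\<Sum>a\<in>A. norm a powr (-(s * (b + e))))"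
  have \<Sigma>: "\<Sigma> > k powr (-s)" "\<Sigma> > 0"
    using A(4) k by (auto simp: \<Sigma>_def intro: order_less_trans[of 0 "k powr (-s)"])
  have Ane: "A \<noteq> {}" using \<Sigma>(2) by (auto simp: \<Sigma>_def)
  have A1: "mult a = m" if "a \<in> A" for a using A(2) that by blast
  obtain \<delta>1 where \<delta>1: "\<delta>1 > 0" "\<forall>x x' z z' n. (\<forall>n. x n \<in> A) \<longrightarrow> (\<forall>n. x' n \<in> A) \<longrightarrow> codes x z \<longrightarrow> codes x' z' \<longrightarrow>
      x n = x' n \<longrightarrow> x (Suc n) \<noteq> x' (Suc n) \<longrightarrow> \<delta>1 \<le> norm (F n z - F n z')"
    using codes_separate_before_split[OF A1 Ane] by blast
  \<comment> \<open>\<open>D / 2\<close> serves codes that differ in the first letter,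
    \<open>\<delta>1\<close> those with a common prefix.\<close>
  define \<delta> where "\<delta> = min (D / 2) \<delta>1"
  have \<delta>: "\<delta> > 0" using \<delta>1(1) D_pos by (simp add: \<delta>_def)
  define \<kappa> where "\<kappa> a = k * norm a powr (-(b + e))" for a :: complex
  define \<pi> where "\<pi> x = (SOME z. codes x z)" for x
  have \<pi>: "codes x (\<pi> x)" if "\<And>n. x n \<in> A" for x
  proof -
    have "\<exists>z. codes x z" by (rule code_exists[OF that]) (rule exI)
    thus ?thesis unfolding \<pi>_def by (rule someI_ex)
  qed
  have na: "norm a \<ge> 1" if "a \<in> A" for a using Q(3)[of a] AQ that by blast
  show ?thesis
  proof (rule coded_set_content_pos[of A "\<lambda>a. norm a powr (-(s * (b + e))) / \<Sigma>" s \<kappa> \<delta> \<pi>])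
    show "finite A" by fact
    show "norm a powr (-(s * (b + e))) / \<Sigma> \<ge> 0" if "a \<in> A" for a using \<Sigma>(2) by simp
    show "(\<Sum>a\<in>A. norm a powr (-(s * (b + e))) / \<Sigma>) = 1"
      using \<Sigma>(2) unfolding sum_divide_distrib[symmetric] \<Sigma>_def[symmetric] by simp
    show "s > 0" by fact
    show "\<delta> > 0" by fact
    show "0 < \<kappa> a \<and> \<kappa> a \<le> 1/2 \<and> norm a powr (-(s * (b + e))) / \<Sigma> \<le> \<kappa> a powr s" if a: "a \<in> A" for a
    proof (intro conjI)
      have na0: "norm a > 0" using na[OF a] by linarith
      have aQ: "a \<in> Q" using AQ a by blast
      show "0 < \<kappa> a" unfolding \<kappa>_def using k na0 by (intro mult_pos_pos) (auto simp: powr_gt_zero)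
      have "norm a powr (-(b + e)) \<le> 1" using norm_powr_le_1[OF aQ] b0 e0 by simp
      hence "k * norm a powr (-(b + e)) \<le> 1/2 * 1" using k by (intro mult_mono) auto
      thus "\<kappa> a \<le> 1/2" by (simp add: \<kappa>_def)
      have "1 / \<Sigma> \<le> 1 / k powr (-s)" using \<Sigma> k by (intro divide_left_mono) auto
      also have "\<dots> = k powr s" by (simp add: powr_minus_divide)
      finally have "1 / \<Sigma> * norm a powr (-(s * (b + e))) \<le> k powr s * norm a powr (-(s * (b + e)))"
        by (rule mult_right_mono) simp
      also have "\<dots> = \<kappa> a powr s"
      proof -
        have "-(b + e) * s = -(s * (b + e))" by (simp add: algebra_simps)
        thus ?thesis unfolding \<kappa>_def powr_mult powr_powr by simp
      qed
      finally show "norm a powr (-(s * (b + e))) / \<Sigma> \<le> \<kappa> a powr s" by simp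
    qed
    show "\<pi> x \<in> escaping_R f c (radial_julia_set f c) R" if x: "\<And>i. x i \<in> A" for x
    proof -
      have "\<pi> x \<in> radial_julia_set f c" by (rule coded_in_radial_julia[OF x \<pi>[OF x]])
      moreover from this have "\<pi> x \<in> all_defined f c" by (simp add: radial_julia_set_def)
      moreover have "norm (F n (\<pi> x)) > R" for n
      proof -
        have "norm (x n - F n (\<pi> x)) < rad" using codesD(1)[OF \<pi>[OF x] x, of n] by (simp add: dist_norm)
        hence "norm (F n (\<pi> x)) > T - rad" using A(3)[OF x[of n]] norm_triangle_ineq2[of "x n" "F n (\<pi> x)"] by linarith
        thus ?thesis using rad C Rbr by (simp add: T_def)
      qed
      ultimately show ?thesis by (simp add: escaping_R_def)
    qed
    fix x y :: "nat \<Rightarrow> complex" and n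
    assume x: "\<And>i. x i \<in> A" and y: "\<And>i. y i \<in> A" and eq: "\<And>i. i < n \<Longrightarrow> x i = y i" and ne: "x n \<noteq> y n"
    have cx: "codes x (\<pi> x)" by (rule \<pi>) (rule x)
    have cy: "codes y (\<pi> y)" by (rule \<pi>) (rule y)
    show "\<delta> * (\<Prod>i<n. \<kappa> (x i)) \<le> norm (\<pi> x - \<pi> y)"
    proof (cases n)
      case 0
      have "D / 2 \<le> norm (F 0 (\<pi> x) - F 0 (\<pi> y))"
        by (rule codes_far_apart[OF x y cx cy]) (use ne 0 in simp)
      thus ?thesis using 0 by (simp add: \<delta>_def)
    next
      case (Suc n')
      let ?d = "\<lambda>i. norm (F i (\<pi> x) - F i (\<pi> y))"
      have g0: "norm (x i) > 0" for i using na[OF x[of i]] by linarith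
      have "norm (x 0) powr e * \<delta> * (\<Prod>i\<le>n'. k * norm (x i) powr (-(b + e))) \<le> ?d 0"
      proof (rule separation_product)
        show "k * norm (x i) powr (-b) * norm (x (Suc i)) powr (-e) * ?d (Suc i) \<le> ?d i" if "i < n'" for i
          unfolding k_def b_def e_def
          by (rule expansion_step[OF x y cx cy A1[OF x]]) (use eq that Suc in auto)
        \<comment> \<open>This factor, at most 1, is inserted at the last common letter so that the
          product runs over the whole prefix.\<close>
        have "k * norm (x n') powr (-b) \<le> 1 * 1"
        proof (rule mult_mono)
          show "norm (x n') powr (-b) \<le> 1" by (rule norm_powr_le_1) (use x AQ b0 in auto)
        qed (use k in auto)
        hence "\<delta> * (k * norm (x n') powr (-b)) \<le> \<delta> * 1" using \<delta> by (intro mult_left_mono) auto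
        also have "\<dots> \<le> \<delta>1" by (simp add: \<delta>_def)
        also have "\<dots> \<le> ?d n'"
        proof -
          have "x n' = y n'" "x (Suc n') \<noteq> y (Suc n')" using eq[of n'] ne Suc by auto
          moreover have "\<forall>n. x n \<in> A" "\<forall>n. y n \<in> A" using x y by blast+
          ultimately show ?thesis using \<delta>1(2) cx cy by blast
        qed
        finally show "\<delta> * k * norm (x n') powr (-b) \<le> ?d n'" by (simp only: mult.assoc)
      qed (use g0 k in auto)
      moreover have "(\<Prod>i\<le>n'. k * norm (x i) powr (-(b + e))) = (\<Prod>i<n. \<kappa> (x i))"
        unfolding \<kappa>_def Suc lessThan_Suc_atMost ..
      ultimately have le: "norm (x 0) powr e * \<delta> * (\<Prod>i<n. \<kappa> (x i)) \<le> norm (\<pi> x - \<pi> y)" by simp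
      have "1 \<le> norm (x 0) powr e" using na[OF x[of 0]] e0 by (simp add: ge_one_powr_ge_zero)
      moreover have "0 \<le> \<delta> * (\<Prod>i<n. \<kappa> (x i))"
        using \<delta> k by (intro mult_nonneg_nonneg prod_nonneg) (auto simp: \<kappa>_def)
      ultimately have "1 * (\<delta> * (\<Prod>i<n. \<kappa> (x i))) \<le> norm (x 0) powr e * (\<delta> * (\<Prod>i<n. \<kappa> (x i)))"
        by (rule mult_right_mono)
      thus ?thesis using le by (simp add: mult.assoc)
    qed
  qed
qed

end

text \<open>The eventual dimensions are defined by \<open>Lim\<close>, which can be evaluated only
  once convergence is known. Monotonicity is asked for from \<open>R\<close> on, since the
  dimensions are compared only where some Hausdorff measure is known to vanish.\<close>

lemma antimono_tendsto_at_top: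
  fixes g :: "real \<Rightarrow> real"
  assumes "\<And>x y. R \<le> x \<Longrightarrow> x \<le> y \<Longrightarrow> g y \<le> g x" "\<And>x. R \<le> x \<Longrightarrow> 0 \<le> g x"
  obtains l where "(g \<longlongrightarrow> l) at_top"
proof -
  have bdd: "bdd_below (g ` {R..})" by (rule bdd_belowI[of _ 0]) (use assms(2) in auto)
  have "(g \<longlongrightarrow> Inf (g ` {R..})) at_top"
  proof (rule decreasing_tendsto)
    show "\<forall>\<^sub>F x in at_top. Inf (g ` {R..}) \<le> g x"
      using eventually_ge_at_top[of R] by eventually_elim (auto intro!: cInf_lower bdd)
    fix u assume "Inf (g ` {R..}) < u"
    then obtain x where x: "x \<ge> R" "g x < u" using cInf_less_iff[OF _ bdd] by auto
    show "\<forall>\<^sub>F y in at_top. g y < u"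
      using eventually_ge_at_top[of x] by eventually_elim (use assms(1)[OF x(1)] x(2) in \<open>auto intro: order_le_less_trans\<close>)
  qed
  thus thesis by (rule that)
qed

lemma escaping_R_mono: "J \<subseteq> J' \<Longrightarrow> R \<ge> R' \<Longrightarrow> escaping_R f c J R \<subseteq> escaping_R f c J' R'"
  by (force simp: escaping_R_def)

theorem theorem6p4:
  fixes f0 :: "complex \<Rightarrow> complex" and \<rho> :: real
    and Pstar :: "complex set" and Rstar Rdag \<beta> C :: real and M :: nat
  assumes transc: "transcendental_meromorphic f0"
    and order: "mero_order f0 = ereal \<rho>" and rho_pos: "\<rho> > 0"
    and KU1: "\<not> infinity_asymptotic_value f0"
    and KU2: "Pstar \<subseteq> poles f0" "finite (poles f0 - Pstar)" "Rstar > 0"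
             "\<And>a. a \<in> Pstar \<Longrightarrow> closure (sing_values f0) \<inter> cball a (2 * Rstar) = {}"
    and KU3: "Rdag > 0"
             "\<And>a1 a2. a1 \<in> poles f0 \<Longrightarrow> a2 \<in> poles f0 \<Longrightarrow> a1 \<noteq> a2 \<Longrightarrow>
                 ball a1 Rdag \<inter> ball a2 Rdag = {}"
    and KU4: "\<beta> \<ge> 0" "C \<ge> 1"
             "\<And>a. a \<in> Pstar \<Longrightarrow> 1 \<le> pole_mult f0 a \<and> pole_mult f0 a \<le> M"
             "\<And>a z. a \<in> Pstar \<Longrightarrow> z \<in> ball a Rdag \<Longrightarrow> z \<noteq> a \<Longrightarrow>
                 inverse C * (norm a powr (-\<beta>) / norm (z - a) ^ pole_mult f0 a) \<le> norm (f0 z) \<and>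
                 norm (f0 z) \<le> C * (norm a powr (-\<beta>) / norm (z - a) ^ pole_mult f0 a)"
             "\<And>a z. a \<in> Pstar \<Longrightarrow> z \<in> ball a Rdag \<Longrightarrow> z \<noteq> a \<Longrightarrow>
                 inverse C * (real (pole_mult f0 a) * norm a powr (-\<beta>) / norm (z - a) ^ (pole_mult f0 a + 1))
                   \<le> norm (deriv f0 z) \<and>
                 norm (deriv f0 z) \<le> C * (real (pole_mult f0 a) * norm a powr (-\<beta>) / norm (z - a) ^ (pole_mult f0 a + 1))"
  shows "\<exists>\<epsilon>>0. \<forall>c :: nat \<Rightarrow> complex. (\<forall>n. norm (c n) < \<epsilon>) \<longrightarrow>
           (\<forall>Ms. is_Mstar f0 \<rho> M Ms \<longrightarrow>
                \<rho> * real Ms / (\<beta> + real Ms + 1) \<le> eventual_hyp_dim f0 c) \<and>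
           eventual_hyp_dim f0 c \<le> eventual_dim f0 c \<and>
           eventual_dim f0 c \<le> \<rho> * real M / (\<beta> + real M + 1)"
proof -
  have pm: "plane_meromorphic f0" using transc by (simp add: transcendental_meromorphic_def)
  define Q where "Q = {a\<in>Pstar. 1 \<le> norm a}"
  have QP: "Q \<subseteq> Pstar" by (auto simp: Q_def)
  have finQ: "finite (poles f0 - Q)"
  proof (rule finite_subset)
    show "poles f0 - Q \<subseteq> (poles f0 - Pstar) \<union> (poles f0 \<inter> cball 0 1)" by (auto simp: Q_def)
    show "finite ((poles f0 - Pstar) \<union> (poles f0 \<inter> cball 0 1))"
      using KU2(2) finite_poles_Int_compact[OF pm compact_cball] by simp
  qed
  interpret pole_growth f0 Q Rdag \<beta> C M
  proof
    show "plane_meromorphic f0" by fact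
    show "Q \<subseteq> poles f0" using QP KU2(1) by blast
    show "finite (poles f0 - Q)" by fact
    show "1 \<le> norm a" if "a \<in> Q" for a using that by (simp add: Q_def)
    show "Rdag > 0" "\<beta> \<ge> 0" "C \<ge> 1" "\<not> infinity_asymptotic_value f0" by fact+
    show "ball a Rdag \<inter> ball b Rdag = {}" if "a \<in> poles f0" "b \<in> poles f0" "a \<noteq> b" for a b
      by (rule KU3(2)[OF that])
    show "pole_mult f0 a \<le> M" if "a \<in> Q" for a using KU4(3) QP that by blast
    show "inverse C * (norm a powr (-\<beta>) / norm (z - a) ^ pole_mult f0 a) \<le> norm (f0 z) \<and>
      norm (f0 z) \<le> C * (norm a powr (-\<beta>) / norm (z - a) ^ pole_mult f0 a)"
      if "a \<in> Q" "z \<in> ball a Rdag" "z \<noteq> a" for a z by (rule KU4(4)) (use that QP in auto)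
    show "deriv f0 z \<noteq> 0" if "a \<in> Q" "z \<in> ball a Rdag" "z \<noteq> a" for a z
    proof -
      have aP: "a \<in> Pstar" using that QP by blast
      have "norm a > 0" using that by (auto simp: Q_def)
      hence "0 < real (pole_mult f0 a) * norm a powr (-\<beta>) / norm (z - a) ^ (pole_mult f0 a + 1)"
        using KU4(3)[OF aP] that(3) by (intro divide_pos_pos mult_pos_pos) (auto simp: powr_gt_zero)
      hence "0 < inverse C * (real (pole_mult f0 a) * norm a powr (-\<beta>) / norm (z - a) ^ (pole_mult f0 a + 1))"
        using KU4(2) by (intro mult_pos_pos) auto
      thus ?thesis using KU4(5)[OF aP that(2,3)] by auto
    qed
  qed
  define d where "d = \<rho> * real M / (\<beta> + real M + 1)"
  have d0: "d \<ge> 0" using rho_pos KU4(1) by (simp add: d_def)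
  have null: "\<exists>R1. \<forall>R\<ge>R1. \<forall>c J. (\<forall>n. norm (c n) < 1) \<longrightarrow> hausdorff_content t (escaping_R f0 c J R) = 0" if t: "t > d" for t
  proof -
    \<comment> \<open>For positive \<open>M\<close> this is the exponent of the pole series in the
      worst case of multiplicity \<open>M\<close>, and \<open>s > \<rho>\<close> amounts to
      \<open>t > d\<close>. For \<open>M = 0\<close> the set \<open>Q\<close> is empty and any
      exponent above \<rho> will do.\<close>
    define s where "s = (if M = 0 then \<rho> + 1 else t * (1 + 1 / real M + \<beta> / real M))"
    have "s > \<rho>"
    proof (cases "M = 0")
      case False
      have "\<rho> * real M < t * (\<beta> + real M + 1)"
        using t KU4(1) by (simp add: d_def pos_divide_less_eq)
      thus ?thesis using False by (simp add: s_def field_simps)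
    qed (simp add: s_def)
    hence "(\<lambda>a. norm a powr (-s)) summable_on poles f0" using poles_summable[OF pm order _ rho_pos] by blast
    hence sm: "(\<lambda>a. norm a powr (-s)) summable_on Q"
      by (rule summable_on_subset_banach) (use QP KU2(1) in blast)
    have le: "s \<le> t * (1 + 1 / real (pole_mult f0 a) + \<beta> / real (pole_mult f0 b))" if ab: "a \<in> Q" "b \<in> Q" for a b
    proof -
      have m: "1 \<le> pole_mult f0 a" "pole_mult f0 a \<le> M" "1 \<le> pole_mult f0 b" "pole_mult f0 b \<le> M"
        using mult_ge_1 mult_le ab by blast+
      have "1 + 1 / real M + \<beta> / real M \<le> 1 + 1 / real (pole_mult f0 a) + \<beta> / real (pole_mult f0 b)"
        using m KU4(1) by (intro add_mono divide_left_mono) auto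
      thus ?thesis using m t d0 by (auto simp: s_def intro!: mult_left_mono)
    qed
    have "t > 0" using t d0 by linarith
    from escaping_null[OF this le sm] show ?thesis by (metis (no_types, lifting))
  qed
  have "\<forall>c :: nat \<Rightarrow> complex. (\<forall>n. norm (c n) < 1) \<longrightarrow>
           (\<forall>Ms. is_Mstar f0 \<rho> M Ms \<longrightarrow>
                \<rho> * real Ms / (\<beta> + real Ms + 1) \<le> eventual_hyp_dim f0 c) \<and>
           eventual_hyp_dim f0 c \<le> eventual_dim f0 c \<and>
           eventual_dim f0 c \<le> \<rho> * real M / (\<beta> + real M + 1)"
  proof (intro allI impI)
    fix c :: "nat \<Rightarrow> complex" assume c: "\<forall>n. norm (c n) < 1"
    define g where "g J R = hausdorff_dim (escaping_R f0 c J R)" for J R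
    let ?J = "julia_set f0 c" and ?Jr = "radial_julia_set f0 c"
    have JrJ: "?Jr \<subseteq> ?J" by (auto simp: radial_julia_set_def)
    \<comment> \<open>The exponent \<open>d + 1\<close> is a reference value: from \<open>R1\<close>
      on it makes the infimum defining each dimension one over a nonempty set.\<close>
    obtain R1 where "\<forall>R\<ge>R1. \<forall>c J. (\<forall>n. norm (c n) < 1) \<longrightarrow> hausdorff_content (d + 1) (escaping_R f0 c J R) = 0"
      using null[of "d + 1"] by auto
    hence R1: "hausdorff_content (d + 1) (escaping_R f0 c J R) = 0" if "R \<ge> R1" for R J
      using c that by blast
    have d1: "d + 1 > 0" using d0 by simp
    have anti: "g J R' \<le> g J R" if "R1 \<le> R" "R \<le> R'" for J R R'
      unfolding g_def by (rule hausdorff_dim_mono[OF escaping_R_mono[OF order_refl that(2)] d1 R1[OF that(1)]])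
    have nonneg: "0 \<le> g J R" if "R1 \<le> R" for J R
      unfolding g_def by (rule hausdorff_dim_nonneg[OF d1 R1[OF that]])
    obtain l where l: "(g ?J \<longlongrightarrow> l) at_top"
      by (rule antimono_tendsto_at_top[of R1 "g ?J"]) (use anti nonneg in auto)
    obtain lr where lr: "(g ?Jr \<longlongrightarrow> lr) at_top"
      by (rule antimono_tendsto_at_top[of R1 "g ?Jr"]) (use anti nonneg in auto)
    have ed: "eventual_dim f0 c = l"
      unfolding eventual_dim_def using tendsto_Lim[OF _ l] by (simp add: g_def[abs_def])
    have ehd: "eventual_hyp_dim f0 c = lr"
      unfolding eventual_hyp_dim_def using tendsto_Lim[OF _ lr] by (simp add: g_def[abs_def])
    have "lr \<le> l"
    proof (rule tendsto_le[OF _ l lr])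
      show "\<forall>\<^sub>F R in at_top. g ?Jr R \<le> g ?J R"
        using eventually_ge_at_top[of R1]
      proof eventually_elim
        case (elim R)
        show ?case unfolding g_def by (rule hausdorff_dim_mono[OF escaping_R_mono[OF JrJ order_refl] d1 R1[OF elim]])
      qed
    qed simp
    moreover have "l \<le> d"
    proof (rule dense_ge)
      fix t assume t: "d < t"
      obtain R2 where "\<forall>R\<ge>R2. \<forall>c J. (\<forall>n. norm (c n) < 1) \<longrightarrow> hausdorff_content t (escaping_R f0 c J R) = 0"
        using null[OF t] by blast
      hence R2: "hausdorff_content t (escaping_R f0 c J R) = 0" if "R \<ge> R2" for R J
        using c that by blast
      have t0: "t > 0" using t d0 by linarith
      show "l \<le> t"
      proof (rule tendsto_upperbound[OF l])
        show "\<forall>\<^sub>F R in at_top. g ?J R \<le> t"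
          using eventually_ge_at_top[of R2] by eventually_elim (auto simp: g_def intro!: hausdorff_dim_le[OF t0] R2)
      qed simp
    qed
    moreover have "\<rho> * real Ms / (\<beta> + real Ms + 1) \<le> lr" if Ms: "is_Mstar f0 \<rho> M Ms" for Ms
    proof (rule tendsto_lowerbound[OF lr])
      show "\<forall>\<^sub>F R in at_top. \<rho> * real Ms / (\<beta> + real Ms + 1) \<le> g ?Jr R"
        using eventually_ge_at_top[of R1]
      proof eventually_elim
        case (elim R)
        show ?case unfolding g_def
        proof (rule hausdorff_dim_ge[OF d1 R1[OF elim]])
          fix s assume s: "s > 0" "s < \<rho> * real Ms / (\<beta> + real Ms + 1)"
          have M1: "Ms \<ge> 1" and mprop: "Mstar_prop f0 \<rho> Ms" using Ms by (auto simp: is_Mstar_def)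
          \<comment> \<open>The upper bound on \<open>s\<close> is equivalent to
            \<open>e < \<rho>\<close>, so the series over the poles of order \<open>Ms\<close>
            diverges at the exponent \<open>e\<close>.\<close>
          define e where "e = s * (\<beta> / real Ms + (1 + 1 / real Ms))"
          have "s * (\<beta> + real Ms + 1) < \<rho> * real Ms" using s(2) KU4(1) by (simp add: pos_less_divide_eq)
          hence "e < \<rho>" using M1 by (simp add: e_def field_simps)
          hence ns: "\<not> (\<lambda>a. norm a powr (-e)) summable_on {a \<in> poles f0. pole_mult f0 a = Ms}"
            using mprop by (simp add: Mstar_prop_def)
          have "\<not> (\<lambda>a. norm a powr (-e)) summable_on {a \<in> Q. pole_mult f0 a = Ms}"
          proof
            assume 1: "(\<lambda>a. norm a powr (-e)) summable_on {a \<in> Q. pole_mult f0 a = Ms}"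
            have 2: "(\<lambda>a. norm a powr (-e)) summable_on {a \<in> poles f0 - Q. pole_mult f0 a = Ms}"
              by (rule summable_on_finite, rule finite_subset[OF _ finQ]) auto
            have "(\<lambda>a. norm a powr (-e)) summable_on ({a \<in> Q. pole_mult f0 a = Ms} \<union> {a \<in> poles f0 - Q. pole_mult f0 a = Ms})"
              by (rule summable_on_Un_disjoint[OF 1 2]) auto
            moreover have "{a \<in> Q. pole_mult f0 a = Ms} \<union> {a \<in> poles f0 - Q. pole_mult f0 a = Ms} = {a \<in> poles f0. pole_mult f0 a = Ms}"
              using QP KU2(1) by auto
            ultimately show False using ns by simp
          qed
          thus "hausdorff_content s (escaping_R f0 c ?Jr R) \<noteq> 0"
            unfolding e_def using c by (intro radial_escaping_content_pos[OF M1 s(1)]) auto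
        qed
      qed
    qed simp
    ultimately show "(\<forall>Ms. is_Mstar f0 \<rho> M Ms \<longrightarrow> \<rho> * real Ms / (\<beta> + real Ms + 1) \<le> eventual_hyp_dim f0 c) \<and>
           eventual_hyp_dim f0 c \<le> eventual_dim f0 c \<and>
           eventual_dim f0 c \<le> \<rho> * real M / (\<beta> + real M + 1)"
      unfolding ed ehd d_def by blast
  qed
  thus ?thesis by (intro exI[of _ 1]) simp
qed

end
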